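(* WMISP restricted to $U_5$-free tournaments can be solved in polynomial time.
   Context: All tournaments are finite. A tournament $G$ is $H$-free if no induced subtournament of $G$ is isomorphic to $H$. For odd $n\ge 1$, $T_n$ is the tournament on $\{v_1,\dots,v_n\}$ with $v_i \to v_j$ iff $j-i \equiv 1,2,\dots,\frac{n-1}{2} \pmod n$, and $U_n$ is obtained from $T_n$ by reversing all arcs with both ends in $\{v_1,\dots,v_{(n-1)/2}\}$. In particular $U_5$ is obtained from $T_5$ by reversing the arc between $v_1$ and $v_2$. A set $X \subseteq V(G)$ is independent if $G[X]$ is transitive (acyclic). WMISP: given a tournament $G$ and a weight function $w: V(G)\to \mathbb{Q}_+$, find the maximum total weight of an independent set of $G$. *)

theory Defs
  imports
    "Graph_Theory.Graph_Theory"
    "HOL-Library.Log_Nat"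
    "HOL-Computational_Algebra.Polynomial"
begin

section \<open>Tournaments\<close>

locale tournament = pair_digraph G for G :: "'a pair_pre_digraph" +
  assumes one_arc: "\<lbrakk>u \<in> pverts G; v \<in> pverts G; u \<noteq> v\<rbrakk> \<Longrightarrow> (u, v) \<in> parcs G \<longleftrightarrow> (v, u) \<notin> parcs G"

definition tournament_free :: "'a pair_pre_digraph \<Rightarrow> 'b pair_pre_digraph \<Rightarrow> bool" where
  "tournament_free G H \<longleftrightarrow> (\<forall>X \<subseteq> pverts G. \<not> digraph_iso (with_proj G \<restriction> X) (with_proj H))"

definition T_tour :: "nat \<Rightarrow> nat pair_pre_digraph" where
  "T_tour n = \<lparr> pverts = {1..n},
     parcs = {(i, j). i \<in> {1..n} \<and> j \<in> {1..n} \<and>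
                (int j - int i) mod int n \<in> {1..(int n - 1) div 2}} \<rparr>"

definition U_tour :: "nat \<Rightarrow> nat pair_pre_digraph" where
  "U_tour n = (let A = parcs (T_tour n); B = {1..(n - 1) div 2} \<times> {1..(n - 1) div 2}
     in \<lparr> pverts = {1..n}, parcs = (A - B) \<union> (A \<inter> B)\<inverse> \<rparr>)"

definition independent_set :: "'a pair_pre_digraph \<Rightarrow> 'a set \<Rightarrow> bool" where
  "independent_set G X \<longleftrightarrow> X \<subseteq> pverts G \<and> trans (arcs_ends (with_proj G \<restriction> X))"

definition max_independent_weight :: "'a pair_pre_digraph \<Rightarrow> ('a \<Rightarrow> rat) \<Rightarrow> rat" where
  "max_independent_weight G w = Max {\<Sum>v\<in>X. w v | X. independent_set G X}"

lemma parcs_T_tour_5: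
  "parcs (T_tour 5) = {(1,2),(1,3),(2,3),(2,4),(3,4),(3,5),(4,5),(4,1),(5,1),(5,2)}"
proof -
  have V: "{1..5} = set [1, 2, 3, 4, 5::nat]"
    by auto
  have "parcs (T_tour 5) = {e \<in> {1..5} \<times> {1..5}. (int (snd e) - int (fst e)) mod 5 \<in> {1..2}}"
    unfolding T_tour_def by (rule set_eqI) (simp add: case_prod_beta mem_Times_iff conj_assoc)
  also have "\<dots> = set (filter (\<lambda>e. (int (snd e) - int (fst e)) mod 5 \<in> {1..2})
      (List.product [1, 2, 3, 4, 5] [1, 2, 3, 4, 5]))"
    unfolding V set_filter set_product ..
  also have "\<dots> = {(1,2),(1,3),(2,3),(2,4),(3,4),(3,5),(4,5),(4,1),(5,1),(5,2)}"
    by simp blast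
  finally show ?thesis .
qed

lemma parcs_U_tour_5:
  "parcs (U_tour 5) = {(2,1),(1,3),(2,3),(2,4),(3,4),(3,5),(4,5),(4,1),(5,1),(5,2)}"
proof -
  have "(parcs (T_tour 5) \<inter> {1..2} \<times> {1..2})\<inverse> = {(2, 1)}"
    unfolding parcs_T_tour_5 by auto
  then show ?thesis
    by (simp add: U_tour_def Let_def parcs_T_tour_5 insert_Diff_if)
qed

lemma tournament_U_tour_5: "tournament (U_tour 5)"
proof -
  have V: "pverts (U_tour 5) = {1, 2, 3, 4, 5}" by (auto simp: U_tour_def Let_def)
  have "finite (pverts (U_tour 5))" "finite (parcs (U_tour 5))"
    by (simp_all add: V parcs_U_tour_5)
  moreover have "\<forall>e \<in> parcs (U_tour 5).
      fst e \<in> pverts (U_tour 5) \<and> snd e \<in> pverts (U_tour 5) \<and> fst e \<noteq> snd e"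
    by (simp add: V parcs_U_tour_5)
  moreover have "\<forall>u \<in> pverts (U_tour 5). \<forall>v \<in> pverts (U_tour 5). u \<noteq> v \<longrightarrow>
      (u, v) \<in> parcs (U_tour 5) \<longleftrightarrow> (v, u) \<notin> parcs (U_tour 5)"
    by (simp add: V parcs_U_tour_5)
  ultimately show ?thesis
    by unfold_locales blast+
qed

lemma (in tournament) independent_set_iff_acyclic:
  "independent_set G X \<longleftrightarrow> X \<subseteq> pverts G \<and> acyclic (arcs_ends (with_proj G \<restriction> X))"
proof (cases "X \<subseteq> pverts G")
  case True
  define r where "r = arcs_ends (with_proj G \<restriction> X)"
  have r: "(u, v) \<in> r \<longleftrightarrow> u \<in> X \<and> v \<in> X \<and> (u, v) \<in> parcs G" for u v
    by (auto simp: r_def induce_subgraph_def arcs_ends_conv with_proj_def image_iff)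
  have irr: "(u, u) \<notin> parcs G" for u
    using pair_no_loops[of "(u, u)"] by auto
  have "trans r \<longleftrightarrow> acyclic r"
  proof
    assume "trans r"
    then show "acyclic r" using irr r by (simp add: acyclic_def)
  next
    assume acyc: "acyclic r"
    show "trans r"
    proof (rule transI)
      fix x y z assume xy: "(x, y) \<in> r" and yz: "(y, z) \<in> r"
      then have p: "(x, z) \<in> r\<^sup>+" by auto
      then have "x \<noteq> z" using acyc by (auto simp: acyclic_def)
      moreover have "(z, x) \<notin> r"
        using p acyc by (meson acyclic_def trancl.trancl_into_trancl)
      ultimately show "(x, z) \<in> r"
        using xy yz True one_arc[of x z] r by blast
    qed
  qed
  then show ?thesis using True by (simp add: independent_set_def r_def)
qed (simp add: independent_set_def)

section \<open>Polynomial time\<close>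

text \<open>
  The machine model is the random access machine of Aho, Hopcroft and Ullman under the
  logarithmic cost criterion, with structured control flow in place of jumps and natural
  numbers as cell contents.  Every access is charged the bit lengths of the addresses and
  contents involved, so that its running time is polynomially related to that of a
  Turing machine even though multiplication and division are available.
\<close>

datatype operand = Imm nat | Dir nat | Ind nat

datatype target = Cell nat | At nat

datatype arith = Add | Sub | Mul | Div

datatype cond = Less operand operand | Equal operand operand

datatype com =
    Skip
  | Assign target arith operand operand
  | Seq com com
  | If cond com com
  | While cond com

type_synonym mem = "nat \<Rightarrow> nat"

text \<open>Zero still occupies one bit.\<close>

definition bits :: "nat \<Rightarrow> nat" where
  "bits k = max 1 (floorlog 2 k)"

fun val :: "mem \<Rightarrow> operand \<Rightarrow> nat" where
  "val m (Imm k) = k"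
| "val m (Dir i) = m i"
| "val m (Ind i) = m (m i)"

fun val_cost :: "mem \<Rightarrow> operand \<Rightarrow> nat" where
  "val_cost m (Imm k) = bits k"
| "val_cost m (Dir i) = bits i + bits (m i)"
| "val_cost m (Ind i) = bits i + bits (m i) + bits (m (m i))"

fun addr :: "mem \<Rightarrow> target \<Rightarrow> nat" where
  "addr m (Cell i) = i"
| "addr m (At i) = m i"

fun addr_cost :: "mem \<Rightarrow> target \<Rightarrow> nat" where
  "addr_cost m (Cell i) = bits i"
| "addr_cost m (At i) = bits i + bits (m i)"

fun arith_val :: "arith \<Rightarrow> nat \<Rightarrow> nat \<Rightarrow> nat" where
  "arith_val Add a b = a + b"
| "arith_val Sub a b = a - b"
| "arith_val Mul a b = a * b"
| "arith_val Div a b = a div b"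

fun holds :: "mem \<Rightarrow> cond \<Rightarrow> bool" where
  "holds m (Less x y) \<longleftrightarrow> val m x < val m y"
| "holds m (Equal x y) \<longleftrightarrow> val m x = val m y"

fun cond_cost :: "mem \<Rightarrow> cond \<Rightarrow> nat" where
  "cond_cost m (Less x y) = val_cost m x + val_cost m y"
| "cond_cost m (Equal x y) = val_cost m x + val_cost m y"

text \<open>\<open>exec c m t m'\<close>: started in memory \<open>m\<close>, program \<open>c\<close> halts with memory \<open>m'\<close> at cost \<open>t\<close>.\<close>

inductive exec :: "com \<Rightarrow> mem \<Rightarrow> nat \<Rightarrow> mem \<Rightarrow> bool" where
  Skip: "exec Skip m 1 m"
| Assign: "exec (Assign d f x y) m (addr_cost m d + val_cost m x + val_cost m y)
             (m(addr m d := arith_val f (val m x) (val m y)))"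
| Seq: "\<lbrakk>exec c1 m t1 m'; exec c2 m' t2 m''\<rbrakk> \<Longrightarrow> exec (Seq c1 c2) m (t1 + t2) m''"
| IfTrue: "\<lbrakk>holds m b; exec c1 m t m'\<rbrakk> \<Longrightarrow> exec (If b c1 c2) m (cond_cost m b + t) m'"
| IfFalse: "\<lbrakk>\<not> holds m b; exec c2 m t m'\<rbrakk> \<Longrightarrow> exec (If b c1 c2) m (cond_cost m b + t) m'"
| WhileFalse: "\<not> holds m b \<Longrightarrow> exec (While b c) m (cond_cost m b) m"
| WhileTrue: "\<lbrakk>holds m b; exec c m t1 m'; exec (While b c) m' t2 m''\<rbrakk>
    \<Longrightarrow> exec (While b c) m (cond_cost m b + t1 + t2) m''"

inductive_cases SkipE: "exec Skip m t m'"
inductive_cases AssignE: "exec (Assign d f x y) m t m'"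
inductive_cases SeqE: "exec (Seq c1 c2) m t m'"
inductive_cases IfE: "exec (If b c1 c2) m t m'"
inductive_cases WhileE: "exec (While b c) m t m'"

lemma exec_deterministic: "exec c m t m' \<Longrightarrow> exec c m u m'' \<Longrightarrow> t = u \<and> m' = m''"
proof (induction arbitrary: u m'' rule: exec.induct)
  case (Skip m)
  then show ?case by (auto elim: SkipE)
next
  case (Assign d f x y m)
  then show ?case by (auto elim: AssignE)
next
  case (Seq c1 m t1 m' c2 t2 m'')
  then show ?case by (metis SeqE)
next
  case (IfTrue m b c1 t m' c2)
  then show ?case by (metis IfE)
next
  case (IfFalse m b c2 t m' c1)
  then show ?case by (metis IfE)
next
  case (WhileFalse m b c)
  then show ?case by (metis WhileE)
next
  case (WhileTrue m b c t1 m' t2 m'')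
  from WhileTrue.prems obtain s1 s2 k where
    "exec c m s1 k" "exec (While b c) k s2 m''" "u = cond_cost m b + s1 + s2"
    by (rule WhileE) (use WhileTrue.hyps(1) in auto)
  then show ?case using WhileTrue.IH by blast
qed

definition load :: "nat list \<Rightarrow> mem" where
  "load xs = (\<lambda>i. if i < length xs then xs ! i else 0)"

definition input_size :: "nat list \<Rightarrow> nat" where
  "input_size xs = (\<Sum>x\<leftarrow>xs. bits x)"

text \<open>
  One program and one polynomial serve all instances in \<open>D\<close>; nothing is required of the
  program on other inputs.  \<open>answer x m\<close> says that the final memory \<open>m\<close> holds a correct
  answer for the instance \<open>x\<close>.
\<close>

definition poly_time_solvable ::
    "'i set \<Rightarrow> ('i \<Rightarrow> nat list) \<Rightarrow> ('i \<Rightarrow> mem \<Rightarrow> bool) \<Rightarrow> bool" where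
  "poly_time_solvable D enc answer \<longleftrightarrow>
     (\<exists>(c :: com) (p :: nat poly). \<forall>x \<in> D. \<exists>t m.
        exec c (load (enc x)) t m \<and> t \<le> poly p (input_size (enc x)) \<and> answer x m)"

section \<open>The weighted maximum independent set problem\<close>

type_synonym wmisp_instance = "nat pair_pre_digraph \<times> (nat \<Rightarrow> rat)"

definition WMISP :: "wmisp_instance set" where
  "WMISP = {(G, w). tournament G \<and> (\<exists>n. pverts G = {..<n}) \<and> (\<forall>v \<in> pverts G. 0 \<le> w v)}"

text \<open>
  The number of vertices, the adjacency matrix row by row, and then numerator and
  denominator of each weight in lowest terms.
\<close>

definition wmisp_encode :: "wmisp_instance \<Rightarrow> nat list" where
  "wmisp_encode = (\<lambda>(G, w). let n = card (pverts G) in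
     n # [if (u, v) \<in> parcs G then 1 else 0. u \<leftarrow> [0..<n], v \<leftarrow> [0..<n]]
       @ concat (map (\<lambda>v. case quotient_of (w v) of (a, b) \<Rightarrow> [nat a, nat b]) [0..<n]))"

text \<open>The answer is a fraction with numerator in cell 0 and denominator in cell 1.\<close>

definition wmisp_answer :: "wmisp_instance \<Rightarrow> mem \<Rightarrow> bool" where
  "wmisp_answer = (\<lambda>(G, w) m. m 1 \<noteq> 0 \<and> of_nat (m 0) / of_nat (m 1) = max_independent_weight G w)"

end

theory Submission
  imports Defs
begin

text \<open>
  A module is a set of vertices that every outside vertex either dominates completely or is
  dominated by completely. An optimum is preserved when a module is contracted to one vertex whose
  weight is the optimum inside the module, so it suffices to solve the problem inside modules that
  are minimal, i.e. generated by any two of their vertices.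

  If \<open>c \<rightarrow> a\<close> and a cyclic triangle lies in \<open>N\<^sup>+(a) \<inter> N\<^sup>-(c)\<close>, then U5-freeness forces the whole module
  generated by the triangle to stay inside \<open>N\<^sup>+(a) \<inter> N\<^sup>-(c)\<close>; hence this never happens inside a
  minimal module. Consequently, for \<open>s \<rightarrow> t \<rightarrow> u\<close> with \<open>s \<rightarrow> u\<close> in a minimal module, one of \<open>s\<close> and \<open>t\<close> is
  redundant for the common out-neighbourhood of the three. So the common out-neighbourhood of a
  transitive set, listed in its order, is always that of two of its vertices, and a dynamic program
  over pairs finds the optimum.
\<close>

section \<open>Tournaments without U5\<close>

text \<open>The common out-neighbourhood matters because it is all that a transitive set shows to
  the vertices appended behind it. In a general tournament it can depend on arbitrarily many members
  of the set, and no table of polynomial size is in sight.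

  The contradiction with minimality comes from strong connectivity: a maximal strongly connected set
  that contains the triangle and lies between \<open>a\<close> and \<open>c\<close> is a module,
  misses \<open>a\<close>, and shares two vertices with the given module. Contraction keeps one
  vertex of the module and deletes the others, so the hypotheses are inherited and as many rounds as
  there are vertices suffice.

  Time is the second concern. Costs are logarithmic, so not only the number of steps but also the
  length of all stored numbers has to stay polynomial. Weights are scaled to natural numbers by the
  product of all denominators, after which the program only copies, adds and compares. The bounds
  are then read off the syntax of a language in which every loop runs \<open>n\<close>
  times.\<close>

definition tour_on :: "('a \<Rightarrow> 'a \<Rightarrow> bool) \<Rightarrow> 'a set \<Rightarrow> bool" where
  "tour_on E A \<longleftrightarrow> finite A \<and> (\<forall>u\<in>A. \<forall>v\<in>A. E u v \<longleftrightarrow> u \<noteq> v \<and> \<not> E v u)"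

text \<open>The ten arcs of \<open>U_tour 5\<close>, with \<open>p1\<close> to \<open>p5\<close> in
  the places of the vertices 1 to 5. They join all ten pairs, so in a tournament, where loops are
  absent, the five vertices are automatically distinct.\<close>

definition U5_pattern :: "('a \<Rightarrow> 'a \<Rightarrow> bool) \<Rightarrow> 'a \<Rightarrow> 'a \<Rightarrow> 'a \<Rightarrow> 'a \<Rightarrow> 'a \<Rightarrow> bool" where
  "U5_pattern E p1 p2 p3 p4 p5 \<longleftrightarrow> E p2 p1 \<and> E p1 p3 \<and> E p2 p3 \<and> E p2 p4 \<and> E p3 p4 \<and>
     E p3 p5 \<and> E p4 p5 \<and> E p4 p1 \<and> E p5 p1 \<and> E p5 p2"

definition U5_free_on :: "('a \<Rightarrow> 'a \<Rightarrow> bool) \<Rightarrow> 'a set \<Rightarrow> bool" where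
  "U5_free_on E A \<longleftrightarrow> (\<forall>p1\<in>A. \<forall>p2\<in>A. \<forall>p3\<in>A. \<forall>p4\<in>A. \<forall>p5\<in>A. \<not> U5_pattern E p1 p2 p3 p4 p5)"

text \<open>A closure condition: a vertex mixed on two members is a member. Only arcs leaving
  \<open>x\<close> occur, since in a tournament they determine those entering it. In this form the
  smallest module through given vertices arises by adding mixed vertices until none is left.\<close>

definition module_in :: "('a \<Rightarrow> 'a \<Rightarrow> bool) \<Rightarrow> 'a set \<Rightarrow> 'a set \<Rightarrow> bool" where
  "module_in E A C \<longleftrightarrow> C \<subseteq> A \<and> (\<forall>x\<in>A. \<forall>y\<in>C. \<forall>z\<in>C. E x y \<longrightarrow> \<not> E x z \<longrightarrow> x \<in> C)"

definition acyclic_in :: "('a \<Rightarrow> 'a \<Rightarrow> bool) \<Rightarrow> 'a set \<Rightarrow> 'a set \<Rightarrow> bool" where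
  "acyclic_in E A X \<longleftrightarrow> X \<subseteq> A \<and> (\<forall>x\<in>X. \<forall>y\<in>X. \<forall>z\<in>X. E x y \<longrightarrow> E y z \<longrightarrow> E x z)"

text \<open>A relation between instance and value, so that an optimum is transported by exhibiting a
  set and a bound. Natural weights suffice because rational ones are scaled by a common
  denominator.\<close>

definition is_opt :: "('a \<Rightarrow> 'a \<Rightarrow> bool) \<Rightarrow> 'a set \<Rightarrow> ('a \<Rightarrow> nat) \<Rightarrow> nat \<Rightarrow> bool" where
  "is_opt E A w k \<longleftrightarrow> (\<exists>X. acyclic_in E A X \<and> sum w X = k) \<and> (\<forall>X. acyclic_in E A X \<longrightarrow> sum w X \<le> k)"

lemma tour_on_subset: "tour_on E A \<Longrightarrow> B \<subseteq> A \<Longrightarrow> tour_on E B"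
  unfolding tour_on_def by (meson finite_subset subset_iff)

lemma U5_free_on_subset: "U5_free_on E A \<Longrightarrow> B \<subseteq> A \<Longrightarrow> U5_free_on E B"
  unfolding U5_free_on_def by (meson subset_iff)

lemma acyclic_in_mono: "acyclic_in E A X \<Longrightarrow> Y \<subseteq> X \<Longrightarrow> A \<subseteq> B \<Longrightarrow> acyclic_in E B Y"
  unfolding acyclic_in_def by (meson subset_iff)

text \<open>Where transitivity fails on \<open>x\<close>, \<open>y\<close>, \<open>z\<close>,
  antisymmetry excludes \<open>z = x\<close>, which leaves the arc back from \<open>z\<close> to
  \<open>x\<close>. Triangles can be rotated, and this saves cases when modules are
  substituted.\<close>

lemma acyclic_in_iff_no_triangle:
  assumes "tour_on E A" "X \<subseteq> A"
  shows "acyclic_in E A X \<longleftrightarrow> (\<forall>x\<in>X. \<forall>y\<in>X. \<forall>z\<in>X. \<not> (E x y \<and> E y z \<and> E z x))"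
  using assms unfolding acyclic_in_def tour_on_def by (smt (verit) subset_iff)

section \<open>Strongly connected sets and modules between two vertices\<close>

definition strong :: "('a \<Rightarrow> 'a \<Rightarrow> bool) \<Rightarrow> 'a set \<Rightarrow> bool" where
  "strong E B \<longleftrightarrow> (\<forall>P. P \<subseteq> B \<longrightarrow> P \<noteq> {} \<longrightarrow> P \<noteq> B \<longrightarrow> (\<exists>p\<in>P. \<exists>q\<in>B - P. E p q))"

lemma strong_triangle:
  assumes "E x y" "E y z" "E z x"
  shows "strong E {x, y, z}"
  unfolding strong_def
proof (intro allI impI)
  fix P assume P: "P \<subseteq> {x, y, z}" "P \<noteq> {}" "P \<noteq> {x, y, z}"
  show "\<exists>p\<in>P. \<exists>q\<in>{x, y, z} - P. E p q"
  proof (rule ccontr)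
    assume "\<not> ?thesis"
    then have "x \<in> P \<Longrightarrow> y \<in> P" "y \<in> P \<Longrightarrow> z \<in> P" "z \<in> P \<Longrightarrow> x \<in> P"
      using assms by blast+
    with P show False by blast
  qed
qed

text \<open>A cut of \<open>insert x B\<close> either induces a proper cut of \<open>B\<close>,
  which an arc of \<open>B\<close> leaves, or separates \<open>x\<close> from \<open>B\<close>, and
  then \<open>x \<rightarrow> y\<close> or \<open>z \<rightarrow> x\<close> leaves it. Strong
  connectivity is phrased by cuts because the later arguments need an arc that leaves a prescribed
  cut.\<close>

lemma strong_insert:
  assumes "strong E B" "y \<in> B" "E x y" "z \<in> B" "E z x"
  shows "strong E (insert x B)"
  unfolding strong_def
proof (intro allI impI)
  fix P assume P: "P \<subseteq> insert x B" "P \<noteq> {}" "P \<noteq> insert x B"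
  consider "P - {x} = {}" | "P - {x} = B" | "P - {x} \<noteq> {}" "P - {x} \<noteq> B" "x \<notin> B" | "x \<in> B"
    by blast
  then show "\<exists>p\<in>P. \<exists>q\<in>insert x B - P. E p q"
  proof cases
    case 1
    then have "P = {x}" using P by blast
    show ?thesis
    proof (cases "y = x")
      case True
      then have "B \<noteq> {x}" "x \<in> B" using P \<open>P = {x}\<close> assms(2) by blast+
      then show ?thesis using \<open>P = {x}\<close> assms(1) unfolding strong_def
        by (metis empty_subsetI insert_absorb insert_not_empty insert_subset)
    next
      case False
      then show ?thesis using \<open>P = {x}\<close> assms by blast
    qed
  next
    case 2
    then have "P = B" "x \<notin> P" using P by blast+
    then show ?thesis using assms by blast
  next
    case 3
    then have "P - {x} \<subseteq> B" using P by blast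
    then obtain p q where "p \<in> P - {x}" "q \<in> B - (P - {x})" "E p q"
      using 3 assms(1) unfolding strong_def by (metis (no_types))
    then show ?thesis using 3 by blast
  next
    case 4
    then have "insert x B = B" by blast
    then show ?thesis using P assms(1) unfolding strong_def by auto
  qed
qed

text \<open>A vertex outside a strong set \<open>B\<close> that is mixed on \<open>B\<close> is mixed along arcs of \<open>B\<close> in both
  directions; unless it lies between \<open>a\<close> and \<open>c\<close> itself, one of these arcs completes a U5.\<close>

lemma strong_between_mixed:
  assumes T: "tour_on E A" and U: "U5_free_on E A"
    and a: "a \<in> A" and c: "c \<in> A" "E c a"
    and B: "B \<subseteq> A" "\<forall>b\<in>B. E a b \<and> E b c" "strong E B"
    and x: "x \<in> A" "x \<notin> B" "y \<in> B" "E x y" "z \<in> B" "\<not> E x z"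
  shows "E a x \<and> E x c"
proof (rule ccontr)
  assume neg: "\<not> ?thesis"
  have E: "E u v \<longleftrightarrow> u \<noteq> v \<and> \<not> E v u" if "u \<in> A" "v \<in> A" for u v
    using T that unfolding tour_on_def by blast
  have zx: "E z x" using E[of z x] x B by blast
  have "x \<noteq> a" using x B by blast
  have "x \<noteq> c" using x B E[of c y] c by blast
  define P where "P = {b \<in> B. E b x}"
  have nP: "E x q" if "q \<in> B - P" for q using that E[of x q] x B unfolding P_def by blast
  have "P \<subseteq> B" "P \<noteq> {}" "P \<noteq> B"
    using x zx E[of x y] B unfolding P_def by blast+
  then obtain b b' where bb: "b \<in> P" "b' \<in> B - P" "E b b'"
    using B(3) unfolding strong_def by meson
  have "B - P \<subseteq> B" "B - P \<noteq> {}" "B - P \<noteq> B"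
    using \<open>P \<subseteq> B\<close> \<open>P \<noteq> {}\<close> \<open>P \<noteq> B\<close> by blast+
  then obtain d' d where dd: "d' \<in> B - P" "d \<in> B - (B - P)" "E d' d"
    using B(3) unfolding strong_def by meson
  have b: "b \<in> A" "b' \<in> A" "E b x" "E x b'" "E a b" "E a b'" "E b c" "E b' c"
    using bb nP B unfolding P_def by blast+
  have d: "d \<in> A" "d' \<in> A" "E d x" "E x d'" "E a d" "E a d'" "E d c" "E d' c"
    using dd nP B unfolding P_def by blast+
  \<comment> \<open>The arc \<open>d' \<rightarrow> d\<close> forms a cyclic triangle with
    \<open>x\<close>, the arc \<open>b \<rightarrow> b'\<close> a transitive one. The first two
    positions of \<open>x\<close> relative to \<open>a\<close> and \<open>c\<close> call for the
    former, the third for the latter.\<close>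
  consider "E x a" "E x c" | "E a x" "E c x" | "E x a" "E c x"
    using neg E[of x a] E[of x c] \<open>x \<noteq> a\<close> \<open>x \<noteq> c\<close> x a c by blast
  then show False
  proof cases
    case 1
    have "U5_pattern E c x a d' d"
      unfolding U5_pattern_def using 1 d dd c by blast
    then show ?thesis using U d a c x unfolding U5_free_on_def by blast
  next
    case 2
    have "U5_pattern E x a d' d c"
      unfolding U5_pattern_def using 2 d dd c by blast
    then show ?thesis using U d a c x unfolding U5_free_on_def by blast
  next
    case 3
    have "U5_pattern E b' b c x a"
      unfolding U5_pattern_def using 3 b bb c by blast
    then show ?thesis using U b a c x unfolding U5_free_on_def by blast
  qed
qed

text \<open>Among the strongly connected sets that contain the triangle and lie between
  \<open>a\<close> and \<open>c\<close>, a maximal one is a module: a vertex mixed on it would lie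
  between \<open>a\<close> and \<open>c\<close> as well and could be added without losing strong
  connectivity.\<close>

lemma module_between:
  assumes T: "tour_on E A" and U: "U5_free_on E A"
    and ac: "a \<in> A" "c \<in> A" "E c a"
    and b: "b1 \<in> A" "b2 \<in> A" "b3 \<in> A" "E b1 b2" "E b2 b3" "E b3 b1"
    and ab: "E a b1" "E a b2" "E a b3" and bc: "E b1 c" "E b2 c" "E b3 c"
  obtains B where "module_in E A B" "b1 \<in> B" "b2 \<in> B" "a \<notin> B"
proof -
  define fam where "fam = {B. B \<subseteq> A \<and> {b1, b2, b3} \<subseteq> B \<and> (\<forall>b\<in>B. E a b \<and> E b c) \<and> strong E B}"
  have "finite fam"
    using T unfolding fam_def tour_on_def by (auto intro: finite_subset[of _ "Pow A"])
  moreover have "{b1, b2, b3} \<in> fam"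
    unfolding fam_def using strong_triangle[of E b1 b2 b3] b ab bc by blast
  ultimately obtain B where B: "B \<in> fam" "\<And>B'. B' \<in> fam \<Longrightarrow> B \<subseteq> B' \<Longrightarrow> B = B'"
    using finite_has_maximal2[of fam] by metis
  have E: "E u v \<longleftrightarrow> u \<noteq> v \<and> \<not> E v u" if "u \<in> A" "v \<in> A" for u v
    using T that unfolding tour_on_def by blast
  have "module_in E A B"
    unfolding module_in_def
  proof (intro conjI ballI impI)
    show "B \<subseteq> A" using B(1) unfolding fam_def by blast
  next
    fix x y z assume x: "x \<in> A" "y \<in> B" "z \<in> B" "E x y" "\<not> E x z"
    show "x \<in> B"
    proof (rule ccontr)
      assume nx: "x \<notin> B"
      have BA: "B \<subseteq> A" "\<forall>b\<in>B. E a b \<and> E b c" "strong E B"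
        using B(1) unfolding fam_def by blast+
      have "E z x" using E[of z x] x nx BA by blast
      have "E a x \<and> E x c"
        using strong_between_mixed[OF T U ac BA x(1) nx x(2) x(4) x(3) x(5)] .
      moreover have "strong E (insert x B)"
        using strong_insert[OF BA(3) x(2) x(4) x(3) \<open>E z x\<close>] .
      ultimately have "insert x B \<in> fam"
        using B(1) x(1) unfolding fam_def by blast
      then show False using B(2)[of "insert x B"] nx by blast
    qed
  qed
  moreover have "b1 \<in> B" "b2 \<in> B" "a \<notin> B"
    using B(1) E[of a a] ac unfolding fam_def by blast+
  ultimately show thesis using that by blast
qed

text \<open>The vertex that can be dispensed with is the middle argument: the common
  out-neighbourhood of the three within \<open>M\<close> is already that of \<open>s\<close> and
  \<open>u\<close>.\<close>

definition redundant :: "('a \<Rightarrow> 'a \<Rightarrow> bool) \<Rightarrow> 'a set \<Rightarrow> 'a \<Rightarrow> 'a \<Rightarrow> 'a \<Rightarrow> bool" where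
  "redundant E M s t u \<longleftrightarrow> (\<forall>x\<in>M. E s x \<longrightarrow> E u x \<longrightarrow> E t x)"

text \<open>Let \<open>c1\<close> witness that \<open>s\<close> cannot be dropped and
  \<open>c2\<close> that \<open>t\<close> cannot. An arc from \<open>c1\<close> to \<open>c2\<close>
  completes a U5. Otherwise the cyclic triangle \<open>t\<close>, \<open>u\<close>,
  \<open>c2\<close> lies between \<open>s\<close> and \<open>c1\<close>, and the resulting module
  contains \<open>t\<close> and \<open>u\<close> but not \<open>s\<close>, against the minimality of
  \<open>M\<close>.\<close>

lemma redundant_dichotomy:
  assumes T: "tour_on E A" and U: "U5_free_on E A" and MA: "M \<subseteq> A"
    and min: "\<And>B b1 b2. module_in E A B \<Longrightarrow> b1 \<in> B \<Longrightarrow> b2 \<in> B \<Longrightarrow> b1 \<in> M \<Longrightarrow> b2 \<in> M \<Longrightarrow> b1 \<noteq> b2 \<Longrightarrow> M \<subseteq> B"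
    and stu: "s \<in> M" "t \<in> M" "u \<in> M" "E s t" "E t u" "E s u"
  shows "redundant E M s t u \<or> redundant E M t s u"
proof (rule ccontr)
  assume "\<not> ?thesis"
  then obtain c1 c2 where c: "c1 \<in> M" "E t c1" "E u c1" "\<not> E s c1" "c2 \<in> M" "E s c2" "E u c2" "\<not> E t c2"
    unfolding redundant_def by blast
  have E: "E x y \<longleftrightarrow> x \<noteq> y \<and> \<not> E y x" if "x \<in> M" "y \<in> M" for x y
    using T that MA unfolding tour_on_def by blast
  have c1s: "E c1 s" using E[of c1 s] E[of s t] c stu by blast
  have c2t: "E c2 t" using E[of c2 t] E[of u t] c stu by blast
  have ne: "c1 \<noteq> c2" using c by blast
  show False
  proof (cases "E c1 c2")
    case True
    then have "U5_pattern E c2 s t u c1"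
      unfolding U5_pattern_def using c stu c1s c2t by blast
    then show False using U c stu MA unfolding U5_free_on_def by blast
  next
    case False
    then have "E c2 c1" using E[of c1 c2] c ne by blast
    moreover have "s \<in> A" "c1 \<in> A" "t \<in> A" "u \<in> A" "c2 \<in> A" using stu c MA by blast+
    ultimately obtain B where "module_in E A B" "t \<in> B" "u \<in> B" "s \<notin> B"
      using module_between[OF T U, of s c1 t u c2] c stu c1s c2t by blast
    then show False using min[of B t u] stu E[of t u] by blast
  qed
qed

section \<open>Transitive sets and the contraction of modules\<close>

lemma acyclic_sink:
  assumes T: "tour_on E A" and W: "acyclic_in E A W" "W \<noteq> {}"
  obtains u where "u \<in> W" "\<And>x. x \<in> W \<Longrightarrow> x \<noteq> u \<Longrightarrow> E x u"
proof -
  have "finite W" using T W unfolding tour_on_def acyclic_in_def by (meson finite_subset)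
  then have "W \<noteq> {} \<Longrightarrow> acyclic_in E A W \<Longrightarrow> \<exists>u\<in>W. \<forall>x\<in>W. x \<noteq> u \<longrightarrow> E x u"
  proof (induction W rule: finite_induct)
    case (insert a W)
    show ?case
    proof (cases "W = {}")
      case False
      then obtain u where u: "u \<in> W" "\<forall>x\<in>W. x \<noteq> u \<longrightarrow> E x u"
        using insert acyclic_in_mono[OF insert.prems(2), of W A] by blast
      have E: "E x y \<longleftrightarrow> x \<noteq> y \<and> \<not> E y x" if "x \<in> insert a W" "y \<in> insert a W" for x y
        using T that insert.prems unfolding tour_on_def acyclic_in_def by blast
      have tr: "E x z" if "x \<in> insert a W" "y \<in> insert a W" "z \<in> insert a W" "E x y" "E y z" for x y z
        using insert.prems that unfolding acyclic_in_def by blast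
      show ?thesis
      proof (cases "E a u")
        case True
        then show ?thesis using u by blast
      next
        case False
        then have "E u a" using E[of u a] u insert by blast
        have "\<forall>x\<in>insert a W. x \<noteq> a \<longrightarrow> E x a"
        proof (intro ballI impI)
          fix x assume "x \<in> insert a W" "x \<noteq> a"
          then show "E x a" using u \<open>E u a\<close> tr[of x u a] by (cases "x = u") auto
        qed
        then show ?thesis by blast
      qed
    qed blast
  qed simp
  then show thesis using that W by blast
qed

lemma module_uniform:
  assumes "tour_on E A" "module_in E A M" "x \<in> A" "x \<notin> M" "y \<in> M" "z \<in> M"
  shows "E x y \<longleftrightarrow> E x z" "E y x \<longleftrightarrow> E z x"
  using assms unfolding tour_on_def module_in_def by (metis subsetD)+

text \<open>Exchange in both directions: \<open>v\<close> is replaced by an optimal transitive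
  subset of \<open>M\<close>, and conversely the part of a transitive set inside \<open>M\<close> is
  replaced by \<open>v\<close>, whose weight \<open>k\<close> is at least as large. Vertices outside
  \<open>M\<close> do not distinguish its members, so neither exchange creates a cyclic
  triangle.\<close>

lemma is_opt_contract:
  assumes T: "tour_on E A" and M: "module_in E A M" and v: "v \<in> M" and k: "is_opt E M w k"
    and opt: "is_opt E (A - (M - {v})) (w(v := k)) r"
  shows "is_opt E A w r"
proof -
  have MA: "M \<subseteq> A" and fA: "finite A" and fM: "finite M"
    using T M unfolding module_in_def tour_on_def by (auto intro: finite_subset)
  define A' where "A' = A - (M - {v})"
  have A'A: "A' \<subseteq> A" unfolding A'_def by blast
  have T': "tour_on E A'" using tour_on_subset[OF T A'A] .
  have swap: "E x y \<longleftrightarrow> E x z" "E y x \<longleftrightarrow> E z x" if "x \<in> A" "x \<notin> M" "y \<in> M" "z \<in> M" for x y z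
    using module_uniform[OF T M that] by blast+
  have irr: "\<not> E x x" if "x \<in> A" for x using T that unfolding tour_on_def by blast
  show ?thesis
    unfolding is_opt_def
  proof (intro conjI allI impI)
    obtain X where X: "acyclic_in E A' X" "sum (w(v := k)) X = r"
      using opt unfolding is_opt_def A'_def by blast
    obtain Y where Y: "acyclic_in E M Y" "sum w Y = k" using k unfolding is_opt_def by blast
    have XA: "X \<subseteq> A" "X \<inter> M \<subseteq> {v}" using X(1) unfolding acyclic_in_def A'_def by blast+
    have fX: "finite X" using XA fA finite_subset by blast
    have YM: "Y \<subseteq> M" using Y(1) unfolding acyclic_in_def by blast
    have fY: "finite Y" using YM fM finite_subset by blast
    show "\<exists>X. acyclic_in E A X \<and> sum w X = r"
    proof (cases "v \<in> X")
      case False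
      then have "sum (w(v := k)) X = sum w X" by (intro sum.cong) auto
      then show ?thesis using X acyclic_in_mono[OF X(1) _ A'A] by auto
    next
      case True
      define Z where "Z = (X - {v}) \<union> Y"
      have "sum w Z = sum w (X - {v}) + k"
        unfolding Z_def using XA YM fX fY Y(2) by (subst sum.union_disjoint) auto
      also have "sum w (X - {v}) = sum (w(v := k)) (X - {v})" by (intro sum.cong) auto
      also have "\<dots> + k = r"
        using sum.remove[OF fX True, of "w(v := k)"] X(2) by simp
      finally have 1: "sum w Z = r" .
      have ZA: "Z \<subseteq> A" unfolding Z_def using XA YM MA by blast
      have tX: "\<not> (E x y \<and> E y z \<and> E z x)" if "x \<in> X" "y \<in> X" "z \<in> X" for x y z
        using X(1) that XA irr unfolding acyclic_in_def by blast
      have tY: "\<not> (E x y \<and> E y z \<and> E z x)" if "x \<in> Y" "y \<in> Y" "z \<in> Y" for x y z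
        using Y(1) that YM MA irr unfolding acyclic_in_def by (meson subsetD)
      have XM: "x \<in> A" "x \<notin> M" if "x \<in> X - {v}" for x using that XA by blast+
      \<comment> \<open>A triangle inside \<open>Y\<close> is excluded by \<open>tY\<close>; every
        other triangle of \<open>Z\<close> can be rotated so that its first vertex lies outside
        \<open>M\<close>.\<close>
      have one: "\<not> (E x y \<and> E y z \<and> E z x)" if xyz: "x \<in> X - {v}" "y \<in> Z" "z \<in> Z" for x y z
      proof
        assume cyc: "E x y \<and> E y z \<and> E z x"
        \<comment> \<open>If at most one of the other two vertices lies in \<open>Y\<close>, moving
          it to \<open>v\<close> gives a triangle in \<open>X\<close>. If both do, \<open>x\<close>
          would distinguish two members of \<open>M\<close>.\<close>
        define g where "g q = (if q \<in> Y then v else q)" for q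
        have g: "g q \<in> X" if "q \<in> Z" for q using that True unfolding g_def Z_def by auto
        consider "y \<in> Y" "z \<in> Y" | "y \<in> X - {v}" | "z \<in> X - {v}" using xyz Z_def by blast
        then show False
        proof cases
          case 1
          then have "E x y \<longleftrightarrow> E x z" using swap(1) XM[OF xyz(1)] YM by blast
          then show False using cyc T XM[OF xyz(1)] 1 YM MA unfolding tour_on_def by blast
        next
          case 2
          have y: "y \<in> A" "y \<notin> M" using XM[OF 2] .
          have "E y (g z)" "E (g z) x"
            using cyc swap[OF y, of z v] swap[OF XM[OF xyz(1)], of z v] YM v unfolding g_def by auto
          then show False using tX[of x y "g z"] cyc xyz 2 g by blast
        next
          case 3
          have z: "z \<in> A" "z \<notin> M" using XM[OF 3] .
          have "E x (g y)" "E (g y) z"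
            using cyc swap[OF z, of y v] swap[OF XM[OF xyz(1)], of y v] YM v unfolding g_def by auto
          then show False using tX[of x "g y" z] cyc xyz 3 g by blast
        qed
      qed
      have "acyclic_in E A Z"
        unfolding acyclic_in_iff_no_triangle[OF T ZA]
        using one tY unfolding Z_def by blast
      then show ?thesis using 1 by blast
    qed
  next
    fix X assume X: "acyclic_in E A X"
    have XA: "X \<subseteq> A" using X unfolding acyclic_in_def by blast
    have fX: "finite X" using XA fA finite_subset by blast
    have le: "sum (w(v := k)) Y \<le> r" if "acyclic_in E A' Y" for Y
      using opt that unfolding is_opt_def A'_def by blast
    show "sum w X \<le> r"
    proof (cases "X \<inter> M = {}")
      case True
      then have "acyclic_in E A' X"
        using X unfolding acyclic_in_def A'_def by blast
      moreover have "sum (w(v := k)) X = sum w X" using True v by (intro sum.cong) auto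
      ultimately show ?thesis using le by metis
    next
      case False
      then obtain y where y: "y \<in> X" "y \<in> M" by blast
      define Z where "Z = insert v (X - M)"
      have "acyclic_in E M (X \<inter> M)" using X unfolding acyclic_in_def by blast
      then have kle: "sum w (X \<inter> M) \<le> k" using k unfolding is_opt_def by blast
      have "sum w X = sum w (X - M) + sum w (X \<inter> M)"
        using fX by (subst sum.union_disjoint[symmetric]) (auto intro!: sum.cong)
      also have "\<dots> \<le> sum w (X - M) + k" using kle by simp
      also have "sum w (X - M) = sum (w(v := k)) (X - M)" using v by (intro sum.cong) auto
      also have "\<dots> + k = sum (w(v := k)) Z" unfolding Z_def using fX v by simp
      finally have 1: "sum w X \<le> sum (w(v := k)) Z" .
      \<comment> \<open>\<open>v\<close> need not belong to \<open>X\<close>, so a member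
        \<open>y\<close> of \<open>X \<inter> M\<close> stands in for it.\<close>
      define g where "g q = (if q = v then y else q)" for q
      have gX: "g q \<in> X" if "q \<in> Z" for q using that y unfolding g_def Z_def by auto
      have gE: "E (g p) (g q)" if "p \<in> Z" "q \<in> Z" "E p q" for p q
        using that swap[of q y v] swap[of p y v] y v XA irr[of v] MA unfolding g_def Z_def by auto
      have "acyclic_in E A' Z"
      proof (subst acyclic_in_iff_no_triangle[OF T'])
        show "Z \<subseteq> A'" using XA v MA unfolding Z_def A'_def by blast
        show "\<forall>x\<in>Z. \<forall>y\<in>Z. \<forall>z\<in>Z. \<not> (E x y \<and> E y z \<and> E z x)"
          using X gE gX unfolding acyclic_in_iff_no_triangle[OF T XA] by blast
      qed
      then show ?thesis using le 1 by (meson le_trans)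
    qed
  qed
qed

lemma is_opt_card_le_1:
  assumes "finite A" "card A \<le> 1"
  shows "is_opt E A w (sum w A)"
proof -
  have eq: "x = y" if "x \<in> A" "y \<in> A" for x y
    using assms that card_le_Suc0_iff_eq by force
  have "acyclic_in E A A" unfolding acyclic_in_def by (auto dest: eq)
  then show ?thesis
    unfolding is_opt_def using assms(1) sum_mono2[of A _ w] by (auto simp: acyclic_in_def)
qed

section \<open>A language of bounded loops\<close>

text \<open>Arrays are two-dimensional and are indexed by loop variables only; variable 0 is constantly 0,
  so that \<open>Arr k 0 0\<close> serves as a scalar and \<open>Arr k i 0\<close> as an entry of a vector.\<close>

datatype expr = Const nat | Var nat | Arr nat nat nat | Adj nat nat | Num nat | Den nat

datatype test = Lt expr expr | Eq expr expr

datatype stmt =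
    Nop
  | Put nat nat nat arith expr expr
  | Then stmt stmt (infixr \<open>;;\<close> 60)
  | Cond test stmt stmt
  | For nat stmt

type_synonym store = "nat \<Rightarrow> nat \<Rightarrow> nat \<Rightarrow> nat"

locale loop_semantics =
  fixes n :: nat and adj :: "nat \<Rightarrow> nat \<Rightarrow> nat" and num den :: "nat \<Rightarrow> nat"
begin

fun eval :: "(nat \<Rightarrow> nat) \<Rightarrow> store \<Rightarrow> expr \<Rightarrow> nat" where
  "eval e \<sigma> (Const k) = k"
| "eval e \<sigma> (Var i) = e i"
| "eval e \<sigma> (Arr k i j) = \<sigma> k (e i) (e j)"
| "eval e \<sigma> (Adj i j) = adj (e i) (e j)"
| "eval e \<sigma> (Num i) = num (e i)"
| "eval e \<sigma> (Den i) = den (e i)"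

fun test_holds :: "(nat \<Rightarrow> nat) \<Rightarrow> store \<Rightarrow> test \<Rightarrow> bool" where
  "test_holds e \<sigma> (Lt x y) \<longleftrightarrow> eval e \<sigma> x < eval e \<sigma> y"
| "test_holds e \<sigma> (Eq x y) \<longleftrightarrow> eval e \<sigma> x = eval e \<sigma> y"

definition put :: "store \<Rightarrow> nat \<Rightarrow> nat \<Rightarrow> nat \<Rightarrow> nat \<Rightarrow> store" where
  "put \<sigma> k u v a = \<sigma>(k := (\<sigma> k)(u := (\<sigma> k u)(v := a)))"

text \<open>The loop variables are kept apart from the store, so a body cannot disturb its own
  counter and every loop makes exactly \<open>n\<close> rounds. Time and growth can therefore be
  bounded by recursion on the syntax.\<close>

fun run :: "stmt \<Rightarrow> (nat \<Rightarrow> nat) \<Rightarrow> store \<Rightarrow> store" where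
  "run Nop e \<sigma> = \<sigma>"
| "run (Put k i j f x y) e \<sigma> = put \<sigma> k (e i) (e j) (arith_val f (eval e \<sigma> x) (eval e \<sigma> y))"
| "run (c ;; d) e \<sigma> = run d e (run c e \<sigma>)"
| "run (Cond b c d) e \<sigma> = (if test_holds e \<sigma> b then run c e \<sigma> else run d e \<sigma>)"
| "run (For j c) e \<sigma> = rec_nat \<sigma> (\<lambda>i \<tau>. run c (e(j := i)) \<tau>) n"

end

text \<open>\<open>X\<close> holds the variables in scope. Variable 0 may index arrays but not the
  input, because its value 0 is not below \<open>n\<close> when there are no vertices. The bounds by
  16 keep constants and array addresses within a fixed budget of bits.\<close>

fun wf_expr :: "nat set \<Rightarrow> expr \<Rightarrow> bool" where
  "wf_expr X (Const k) \<longleftrightarrow> k < 16"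
| "wf_expr X (Var i) \<longleftrightarrow> i \<in> X"
| "wf_expr X (Arr k i j) \<longleftrightarrow> 2 \<le> k \<and> k < 16 \<and> i \<in> X \<and> j \<in> X"
| "wf_expr X (Adj i j) \<longleftrightarrow> i \<in> X - {0} \<and> j \<in> X - {0}"
| "wf_expr X (Num i) \<longleftrightarrow> i \<in> X - {0}"
| "wf_expr X (Den i) \<longleftrightarrow> i \<in> X - {0}"

fun is_input :: "expr \<Rightarrow> bool" where
  "is_input (Num i) \<longleftrightarrow> True"
| "is_input (Den i) \<longleftrightarrow> True"
| "is_input _ \<longleftrightarrow> False"

fun wf_test :: "nat set \<Rightarrow> test \<Rightarrow> bool" where
  "wf_test X (Lt x y) \<longleftrightarrow> wf_expr X x \<and> wf_expr X y"
| "wf_test X (Eq x y) \<longleftrightarrow> wf_expr X x \<and> wf_expr X y"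

text \<open>Multiplication is only allowed by an input weight, so that a single assignment lengthens the
  stored numbers by no more than the input size.\<close>

fun wf_stmt :: "nat set \<Rightarrow> stmt \<Rightarrow> bool" where
  "wf_stmt X Nop \<longleftrightarrow> True"
| "wf_stmt X (Put k i j f x y) \<longleftrightarrow> 2 \<le> k \<and> k < 16 \<and> i \<in> X \<and> j \<in> X \<and> wf_expr X x \<and> wf_expr X y \<and>
     (f = Mul \<longrightarrow> is_input y)"
| "wf_stmt X (c ;; d) \<longleftrightarrow> wf_stmt X c \<and> wf_stmt X d"
| "wf_stmt X (Cond b c d) \<longleftrightarrow> wf_test X b \<and> wf_stmt X c \<and> wf_stmt X d"
| "wf_stmt X (For j c) \<longleftrightarrow> j < 8 \<and> j \<notin> X \<and> j \<noteq> 0 \<and> wf_stmt (insert j X) c"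

text \<open>Bounds the number of assignments executed, as a polynomial in a bound on
  \<open>n\<close>; each of them lengthens the longest number by at most the input size. The
  branches of a conditional are added because the maximum of two polynomials is in general not a
  polynomial.\<close>

fun growth :: "stmt \<Rightarrow> nat poly" where
  "growth Nop = 0"
| "growth (Put k i j f x y) = 1"
| "growth (c ;; d) = growth c + growth d"
| "growth (Cond b c d) = growth c + growth d"
| "growth (For j c) = [:0, 1:] * growth c"

text \<open>The unit is the length of the longest number. An assignment takes 62 + 62 for its
  operands, 32 for the address and 8 for the store, rounded up to 200; a loop takes 8 for the
  initialisation, 6 for each test and 8 for each increment.\<close>

fun work :: "stmt \<Rightarrow> nat poly" where
  "work Nop = 1"
| "work (Put k i j f x y) = 200"
| "work (c ;; d) = work c + work d"
| "work (Cond b c d) = 200 + work c + work d"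
| "work (For j c) = 14 + [:0, 1:] * (14 + work c)"

section \<open>Compilation\<close>

text \<open>Cell 0 holds \<open>n\<close>, cell 1 the stride \<open>s = n + 16\<close>, cells 2 to 4 are scratch and cell \<open>5 + j\<close>
  holds loop variable \<open>j\<close>. Entry \<open>(u, v)\<close> of array \<open>k \<ge> 2\<close> is cell \<open>(k * s + u) * s + v\<close>. The input
  stays in place, except that cell \<open>i\<close> with \<open>0 < i < 16\<close> is moved to \<open>s * s + i\<close>.\<close>

fun locate :: "nat \<Rightarrow> nat \<Rightarrow> nat \<Rightarrow> com" where
  "locate k i j =
     Seq (Assign (Cell 2) Mul (Imm k) (Dir 1))
    (Seq (Assign (Cell 2) Add (Dir 2) (Dir (5 + i)))
    (Seq (Assign (Cell 2) Mul (Dir 2) (Dir 1))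
         (Assign (Cell 2) Add (Dir 2) (Dir (5 + j)))))"

text \<open>Addresses below 16 are redirected to where the displaced input cells are kept. Cell
  \<open>d\<close> receives the result in any case and holds \<open>s * s\<close> meanwhile.\<close>

definition read_input :: "nat \<Rightarrow> com" where
  "read_input d =
     Seq (If (Less (Dir 2) (Imm 16))
             (Seq (Assign (Cell d) Mul (Dir 1) (Dir 1)) (Assign (Cell 2) Add (Dir 2) (Dir d)))
             Skip)
         (Assign (Cell d) Add (Ind 2) (Imm 0))"

fun fetch :: "nat \<Rightarrow> expr \<Rightarrow> com" where
  "fetch d (Const k) = Assign (Cell d) Add (Imm k) (Imm 0)"
| "fetch d (Var i) = Assign (Cell d) Add (Dir (5 + i)) (Imm 0)"
| "fetch d (Arr k i j) = Seq (locate k i j) (Assign (Cell d) Add (Ind 2) (Imm 0))"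
| "fetch d (Adj i j) =
     Seq (Assign (Cell 2) Mul (Dir (5 + i)) (Dir 0))
    (Seq (Assign (Cell 2) Add (Dir 2) (Dir (5 + j)))
    (Seq (Assign (Cell 2) Add (Dir 2) (Imm 1)) (read_input d)))"
| "fetch d (Num i) =
     Seq (Assign (Cell 2) Mul (Dir 0) (Dir 0))
    (Seq (Assign (Cell 2) Add (Dir 2) (Dir (5 + i)))
    (Seq (Assign (Cell 2) Add (Dir 2) (Dir (5 + i)))
    (Seq (Assign (Cell 2) Add (Dir 2) (Imm 1)) (read_input d))))"
| "fetch d (Den i) =
     Seq (Assign (Cell 2) Mul (Dir 0) (Dir 0))
    (Seq (Assign (Cell 2) Add (Dir 2) (Dir (5 + i)))
    (Seq (Assign (Cell 2) Add (Dir 2) (Dir (5 + i)))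
    (Seq (Assign (Cell 2) Add (Dir 2) (Imm 2)) (read_input d))))"

fun branch :: "test \<Rightarrow> com \<Rightarrow> com \<Rightarrow> com" where
  "branch (Lt x y) c d = Seq (fetch 3 x) (Seq (fetch 4 y) (If (Less (Dir 3) (Dir 4)) c d))"
| "branch (Eq x y) c d = Seq (fetch 3 x) (Seq (fetch 4 y) (If (Equal (Dir 3) (Dir 4)) c d))"

fun compile :: "stmt \<Rightarrow> com" where
  "compile Nop = Skip"
| "compile (Put k i j f x y) =
     Seq (fetch 3 x) (Seq (fetch 4 y) (Seq (locate k i j) (Assign (At 2) f (Dir 3) (Dir 4))))"
| "compile (c ;; d) = Seq (compile c) (compile d)"
| "compile (Cond b c d) = branch b (compile c) (compile d)"
| "compile (For j c) =
     Seq (Assign (Cell (5 + j)) Add (Imm 0) (Imm 0))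
         (While (Less (Dir (5 + j)) (Dir 0))
            (Seq (compile c) (Assign (Cell (5 + j)) Add (Dir (5 + j)) (Imm 1))))"

text \<open>Time as a multiple \<open>k\<close> of a common word length \<open>B\<close>. With
  \<open>B\<close> fixed for a whole run, the factors simply add up.\<close>

definition runs :: "nat \<Rightarrow> nat \<Rightarrow> com \<Rightarrow> mem \<Rightarrow> mem \<Rightarrow> bool" where
  "runs B k c m m' \<longleftrightarrow> (\<exists>t. exec c m t m' \<and> t \<le> k * B)"

definition bounded :: "nat \<Rightarrow> mem \<Rightarrow> bool" where
  "bounded b m \<longleftrightarrow> (\<forall>i. m i < 2 ^ b)"

text \<open>Numbers written in the program text are below 32 and so take at most 5 bits; this is the
  source of the hypothesis \<open>5 \<le> B\<close>.\<close>

fun small_operand :: "operand \<Rightarrow> bool" where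
  "small_operand (Imm k) \<longleftrightarrow> k < 32"
| "small_operand (Dir k) \<longleftrightarrow> k < 32"
| "small_operand (Ind k) \<longleftrightarrow> k < 32"

fun small_target :: "target \<Rightarrow> bool" where
  "small_target (Cell k) \<longleftrightarrow> k < 32"
| "small_target (At k) \<longleftrightarrow> k < 32"

lemma bits_le: "k < 2 ^ B \<Longrightarrow> 0 < B \<Longrightarrow> bits k \<le> B"
  unfolding bits_def by (simp add: floorlog_leI)

lemma bits_small: "k < 32 \<Longrightarrow> 5 \<le> B \<Longrightarrow> bits k \<le> B"
  using power_increasing[of 5 B "2::nat"] by (intro bits_le) auto

lemma bits_bounded: "bounded B m \<Longrightarrow> 5 \<le> B \<Longrightarrow> bits (m i) \<le> B"
  unfolding bounded_def by (intro bits_le) auto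

lemma val_cost_le:
  assumes "bounded B m" "5 \<le> B" "small_operand x"
  shows "val_cost m x \<le> 3 * B"
proof (cases x)
  case (Imm k)
  then show ?thesis using bits_small[of k B] assms by simp
next
  case (Dir i)
  then show ?thesis using bits_small[of i B] bits_bounded[OF assms(1,2), of i] assms by simp
next
  case (Ind i)
  then show ?thesis
    using bits_small[of i B] bits_bounded[OF assms(1,2), of i] bits_bounded[OF assms(1,2), of "m i"] assms
    by simp
qed

lemma addr_cost_le:
  assumes "bounded B m" "5 \<le> B" "small_target d"
  shows "addr_cost m d \<le> 2 * B"
proof (cases d)
  case (Cell i)
  then show ?thesis using bits_small[of i B] assms by simp
next
  case (At i)
  then show ?thesis using bits_small[of i B] bits_bounded[OF assms(1,2), of i] assms by simp
qed

lemma bounded_mono: "bounded b m \<Longrightarrow> b \<le> c \<Longrightarrow> bounded c m"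
  unfolding bounded_def by (meson less_le_trans one_le_numeral power_increasing)

lemma bounded_upd: "bounded b m \<Longrightarrow> a < 2 ^ b \<Longrightarrow> bounded b (m(i := a))"
  unfolding bounded_def by simp

text \<open>8 = 2 + 3 + 3: an indirect target involves two numbers, an indirect operand
  three.\<close>

lemma runs_assign:
  assumes "bounded B m" "5 \<le> B" "small_target d" "small_operand x" "small_operand y"
    and "m' = m(addr m d := arith_val f (val m x) (val m y))"
  shows "runs B 8 (Assign d f x y) m m'"
  unfolding runs_def assms(6)
  using exec.Assign addr_cost_le[OF assms(1-3)] val_cost_le[OF assms(1,2,4)] val_cost_le[OF assms(1,2,5)]
  by (intro exI[of _ "addr_cost m d + val_cost m x + val_cost m y"]) auto

lemma runs_skip: "0 < B \<Longrightarrow> runs B 1 Skip m m"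
  unfolding runs_def using exec.Skip by (intro exI[of _ 1]) auto

lemma runs_seq: "runs B k c m m' \<Longrightarrow> runs B l d m' m'' \<Longrightarrow> runs B (k + l) (Seq c d) m m''"
  unfolding runs_def by (metis exec.Seq add_mono add_mult_distrib)

lemma runs_mono: "runs B k c m m' \<Longrightarrow> k \<le> l \<Longrightarrow> runs B l c m m'"
  unfolding runs_def by (meson le_trans mult_le_mono1)

fun small_cond :: "cond \<Rightarrow> bool" where
  "small_cond (Less x y) \<longleftrightarrow> small_operand x \<and> small_operand y"
| "small_cond (Equal x y) \<longleftrightarrow> small_operand x \<and> small_operand y"

lemma cond_cost_le:
  assumes "bounded B m" "5 \<le> B" "small_cond b"
  shows "cond_cost m b \<le> 6 * B"
  using assms(3) val_cost_le[OF assms(1,2)]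
  by (cases b) (simp_all, (metis add_mono numeral_Bit0 distrib_right)+)

lemma runs_if:
  assumes "bounded B m" "5 \<le> B" "small_cond b"
    and "runs B k (if holds m b then c else d) m m'"
  shows "runs B (6 + k) (If b c d) m m'"
proof -
  obtain t where t: "exec (if holds m b then c else d) m t m'" "t \<le> k * B"
    using assms(4) unfolding runs_def by blast
  then have "exec (If b c d) m (cond_cost m b + t) m'"
    by (cases "holds m b") (auto intro: exec.IfTrue exec.IfFalse)
  then show ?thesis unfolding runs_def using t(2) cond_cost_le[OF assms(1-3)]
    by (intro exI[of _ "cond_cost m b + t"]) (auto simp: add_mult_distrib)
qed

lemma runs_while_false:
  assumes "bounded B m" "5 \<le> B" "small_cond b" "\<not> holds m b"
  shows "runs B 6 (While b c) m m"
  unfolding runs_def using exec.WhileFalse[OF assms(4)] cond_cost_le[OF assms(1-3)] by blast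

lemma runs_while_true:
  assumes "bounded B m" "5 \<le> B" "small_cond b" "holds m b"
    and "runs B k c m m'" "runs B l (While b c) m' m''"
  shows "runs B (6 + k + l) (While b c) m m''"
proof -
  obtain t u where "exec c m t m'" "t \<le> k * B" "exec (While b c) m' u m''" "u \<le> l * B"
    using assms(5,6) unfolding runs_def by blast
  then show ?thesis unfolding runs_def
    using exec.WhileTrue[OF assms(4)] cond_cost_le[OF assms(1-3)]
    by (intro exI[of _ "cond_cost m b + t + u"]) (auto simp: add_mult_distrib)
qed

section \<open>Memory layout and correctness of the compiled code\<close>

locale wmisp_input = loop_semantics +
  fixes N :: nat and inp :: mem
  assumes inp_adj: "u < n \<Longrightarrow> v < n \<Longrightarrow> inp (u * n + v + 1) = adj u v"
    and inp_num: "v < n \<Longrightarrow> inp (n * n + v + v + 1) = num v"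
    and inp_den: "v < n \<Longrightarrow> inp (n * n + v + v + 2) = den v"
    and inp_0: "inp 0 = n" and inp_1: "inp 1 = 0"
    and inp_beyond: "n * n + 2 * n + 1 \<le> i \<Longrightarrow> inp i = 0"
    and inp_less: "inp i < 2 ^ N"
    and n_le: "n \<le> N" and N_pos: "0 < N"
begin

text \<open>With 16 added to \<open>n\<close>, the square \<open>s * s\<close> exceeds both the
  input, which has \<open>n * n + 2 * n + 1\<close> cells, and the sixteen low cells. The displaced
  cells follow directly behind \<open>s * s\<close>, and arrays with index at least 2 begin only at
  \<open>2 * s * s\<close>.\<close>

definition s :: nat where "s = n + 16"

text \<open>All addresses are below \<open>16 * (s * s)\<close>, and
  \<open>s \<le> 16 * 2 ^ N\<close>; the exponent is \<open>4 + 2 * (N + 4)\<close>.\<close>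

definition b0 :: nat where "b0 = 2 * N + 12"

text \<open>Cells 2 to 4 are left open and thus free as scratch. Variables outside \<open>X\<close>
  are left open too, which lets a finished loop forget its counter.\<close>

definition rep :: "nat set \<Rightarrow> (nat \<Rightarrow> nat) \<Rightarrow> store \<Rightarrow> mem \<Rightarrow> bool" where
  "rep X e \<sigma> m \<longleftrightarrow> m 0 = n \<and> m 1 = s \<and> (\<forall>j\<in>X. m (5 + j) = e j) \<and>
     (\<forall>i. 16 \<le> i \<longrightarrow> i < s * s \<longrightarrow> m i = inp i) \<and>
     (\<forall>i. 0 < i \<longrightarrow> i < 16 \<longrightarrow> m (s * s + i) = inp i) \<and>
     (\<forall>k u v. 2 \<le> k \<longrightarrow> u < s \<longrightarrow> v < s \<longrightarrow> m ((k * s + u) * s + v) = \<sigma> k u v)"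

definition env_ok :: "nat set \<Rightarrow> (nat \<Rightarrow> nat) \<Rightarrow> bool" where
  "env_ok X e \<longleftrightarrow> (\<forall>j\<in>X. j < 8 \<and> (if j = 0 then e j = 0 else e j < n))"

lemma s_square_less: "16 * (s * s) \<le> 2 ^ b0"
proof -
  have "n < 2 ^ N" using n_le less_exp[of N] by linarith
  moreover have "(1::nat) \<le> 2 ^ N" by simp
  ultimately have "s \<le> 2 ^ N * 16" unfolding s_def by linarith
  then have "s * s \<le> (2 ^ N * 16) * (2 ^ N * 16)" by (intro mult_mono) auto
  then have "16 * (s * s) \<le> 16 * ((2 ^ N * 16) * (2 ^ N * 16))" by (rule mult_le_mono2)
  also have "\<dots> = 2 ^ b0" unfolding b0_def power_add power_mult mult_2 by simp
  finally show ?thesis .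
qed

lemma s_bounds: "16 \<le> s" "s \<le> s * s" "n < s" "n * n + 2 * n + 16 < s * s"
proof -
  show "16 \<le> s" "s \<le> s * s" "n < s" unfolding s_def by auto
  have "s * s = n * n + 32 * n + 256" unfolding s_def by (simp add: algebra_simps)
  then show "n * n + 2 * n + 16 < s * s" by linarith
qed

lemma slot_less:
  assumes "k < 16" "u < s" "v < s"
  shows "(k * s + u) * s + v < 2 ^ b0" "k * s + u < 2 ^ b0" "k * s < 2 ^ b0" "(k * s + u) * s < 2 ^ b0"
proof -
  have "k * s + u < 16 * s"
  proof -
    have "k * s \<le> 15 * s" using assms by (intro mult_right_mono) auto
    then show ?thesis using assms by linarith
  qed
  then have "(k * s + u) * s + v < 16 * (s * s)"
  proof -
    assume "k * s + u < 16 * s"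
    then have "Suc (k * s + u) * s \<le> 16 * s * s" by (intro mult_right_mono) auto
    then show ?thesis using assms by simp
  qed
  then show 1: "(k * s + u) * s + v < 2 ^ b0" using s_square_less by linarith
  then show "(k * s + u) * s < 2 ^ b0" by linarith
  have "(k * s + u) * 1 \<le> (k * s + u) * s" using s_bounds(1) by (intro mult_left_mono) auto
  then show "k * s + u < 2 ^ b0" using 1 unfolding mult_1_right by linarith
  then show "k * s < 2 ^ b0" by linarith
qed

lemma slot_inj:
  assumes "u < s" "v < s" "u' < s" "v' < s" "(k * s + u) * s + v = (k' * s + u') * s + v'"
  shows "k = k' \<and> u = u' \<and> v = v'"
proof -
  have "((k * s + u) * s + v) mod s = v" "((k * s + u) * s + v) div s = k * s + u"
    using assms(2) by simp_all
  moreover have "((k' * s + u') * s + v') mod s = v'" "((k' * s + u') * s + v') div s = k' * s + u'"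
    using assms(4) by simp_all
  ultimately have 1: "v = v'" "k * s + u = k' * s + u'" using assms(5) by metis+
  have "(k * s + u) mod s = u" "(k' * s + u') mod s = u'" "(k * s + u) div s = k" "(k' * s + u') div s = k'"
    using assms by simp_all
  then show ?thesis using 1 by metis
qed

lemma slot_ge:
  assumes "2 \<le> k"
  shows "s * s + 16 < (k * s + u) * s + v"
proof -
  have "2 * s * s \<le> k * s * s" using assms by (intro mult_right_mono) auto
  also have "\<dots> \<le> (k * s + u) * s + v" by (simp add: algebra_simps)
  finally have "2 * s * s \<le> (k * s + u) * s + v" .
  moreover have "16 * 16 \<le> s * s" using s_bounds(1) by (intro mult_mono) auto
  ultimately show ?thesis by linarith
qed

lemma env_less: "env_ok X e \<Longrightarrow> j \<in> X \<Longrightarrow> e j < s" "env_ok X e \<Longrightarrow> j \<in> X \<Longrightarrow> j < 8"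
  "env_ok X e \<Longrightarrow> j \<in> X \<Longrightarrow> j \<noteq> 0 \<Longrightarrow> e j < n"
  using s_bounds unfolding env_ok_def by (fastforce split: if_splits)+

lemma rep_scratch:
  assumes "rep X e \<sigma> m" "\<And>i. i \<noteq> 2 \<Longrightarrow> i \<noteq> 3 \<Longrightarrow> i \<noteq> 4 \<Longrightarrow> m' i = m i"
  shows "rep X e \<sigma> m'"
proof -
  have "16 * 16 \<le> s * s" using s_bounds(1) by (intro mult_mono) auto
  then have "m' (s * s + i) = m (s * s + i)" for i by (intro assms(2)) auto
  moreover have "m' ((k * s + u) * s + v) = m ((k * s + u) * s + v)" if "2 \<le> k" for k u v
    using slot_ge[OF that, of u v] by (intro assms(2)) auto
  ultimately show ?thesis using assms unfolding rep_def by auto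
qed

lemma b0_ge: "5 \<le> b0" unfolding b0_def by simp

lemma locate_correct:
  assumes "rep X e \<sigma> m" "env_ok X e" "bounded b m" "b0 \<le> b" "b \<le> B" "k < 16" "i \<in> X" "j \<in> X"
  shows "runs B 32 (locate k i j) m (m(2 := (k * s + e i) * s + e j))"
    and "bounded b (m(2 := (k * s + e i) * s + e j))"
proof -
  have m: "m (Suc 0) = s" "m (5 + i) = e i" "m (5 + j) = e j"
    using assms unfolding rep_def by auto
  have ij: "e i < s" "e j < s" "i < 8" "j < 8" using assms env_less by blast+
  have pw: "(2::nat) ^ b0 \<le> 2 ^ b" using assms by (intro power_increasing) auto
  note sl = slot_less[OF assms(6) ij(1,2)]
  have bd: "bounded b (m(2 := a))" if "a < 2 ^ b0" for a
    using bounded_upd[OF assms(3)] that pw less_le_trans by blast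
  have bB: "bounded B (m(2 := a))" if "a < 2 ^ b0" for a
    using bounded_mono[OF bd[OF that] assms(5)] .
  have B5: "5 \<le> B" using assms b0_ge by linarith
  have 1: "runs B 8 (Assign (Cell 2) Mul (Imm k) (Dir 1)) m (m(2 := k * s))"
    using assms m by (intro runs_assign bounded_mono[OF assms(3,5)] B5) auto
  have 2: "runs B 8 (Assign (Cell 2) Add (Dir 2) (Dir (5 + i))) (m(2 := k * s)) (m(2 := k * s + e i))"
    using ij m by (intro runs_assign bB sl B5) auto
  have 3: "runs B 8 (Assign (Cell 2) Mul (Dir 2) (Dir 1)) (m(2 := k * s + e i)) (m(2 := (k * s + e i) * s))"
    using ij m by (intro runs_assign bB sl B5) auto
  have 4: "runs B 8 (Assign (Cell 2) Add (Dir 2) (Dir (5 + j))) (m(2 := (k * s + e i) * s))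
      (m(2 := (k * s + e i) * s + e j))"
    using ij m by (intro runs_assign bB sl B5) auto
  show "runs B 32 (locate k i j) m (m(2 := (k * s + e i) * s + e j))"
    using runs_seq[OF 1 runs_seq[OF 2 runs_seq[OF 3 4]]] by simp
  show "bounded b (m(2 := (k * s + e i) * s + e j))" using bd sl(1) by blast
qed

lemma read_input_correct:
  assumes "rep X e \<sigma> m" "bounded b m" "b0 \<le> b" "b \<le> B" "d = 3 \<or> d = 4" "m 2 = q" "0 < q" "q < s * s"
  shows "\<exists>m'. runs B 30 (read_input d) m m' \<and> bounded b m' \<and> m' d = inp q \<and>
    (\<forall>i. i \<noteq> 2 \<longrightarrow> i \<noteq> d \<longrightarrow> m' i = m i)"
proof -
  have B5: "5 \<le> B" using assms b0_ge by linarith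
  have pw: "(2::nat) ^ b0 \<le> 2 ^ b" using assms by (intro power_increasing) auto
  have "2 ^ N < (2::nat) ^ b0" unfolding b0_def by (intro power_strict_increasing) auto
  then have ib: "inp q < 2 ^ b" using inp_less[of q] pw by linarith
  have m1: "m (Suc 0) = s" using assms unfolding rep_def by auto
  have bm: "bounded B m" using bounded_mono assms by blast
  show ?thesis
  proof (cases "q < 16")
    case True
    define m1' where "m1' = m(d := s * s)"
    define m2 where "m2 = m1'(2 := s * s + q)"
    define m3 where "m3 = m2(d := inp q)"
    have sq: "s * s < 2 ^ b" "s * s + q < 2 ^ b"
      using s_square_less pw assms(8) by linarith+
    have b1: "bounded b m1'" unfolding m1'_def by (intro bounded_upd assms sq)
    have b2: "bounded b m2" unfolding m2_def by (intro bounded_upd b1 sq)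
    have b3: "bounded b m3" unfolding m3_def by (intro bounded_upd b2 ib)
    have "16 * 16 \<le> s * s" using s_bounds(1) by (intro mult_mono) auto
    then have "s * s + q \<noteq> 2" "s * s + q \<noteq> d" using assms(5) by linarith+
    then have "m2 (s * s + q) = m (s * s + q)" unfolding m2_def m1'_def by simp
    then have far: "m2 (s * s + q) = inp q" using assms(1,7) True unfolding rep_def by simp
    have w1: "runs B 8 (Assign (Cell d) Mul (Dir 1) (Dir 1)) m m1'"
      unfolding m1'_def using assms m1 by (intro runs_assign bm B5) auto
    have w2: "runs B 8 (Assign (Cell 2) Add (Dir 2) (Dir d)) m1' m2"
      unfolding m2_def using assms m1
      by (intro runs_assign bounded_mono[OF b1 assms(4)] B5) (auto simp: m1'_def)
    have w3: "runs B 8 (Assign (Cell d) Add (Ind 2) (Imm 0)) m2 m3"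
      unfolding m3_def using assms far
      by (intro runs_assign bounded_mono[OF b2 assms(4)] B5) (auto simp: m2_def)
    have "runs B 30 (read_input d) m m3"
      unfolding read_input_def
      using runs_seq[OF runs_if[OF bm B5 _ , where k = 16 and m' = m2] w3] runs_seq[OF w1 w2] True assms(6)
      by simp
    then show ?thesis using b3 unfolding m3_def m2_def m1'_def by (intro exI[of _ m3]) (auto simp: m3_def m2_def m1'_def)
  next
    case False
    define m3 where "m3 = m(d := inp q)"
    have b3: "bounded b m3" unfolding m3_def by (intro bounded_upd assms ib)
    have w3: "runs B 8 (Assign (Cell d) Add (Ind 2) (Imm 0)) m m3"
      unfolding m3_def using assms False by (intro runs_assign bm B5) (auto simp: rep_def)
    have "runs B 15 (read_input d) m m3"
      unfolding read_input_def
      using runs_seq[OF runs_if[OF bm B5 _ , where k = 1 and m' = m] w3] runs_skip[of B m] B5 False assms(6)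
      by simp
    then have "runs B 30 (read_input d) m m3" by (rule runs_mono) simp
    then show ?thesis using b3 by (intro exI[of _ m3]) (auto simp: m3_def)
  qed
qed

text \<open>The longest cases are \<open>Num\<close> and \<open>Den\<close>: four assignments at 8
  and \<open>read_input\<close> at 30 make 62. Only addresses and copies of existing values are
  written, so the bound \<open>b\<close> on the length does not move.\<close>

lemma fetch_correct:
  assumes R: "rep X e \<sigma> m" and env: "env_ok X e" and bd: "bounded b m" and b: "b0 \<le> b" "b \<le> B"
    and d: "d = 3 \<or> d = 4" and wf: "wf_expr X x"
  shows "\<exists>m'. runs B 62 (fetch d x) m m' \<and> bounded b m' \<and> m' d = eval e \<sigma> x \<and>
    (\<forall>i. i \<noteq> 2 \<longrightarrow> i \<noteq> d \<longrightarrow> m' i = m i)"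
proof -
  have B5: "5 \<le> B" using b b0_ge by linarith
  have pw: "(2::nat) ^ b0 \<le> 2 ^ b" using b by (intro power_increasing) auto
  have bm: "bounded B m" using bounded_mono bd b by blast
  have m0: "m 0 = n" using R unfolding rep_def by auto
  have mv: "m (5 + i) = e i" if "i \<in> X" for i using R that unfolding rep_def by auto
  have bd2: "bounded b (m(2 := a))" if "a < s * s" for a
    using that pw s_square_less by (intro bounded_upd bd) linarith
  have bB2: "bounded B (m(2 := a))" if "a < s * s" for a
    using bounded_mono[OF bd2[OF that] b(2)] .
  have rd: "\<exists>m'. runs B 30 (read_input d) (m(2 := q)) m' \<and> bounded b m' \<and> m' d = inp q \<and>
    (\<forall>i. i \<noteq> 2 \<longrightarrow> i \<noteq> d \<longrightarrow> m' i = m i)" if q: "0 < q" "q < s * s" for q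
  proof -
    have "rep X e \<sigma> (m(2 := q))" using rep_scratch[OF R] by simp
    from read_input_correct[OF this bd2[OF q(2)] b d _ q] show ?thesis by auto
  qed
  show ?thesis
  proof (cases x)
    case (Const k)
    have "k < 16" using wf Const by simp
    then have "k < 2 ^ b" using pw s_square_less s_bounds by linarith
    moreover have "runs B 8 (fetch d x) m (m(d := k))"
      using Const wf d by (simp, intro runs_assign bm B5) auto
    then have "runs B 62 (fetch d x) m (m(d := k))" by (rule runs_mono) simp
    ultimately show ?thesis using Const bd by (intro exI[of _ "m(d := k)"]) (auto intro: bounded_upd)
  next
    case (Var i)
    then have i: "i \<in> X" "i < 8" using wf env env_less by auto
    have "e i < 2 ^ b" using mv[OF i(1)] bd unfolding bounded_def by metis
    moreover have "runs B 8 (fetch d x) m (m(d := e i))"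
      using Var i d mv[OF i(1)] by (simp, intro runs_assign bm B5) auto
    then have "runs B 62 (fetch d x) m (m(d := e i))" by (rule runs_mono) simp
    ultimately show ?thesis using Var bd by (intro exI[of _ "m(d := e i)"]) (auto intro: bounded_upd)
  next
    case (Arr k i j)
    then have k: "2 \<le> k" "k < 16" "i \<in> X" "j \<in> X" using wf by auto
    have ij: "e i < s" "e j < s" using env_less(1)[OF env] k by blast+
    define a where "a = (k * s + e i) * s + e j"
    have "m a = \<sigma> k (e i) (e j)" using R k ij unfolding rep_def a_def by blast
    have "a \<noteq> 2" using slot_ge[OF k(1), of "e i" "e j"] unfolding a_def by linarith
    note L = locate_correct[OF R env bd b k(2-4), folded a_def]
    define m' where "m' = m(2 := a, d := m a)"
    have "runs B 8 (Assign (Cell d) Add (Ind 2) (Imm 0)) (m(2 := a)) m'"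
      unfolding m'_def using d \<open>a \<noteq> 2\<close> by (intro runs_assign bounded_mono[OF L(2) b(2)] B5) auto
    from runs_seq[OF L(1) this] have "runs B 40 (fetch d x) m m'" using Arr by simp
    then have "runs B 62 (fetch d x) m m'" by (rule runs_mono) simp
    moreover have "bounded b m'" unfolding m'_def
      using bd by (intro bounded_upd[OF L(2)]) (auto simp: bounded_def)
    ultimately show ?thesis using Arr \<open>m a = _\<close> by (intro exI[of _ m']) (auto simp: m'_def)
  next
    case (Adj i j)
    then have X: "i \<in> X" "j \<in> X" "i \<noteq> 0" "j \<noteq> 0" using wf by auto
    then have ij: "e i < n" "e j < n" "i < 8" "j < 8" using env env_less by blast+
    have "Suc (e i) * n \<le> n * n" using ij by (intro mult_right_mono) auto
    then have q: "e i * n + e j + 1 < s * s" using ij s_bounds(4) by simp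
    have 1: "runs B 8 (Assign (Cell 2) Mul (Dir (5 + i)) (Dir 0)) m (m(2 := e i * n))"
      using ij mv[OF X(1)] m0 by (intro runs_assign bm B5) auto
    have 2: "runs B 8 (Assign (Cell 2) Add (Dir 2) (Dir (5 + j))) (m(2 := e i * n)) (m(2 := e i * n + e j))"
      using ij mv[OF X(2)] q by (intro runs_assign bB2 B5) auto
    have 3: "runs B 8 (Assign (Cell 2) Add (Dir 2) (Imm 1)) (m(2 := e i * n + e j)) (m(2 := e i * n + e j + 1))"
      using q by (intro runs_assign bB2 B5) auto
    obtain m' where m': "runs B 30 (read_input d) (m(2 := e i * n + e j + 1)) m'" "bounded b m'"
      "m' d = inp (e i * n + e j + 1)" "\<forall>i. i \<noteq> 2 \<longrightarrow> i \<noteq> d \<longrightarrow> m' i = m i"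
      using rd[OF _ q] by auto
    have "runs B 62 (fetch d x) m m'"
      using runs_seq[OF 1 runs_seq[OF 2 runs_seq[OF 3 m'(1)]]] Adj by (auto elim: runs_mono)
    then show ?thesis using m' Adj inp_adj[OF ij(1,2)] by auto
  next
    case (Num i)
    then have X: "i \<in> X" "i \<noteq> 0" using wf by auto
    then have ij: "e i < n" "i < 8" using env env_less by blast+
    have q: "n * n + e i + e i + 1 < s * s" using ij s_bounds(4) by simp
    have 1: "runs B 8 (Assign (Cell 2) Mul (Dir 0) (Dir 0)) m (m(2 := n * n))"
      using m0 by (intro runs_assign bm B5) auto
    have 2: "runs B 8 (Assign (Cell 2) Add (Dir 2) (Dir (5 + i))) (m(2 := n * n)) (m(2 := n * n + e i))"
      using ij mv[OF X(1)] q by (intro runs_assign bB2 B5) auto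
    have 3: "runs B 8 (Assign (Cell 2) Add (Dir 2) (Dir (5 + i))) (m(2 := n * n + e i)) (m(2 := n * n + e i + e i))"
      using ij mv[OF X(1)] q by (intro runs_assign bB2 B5) auto
    have 4: "runs B 8 (Assign (Cell 2) Add (Dir 2) (Imm 1)) (m(2 := n * n + e i + e i)) (m(2 := n * n + e i + e i + 1))"
      using q by (intro runs_assign bB2 B5) auto
    obtain m' where m': "runs B 30 (read_input d) (m(2 := n * n + e i + e i + 1)) m'" "bounded b m'"
      "m' d = inp (n * n + e i + e i + 1)" "\<forall>i. i \<noteq> 2 \<longrightarrow> i \<noteq> d \<longrightarrow> m' i = m i"
      using rd[OF _ q] by auto
    have "runs B 62 (fetch d x) m m'"
      using runs_seq[OF 1 runs_seq[OF 2 runs_seq[OF 3 runs_seq[OF 4 m'(1)]]]] Num by simp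
    then show ?thesis using m' Num inp_num[OF ij(1)] by auto
  next
    case (Den i)
    then have X: "i \<in> X" "i \<noteq> 0" using wf by auto
    then have ij: "e i < n" "i < 8" using env env_less by blast+
    have q: "n * n + e i + e i + 2 < s * s" using ij s_bounds(4) by simp
    have 1: "runs B 8 (Assign (Cell 2) Mul (Dir 0) (Dir 0)) m (m(2 := n * n))"
      using m0 by (intro runs_assign bm B5) auto
    have 2: "runs B 8 (Assign (Cell 2) Add (Dir 2) (Dir (5 + i))) (m(2 := n * n)) (m(2 := n * n + e i))"
      using ij mv[OF X(1)] q by (intro runs_assign bB2 B5) auto
    have 3: "runs B 8 (Assign (Cell 2) Add (Dir 2) (Dir (5 + i))) (m(2 := n * n + e i)) (m(2 := n * n + e i + e i))"
      using ij mv[OF X(1)] q by (intro runs_assign bB2 B5) auto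
    have 4: "runs B 8 (Assign (Cell 2) Add (Dir 2) (Imm 2)) (m(2 := n * n + e i + e i)) (m(2 := n * n + e i + e i + 2))"
      using q by (intro runs_assign bB2 B5) auto
    obtain m' where m': "runs B 30 (read_input d) (m(2 := n * n + e i + e i + 2)) m'" "bounded b m'"
      "m' d = inp (n * n + e i + e i + 2)" "\<forall>i. i \<noteq> 2 \<longrightarrow> i \<noteq> d \<longrightarrow> m' i = m i"
      using rd[OF _ q] by auto
    have "runs B 62 (fetch d x) m m'"
      using runs_seq[OF 1 runs_seq[OF 2 runs_seq[OF 3 runs_seq[OF 4 m'(1)]]]] Den by simp
    then show ?thesis using m' Den inp_den[OF ij(1)] by auto
  qed
qed

lemma rep_var:
  assumes "rep X e \<sigma> m" "j < 8"
  shows "rep (insert j X) (e(j := i)) \<sigma> (m(5 + j := i))"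
proof -
  have "16 * 16 \<le> s * s" using s_bounds(1) by (intro mult_mono) auto
  moreover have "(k * s + u) * s + v \<noteq> 5 + j" if "2 \<le> k" for k u v
    using slot_ge[OF that, of u v] assms(2) by linarith
  ultimately show ?thesis using assms unfolding rep_def by auto
qed

lemma rep_put:
  assumes R: "rep X e \<sigma> m" and env: "env_ok X e" and k: "2 \<le> k" and uv: "u < s" "v < s"
  shows "rep X e (put \<sigma> k u v a) (m((k * s + u) * s + v := a))"
proof -
  define q where "q = (k * s + u) * s + v"
  have q: "s * s + 16 < q" unfolding q_def using slot_ge[OF k] .
  have "q \<noteq> 5 + j" if "j \<in> X" for j
    using env_less(2)[OF env that] q by linarith
  moreover have "(m(q := a)) ((k' * s + u') * s + v') = put \<sigma> k u v a k' u' v'"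
    if "2 \<le> k'" "u' < s" "v' < s" for k' u' v'
  proof (cases "k' = k \<and> u' = u \<and> v' = v")
    case True
    then show ?thesis unfolding put_def q_def by simp
  next
    case False
    then have "(k' * s + u') * s + v' \<noteq> q"
      using slot_inj[OF that(2,3) uv, of k' k] unfolding q_def by blast
    moreover have "put \<sigma> k u v a k' u' v' = \<sigma> k' u' v'"
      using False unfolding put_def by auto
    ultimately show ?thesis using R that unfolding rep_def by simp
  qed
  ultimately show ?thesis using R q unfolding rep_def q_def[symmetric] by auto
qed

text \<open>Only multiplication can lengthen a number by more than one bit, and there the second
  factor has at most \<open>N\<close> bits. The carry of an addition fits because \<open>N\<close>
  is positive.\<close>

lemma arith_val_less:
  assumes "a < 2 ^ b" "c < 2 ^ b" "f = Mul \<Longrightarrow> c < 2 ^ N"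
  shows "arith_val f a c < 2 ^ (b + N)"
proof (cases f)
  case Add
  have "a + c < 2 ^ Suc b" using assms by simp
  also have "(2::nat) ^ Suc b \<le> 2 ^ (b + N)" using N_pos by (intro power_increasing) auto
  finally show ?thesis using Add by simp
next
  case Mul
  then have "a * c < 2 ^ b * 2 ^ N" using assms by (intro mult_strict_mono) auto
  then show ?thesis using Mul by (simp add: power_add)
next
  case Sub
  have "(2::nat) ^ b \<le> 2 ^ (b + N)" by (intro power_increasing) auto
  then have "a - c < 2 ^ (b + N)" using assms(1) by linarith
  then show ?thesis using Sub by simp
next
  case Div
  have "(2::nat) ^ b \<le> 2 ^ (b + N)" by (intro power_increasing) auto
  moreover have "a div c \<le> a" by simp
  ultimately have "a div c < 2 ^ (b + N)" using assms(1) by linarith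
  then show ?thesis using Div by simp
qed

lemma branch_correct:
  assumes R: "rep X e \<sigma> m" and env: "env_ok X e" and bd: "bounded b m" and b: "b0 \<le> b" "b \<le> B"
    and wf: "wf_test X t"
    and sub: "\<And>m'. rep X e \<sigma> m' \<Longrightarrow> bounded b m' \<Longrightarrow>
      \<exists>m''. runs B k (if test_holds e \<sigma> t then c else d) m' m'' \<and> P m''"
  shows "\<exists>m''. runs B (200 + k) (branch t c d) m m'' \<and> P m''"
proof -
  have B5: "5 \<le> B" using b b0_ge by linarith
  define x where "x = (case t of Lt x y \<Rightarrow> x | Eq x y \<Rightarrow> x)"
  define y where "y = (case t of Lt x y \<Rightarrow> y | Eq x y \<Rightarrow> y)"
  have wxy: "wf_expr X x" "wf_expr X y" using wf unfolding x_def y_def by (cases t; simp)+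
  obtain m1 where m1: "runs B 62 (fetch 3 x) m m1" "bounded b m1" "m1 3 = eval e \<sigma> x"
    "\<forall>i. i \<noteq> 2 \<longrightarrow> i \<noteq> 3 \<longrightarrow> m1 i = m i"
    using fetch_correct[OF R env bd b _ wxy(1), of 3] by blast
  have R1: "rep X e \<sigma> m1" using rep_scratch[OF R] m1(4) by auto
  obtain m2 where m2: "runs B 62 (fetch 4 y) m1 m2" "bounded b m2" "m2 4 = eval e \<sigma> y"
    "\<forall>i. i \<noteq> 2 \<longrightarrow> i \<noteq> 4 \<longrightarrow> m2 i = m1 i"
    using fetch_correct[OF R1 env m1(2) b _ wxy(2), of 4] by blast
  have R2: "rep X e \<sigma> m2" using rep_scratch[OF R1] m2(4) by auto
  have m23: "m2 3 = eval e \<sigma> x" using m2(4) m1(3) by simp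
  obtain m3 where m3: "runs B k (if test_holds e \<sigma> t then c else d) m2 m3" "P m3"
    using sub[OF R2 m2(2)] by blast
  define q where "q = (case t of Lt x y \<Rightarrow> Less (Dir 3) (Dir 4) | Eq x y \<Rightarrow> Equal (Dir 3) (Dir 4))"
  have "holds m2 q \<longleftrightarrow> test_holds e \<sigma> t" "small_cond q"
    using m23 m2(3) unfolding q_def x_def y_def by (cases t; simp)+
  then have "runs B (6 + k) (com.If q c d) m2 m3"
    using m3(1) runs_if[OF bounded_mono[OF m2(2) b(2)] B5] by simp
  from runs_seq[OF m1(1) runs_seq[OF m2(1) this]]
  have "runs B (62 + (62 + (6 + k))) (branch t c d) m m3"
    unfolding q_def x_def y_def by (cases t) simp_all
  then show ?thesis using m3(2) by (intro exI[of _ m3]) (auto elim: runs_mono)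
qed

lemma put_correct:
  assumes wf: "wf_stmt X (Put k i j f x y)" and R: "rep X e \<sigma> m" and env: "env_ok X e"
    and bd: "bounded b m" and b: "b0 \<le> b" "b + N \<le> B"
  shows "\<exists>m'. runs B 200 (compile (Put k i j f x y)) m m' \<and> rep X e (run (Put k i j f x y) e \<sigma>) m' \<and>
    bounded (b + N) m'"
proof -
  have bB: "b \<le> B" using b by simp
  have B5: "5 \<le> B" using b b0_ge by linarith
  have w: "2 \<le> k" "k < 16" "i \<in> X" "j \<in> X" "wf_expr X x" "wf_expr X y" "f = Mul \<Longrightarrow> is_input y"
    using wf by auto
  have ij: "e i < s" "e j < s" using env_less(1)[OF env] w by blast+
  obtain m1 where m1: "runs B 62 (fetch 3 x) m m1" "bounded b m1" "m1 3 = eval e \<sigma> x"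
    "\<forall>i. i \<noteq> 2 \<longrightarrow> i \<noteq> 3 \<longrightarrow> m1 i = m i"
    using fetch_correct[OF R env bd b(1) bB _ w(5), of 3] by blast
  have R1: "rep X e \<sigma> m1" using rep_scratch[OF R] m1(4) by auto
  obtain m2 where m2: "runs B 62 (fetch 4 y) m1 m2" "bounded b m2" "m2 4 = eval e \<sigma> y"
    "\<forall>i. i \<noteq> 2 \<longrightarrow> i \<noteq> 4 \<longrightarrow> m2 i = m1 i"
    using fetch_correct[OF R1 env m1(2) b(1) bB _ w(6), of 4] by blast
  have R2: "rep X e \<sigma> m2" using rep_scratch[OF R1] m2(4) by auto
  define a where "a = (k * s + e i) * s + e j"
  note L = locate_correct[OF R2 env m2(2) b(1) bB w(2-4), folded a_def]
  define m3 where "m3 = m2(2 := a)"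
  have R3: "rep X e \<sigma> m3" unfolding m3_def using rep_scratch[OF R2] by simp
  define r where "r = arith_val f (eval e \<sigma> x) (eval e \<sigma> y)"
  have m3v: "m3 3 = eval e \<sigma> x" "m3 4 = eval e \<sigma> y" "m3 2 = a"
    unfolding m3_def using m1 m2 by simp_all
  have yN: "eval e \<sigma> y < 2 ^ N" if "f = Mul"
  proof (cases y)
    case (Num l)
    then have "e l < n" using w(6) env_less(3)[OF env] by auto
    then show ?thesis using Num inp_num inp_less by (metis eval.simps(5))
  next
    case (Den l)
    then have "e l < n" using w(6) env_less(3)[OF env] by auto
    then show ?thesis using Den inp_den inp_less by (metis eval.simps(6))
  qed (use w(7) that in auto)
  have "r < 2 ^ (b + N)"
    unfolding r_def using m3v L(2) yN by (intro arith_val_less) (metis m3_def bounded_def)+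
  then have bd4: "bounded (b + N) (m3(a := r))"
    using bounded_mono[OF L(2), of "b + N"] bounded_upd unfolding m3_def by simp
  have "runs B 8 (Assign (At 2) f (Dir 3) (Dir 4)) m3 (m3(a := r))"
    unfolding r_def using m3v L(2) unfolding m3_def[symmetric]
    by (intro runs_assign bounded_mono[OF _ bB] B5) auto
  with L(1) have "runs B (62 + (62 + (32 + 8))) (compile (Put k i j f x y)) m (m3(a := r))"
    unfolding m3_def[symmetric] compile.simps by (intro runs_seq[OF m1(1)] runs_seq[OF m2(1)] runs_seq)
  then have "runs B 200 (compile (Put k i j f x y)) m (m3(a := r))" by (rule runs_mono) simp
  moreover have "rep X e (run (Put k i j f x y) e \<sigma>) (m3(a := r))"
    using rep_put[OF R3 env w(1) ij, of r] unfolding a_def r_def by simp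
  ultimately show ?thesis using bd4 by blast
qed

text \<open>Two lengths are tracked: \<open>b\<close> bounds the numbers before \<open>c\<close>,
  and \<open>B\<close> all numbers up to the end. Time is charged at the rate \<open>B\<close>
  throughout, so that the counts in \<open>work\<close> can be added, while \<open>b\<close> moves
  up by the growth of each part.\<close>

lemma compile_correct:
  assumes "wf_stmt X c" "rep X e \<sigma> m" "env_ok X e" "bounded b m" "b0 \<le> b"
    and "b + poly (growth c) N * N \<le> B"
  shows "\<exists>m'. runs B (poly (work c) N) (compile c) m m' \<and> rep X e (run c e \<sigma>) m' \<and>
    bounded (b + poly (growth c) N * N) m'"
  using assms
proof (induction c arbitrary: X e \<sigma> m b)
  case Nop
  then show ?case using runs_skip[of B m] b0_ge by auto
next
  case (Put k i j f x y)
  have "b + N \<le> B" using Put.prems(6) by simp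
  from put_correct[OF Put.prems(1-5) this] show ?case by (simp add: numeral_poly)
next
  case (Then c d)
  have w: "wf_stmt X c" "wf_stmt X d" using Then.prems by auto
  have gr: "b + poly (growth c) N * N \<le> B" "b + poly (growth c) N * N + poly (growth d) N * N \<le> B"
    using Then.prems(6) by (simp_all add: add_mult_distrib)
  obtain m1 where m1: "runs B (poly (work c) N) (compile c) m m1" "rep X e (run c e \<sigma>) m1"
    "bounded (b + poly (growth c) N * N) m1"
    using Then.IH(1)[OF w(1) Then.prems(2-5) gr(1)] by blast
  have "b0 \<le> b + poly (growth c) N * N" using Then.prems(5) by simp
  then obtain m2 where m2: "runs B (poly (work d) N) (compile d) m1 m2"
    "rep X e (run d e (run c e \<sigma>)) m2" "bounded (b + poly (growth c) N * N + poly (growth d) N * N) m2"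
    using Then.IH(2)[OF w(2) m1(2) Then.prems(3) m1(3) _ gr(2)] by blast
  show ?case
    using runs_seq[OF m1(1) m2(1)] m2 by (intro exI[of _ m2]) (simp add: add_mult_distrib add.assoc)
next
  case (Cond t c d)
  have w: "wf_test X t" "wf_stmt X c" "wf_stmt X d" using Cond.prems by auto
  define B' where "B' = b + poly (growth (Cond t c d)) N * N"
  have gr: "b + poly (growth c) N * N \<le> B'" "b + poly (growth d) N * N \<le> B'" "B' \<le> B" "b \<le> B"
    using Cond.prems(6) unfolding B'_def by (simp_all add: add_mult_distrib)
  have "\<exists>m''. runs B (poly (work c) N + poly (work d) N)
      (if test_holds e \<sigma> t then compile c else compile d) m' m'' \<and>
      (rep X e (run (Cond t c d) e \<sigma>) m'' \<and> bounded B' m'')"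
    if m': "rep X e \<sigma> m'" "bounded b m'" for m'
  proof (cases "test_holds e \<sigma> t")
    case True
    obtain m2 where m2: "runs B (poly (work c) N) (compile c) m' m2" "rep X e (run c e \<sigma>) m2"
      "bounded (b + poly (growth c) N * N) m2"
      using Cond.IH(1)[OF w(2) m'(1) Cond.prems(3) m'(2) Cond.prems(5)] gr by force
    then show ?thesis using True bounded_mono[OF m2(3) gr(1)]
      by (intro exI[of _ m2]) (auto elim: runs_mono)
  next
    case False
    obtain m2 where m2: "runs B (poly (work d) N) (compile d) m' m2" "rep X e (run d e \<sigma>) m2"
      "bounded (b + poly (growth d) N * N) m2"
      using Cond.IH(2)[OF w(3) m'(1) Cond.prems(3) m'(2) Cond.prems(5)] gr by force
    then show ?thesis using False bounded_mono[OF m2(3) gr(2)]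
      by (intro exI[of _ m2]) (auto elim: runs_mono)
  qed
  from branch_correct[OF Cond.prems(2-5) gr(4) w(1) this]
  show ?case unfolding B'_def by (simp add: add.assoc numeral_poly)
next
  case (For j c)
  have w: "j < 8" "j \<notin> X" "j \<noteq> 0" "wf_stmt (insert j X) c" using For.prems by auto
  define g where "g = poly (growth c) N * N"
  define wk where "wk = poly (work c) N"
  define S where "S = rec_nat \<sigma> (\<lambda>i \<tau>. run c (e(j := i)) \<tau>)"
  have S: "S 0 = \<sigma>" "S (Suc i) = run c (e(j := i)) (S i)" for i unfolding S_def by simp_all
  define body where "body = Seq (compile c) (Assign (Cell (5 + j)) Add (Dir (5 + j)) (Imm 1))"
  define q where "q = Less (Dir (5 + j)) (Dir 0)"
  have sq: "small_cond q" unfolding q_def using w(1) by simp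
  have B5: "5 \<le> B" using For.prems(5,6) b0_ge by linarith
  \<comment> \<open>\<open>k\<close> counts the rounds still to come, so the induction follows the
    execution forwards, from any round \<open>i\<close> and with the length \<open>b\<close> reached
    by then.\<close>
  have loop: "\<exists>m'. runs B (6 + k * (14 + wk)) (While q body) m m' \<and> rep X e (S n) m' \<and> bounded (b + k * g) m'"
    if "i + k = n" "rep (insert j X) (e(j := i)) (S i) m" "bounded b m" "b0 \<le> b" "b + k * g \<le> B" for i k m b
    using that
  proof (induction k arbitrary: i m b)
    case 0
    then have "\<not> holds m q" unfolding q_def rep_def by simp
    with 0 have "runs B 6 (While q body) m m"
      using B5 sq by (intro runs_while_false) (auto intro: bounded_mono)
    moreover have "rep X e (S n) m" using 0 w(2) unfolding rep_def by auto
    ultimately show ?case using 0 by auto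
  next
    case (Suc k)
    have i: "i < n" using Suc.prems(1) by simp
    have hq: "holds m q" using Suc.prems(2) i unfolding q_def rep_def by simp
    have env: "env_ok (insert j X) (e(j := i))"
      using For.prems(3) w i unfolding env_ok_def by auto
    have le: "b + g \<le> B" "b + g + k * g \<le> B" using Suc.prems(5) by (simp_all add: add.assoc)
    obtain m1 where m1: "runs B wk (compile c) m m1" "rep (insert j X) (e(j := i)) (S (Suc i)) m1"
      "bounded (b + g) m1"
      using For.IH[OF w(4) Suc.prems(2) env Suc.prems(3,4)] le(1) unfolding S g_def wk_def by blast
    define m2 where "m2 = m1(5 + j := Suc i)"
    have "rep (insert j X) (e(j := Suc i)) (S (Suc i)) m2"
      using rep_var[OF m1(2) w(1), of "Suc i"] unfolding m2_def by simp
    moreover have "bounded (b + g) m2"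
    proof -
      \<comment> \<open>The counter ends at \<open>n\<close>, which is not an admissible index any
        more but still a short number.\<close>
      have "Suc i < 16 * (s * s)" using i s_bounds by linarith
      also have "\<dots> \<le> 2 ^ b0" by (rule s_square_less)
      also have "(2::nat) ^ b0 \<le> 2 ^ (b + g)" using Suc.prems(4) by (intro power_increasing) auto
      finally show ?thesis unfolding m2_def by (intro bounded_upd m1)
    qed
    ultimately obtain m3 where m3: "runs B (6 + k * (14 + wk)) (While q body) m2 m3" "rep X e (S n) m3"
      "bounded (b + g + k * g) m3"
      using Suc.IH[of "Suc i" m2 "b + g"] Suc.prems(1,4) le(2) add_Suc_shift trans_le_add1 by metis
    have "m1 (5 + j) = i" using m1(2) unfolding rep_def by simp
    then have "runs B 8 (Assign (Cell (5 + j)) Add (Dir (5 + j)) (Imm 1)) m1 m2"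
      unfolding m2_def using w(1) by (intro runs_assign bounded_mono[OF m1(3) le(1)] B5) auto
    then have "runs B (wk + 8) body m m2"
      unfolding body_def using m1(1) by (intro runs_seq)
    moreover have "bounded B m" using Suc.prems(3) le(1) by (auto intro: bounded_mono)
    ultimately have "runs B (6 + (wk + 8) + (6 + k * (14 + wk))) (While q body) m m3"
      using runs_while_true[OF _ B5 sq hq _ m3(1)] by blast
    then show ?case using m3 by (intro exI[of _ m3]) (auto simp: add.assoc elim: runs_mono)
  qed
  define m0 where "m0 = m(5 + j := 0)"
  have le: "n * g \<le> N * g" using n_le by simp
  have gB: "b + N * g \<le> B" using For.prems(6) unfolding g_def by (simp add: mult.assoc)
  have "bounded B m" using For.prems(4) gB by (auto intro: bounded_mono)
  then have "runs B 8 (Assign (Cell (5 + j)) Add (Imm 0) (Imm 0)) m m0"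
    unfolding m0_def using w(1) B5 by (intro runs_assign) auto
  moreover have "rep (insert j X) (e(j := 0)) (S 0) m0"
    unfolding m0_def S using rep_var[OF For.prems(2) w(1)] .
  moreover have "bounded b m0" unfolding m0_def by (intro bounded_upd For.prems) simp
  ultimately obtain m' where m': "runs B (6 + n * (14 + wk)) (While q body) m0 m'"
    "rep X e (S n) m'" "bounded (b + n * g) m'"
    using loop[of 0 n m0 b] For.prems(5) le gB by auto
  have "runs B (8 + (6 + n * (14 + wk))) (compile (For j c)) m m'"
    using runs_seq[OF \<open>runs B 8 _ m m0\<close> m'(1)] unfolding q_def body_def by simp
  moreover have "n * (14 + wk) \<le> N * (14 + wk)" using n_le by (intro mult_right_mono) auto
  ultimately have "runs B (poly (work (For j c)) N) (compile (For j c)) m m'"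
    unfolding wk_def by (auto simp: numeral_poly elim: runs_mono)
  moreover have "bounded (b + poly (growth (For j c)) N * N) m'"
    using bounded_mono[OF m'(3), of "b + N * g"] le unfolding g_def by (simp add: mult.assoc)
  ultimately show ?case using m'(2) unfolding S_def by auto
qed

end

section \<open>Start and output code, total running time\<close>

text \<open>The diagonal of the adjacency matrix is zero, so cell 1 is free from the start and serves as the
  pointer for moving the other low cells away.\<close>

fun save_low :: "nat \<Rightarrow> com" where
  "save_low 0 = Skip"
| "save_low (Suc k) =
     Seq (save_low k)
    (Seq (Assign (Cell 1) Add (Dir 1) (Imm 1)) (Assign (At 1) Add (Dir (k + 2)) (Imm 0)))"

definition init_code :: com where
  "init_code =
     Seq (Assign (Cell 1) Add (Dir 0) (Imm 16))
    (Seq (Assign (Cell 1) Mul (Dir 1) (Dir 1))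
    (Seq (Assign (Cell 1) Add (Dir 1) (Imm 1))
    (Seq (save_low 14)
    (Seq (Assign (Cell 1) Add (Dir 0) (Imm 16))
         (Assign (Cell 5) Add (Imm 0) (Imm 0))))))"

text \<open>Both results are fetched before cells 0 and 1 are overwritten, because locating an array
  entry still reads the stride from cell 1.\<close>

definition output_code :: "nat \<Rightarrow> nat \<Rightarrow> com" where
  "output_code k l =
     Seq (fetch 3 (Arr k 0 0))
    (Seq (fetch 4 (Arr l 0 0))
    (Seq (Assign (Cell 0) Add (Dir 3) (Imm 0)) (Assign (Cell 1) Add (Dir 4) (Imm 0))))"

definition full_code :: "stmt \<Rightarrow> nat \<Rightarrow> nat \<Rightarrow> com" where
  "full_code c k l = Seq init_code (Seq (compile c) (output_code k l))"

context wmisp_input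
begin

text \<open>Memory after moving cells 2 to \<open>k + 1\<close>, with the pointer in cell 1 at the
  last place filled. The pointer starts at \<open>s * s + 1\<close>, the place reserved for cell 1;
  both are zero in the input, so that place is correct from the start.\<close>

definition saved :: "nat \<Rightarrow> mem" where
  "saved k = (\<lambda>i. if i = 1 then s * s + 1 + k
     else if s * s + 2 \<le> i \<and> i < s * s + 2 + k then inp (i - s * s) else inp i)"

lemma inp_less_b0: "inp i < 2 ^ b0"
proof -
  have "2 ^ N \<le> (2::nat) ^ b0" unfolding b0_def by (intro power_increasing) auto
  then show ?thesis using inp_less[of i] by linarith
qed

lemma s_square_ge: "256 \<le> s * s"
  using mult_mono[OF s_bounds(1) s_bounds(1)] by simp

lemma bounded_saved: "k \<le> 14 \<Longrightarrow> bounded b0 (saved k)"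
  using s_square_less s_square_ge inp_less_b0 unfolding bounded_def saved_def by auto

lemma save_low_correct:
  assumes "b0 \<le> B" "k \<le> 14"
  shows "runs B (1 + k * 16) (save_low k) (saved 0) (saved k)"
  using assms(2)
proof (induction k)
  case 0
  then show ?case using runs_skip[of B] b0_ge assms(1) by simp
next
  case (Suc k)
  have B5: "5 \<le> B" using assms(1) b0_ge by linarith
  have bd: "bounded B (saved k)" using bounded_saved[of k] Suc.prems assms(1) bounded_mono by simp
  define m1 where "m1 = (saved k)(1 := s * s + 2 + k)"
  have sv: "saved k (Suc 0) = s * s + 1 + k" "saved k (Suc (Suc k)) = inp (Suc (Suc k))"
    using Suc.prems s_square_ge unfolding saved_def by auto
  have w1: "runs B 8 (Assign (Cell 1) Add (Dir 1) (Imm 1)) (saved k) m1"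
    unfolding m1_def using sv by (intro runs_assign bd B5) auto
  have "s * s + 2 + k < 2 ^ b0" using Suc.prems s_square_ge s_square_less by linarith
  then have "bounded b0 m1"
    unfolding m1_def using bounded_saved[of k] Suc.prems by (intro bounded_upd) auto
  then have bd1: "bounded B m1" using assms(1) bounded_mono by blast
  have eq: "saved (Suc k) = m1(s * s + 2 + k := inp (Suc (Suc k)))"
    using s_square_ge unfolding m1_def saved_def by (intro ext) auto
  have "runs B 8 (Assign (At 1) Add (Dir (k + 2)) (Imm 0)) m1 (saved (Suc k))"
    unfolding eq using Suc.prems sv by (intro runs_assign bd1 B5) (auto simp: m1_def)
  from runs_seq[OF Suc.IH runs_seq[OF w1 this]] Suc.prems show ?case by (simp add: algebra_simps)
qed

lemma init_code_correct:
  assumes "b0 \<le> B"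
  shows "\<exists>m. runs B 300 init_code inp m \<and> rep {0} (\<lambda>_. 0) (\<lambda>_ _ _. 0) m \<and> bounded b0 m"
proof -
  have B5: "5 \<le> B" using assms b0_ge by linarith
  have bd: "bounded b0 (inp(1 := a))" if "a < 2 ^ b0" for a
    using that inp_less_b0 unfolding bounded_def by simp
  have bdB: "bounded B (inp(1 := a))" if "a < 2 ^ b0" for a
    using bounded_mono[OF bd[OF that] assms] .
  have lt: "s < 2 ^ b0" "s * s < 2 ^ b0" "s * s + 1 < 2 ^ b0"
    using s_square_less s_square_ge s_bounds by linarith+
  have bi: "bounded B inp" using bounded_mono[of b0] inp_less_b0 assms unfolding bounded_def by blast
  have 1: "runs B 8 (Assign (Cell 1) Add (Dir 0) (Imm 16)) inp (inp(1 := s))"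
    using inp_0 by (intro runs_assign bi B5) (auto simp: s_def)
  have 2: "runs B 8 (Assign (Cell 1) Mul (Dir 1) (Dir 1)) (inp(1 := s)) (inp(1 := s * s))"
    by (intro runs_assign bdB lt B5) auto
  have 3: "runs B 8 (Assign (Cell 1) Add (Dir 1) (Imm 1)) (inp(1 := s * s)) (saved 0)"
    by (intro runs_assign bdB lt B5) (auto simp: saved_def)
  have 4: "runs B 225 (save_low 14) (saved 0) (saved 14)"
    using save_low_correct[OF assms, of 14] by simp
  define m5 where "m5 = (saved 14)(1 := s)"
  define m6 where "m6 = m5(5 := 0)"
  have s0: "saved 14 0 = n" using inp_0 s_square_ge unfolding saved_def by simp
  have b5: "bounded b0 m5" unfolding m5_def by (intro bounded_upd bounded_saved lt) simp
  have b6: "bounded b0 m6" unfolding m6_def by (intro bounded_upd b5) simp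
  have 5: "runs B 8 (Assign (Cell 1) Add (Dir 0) (Imm 16)) (saved 14) m5"
    unfolding m5_def using s0
    by (intro runs_assign bounded_mono[OF bounded_saved assms] B5) (auto simp: s_def)
  have 6: "runs B 8 (Assign (Cell 5) Add (Imm 0) (Imm 0)) m5 m6"
    unfolding m6_def by (intro runs_assign bounded_mono[OF b5 assms] B5) auto
  have "runs B 300 init_code inp m6"
    using runs_seq[OF 1 runs_seq[OF 2 runs_seq[OF 3 runs_seq[OF 4 runs_seq[OF 5 6]]]]]
    unfolding init_code_def by (auto elim: runs_mono)
  moreover have "rep {0} (\<lambda>_. 0) (\<lambda>_ _ _. 0) m6"
    unfolding rep_def
  proof (intro conjI ballI allI impI)
    show "m6 0 = n" "m6 1 = s" using s0 unfolding m6_def m5_def by auto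
    show "m6 (5 + j) = 0" if "j \<in> {0}" for j using that unfolding m6_def by simp
    show "m6 i = inp i" if "16 \<le> i" "i < s * s" for i
      using that unfolding m6_def m5_def saved_def by simp
    show "m6 (s * s + i) = inp i" if "0 < i" "i < 16" for i
    proof (cases "i = 1")
      case True
      have "inp (s * s + 1) = 0" using s_bounds(4) by (intro inp_beyond) linarith
      then show ?thesis
        using True s_square_ge inp_1 unfolding m6_def m5_def saved_def by simp
    next
      case False
      then show ?thesis using that s_square_ge unfolding m6_def m5_def saved_def by simp
    qed
    show "m6 ((k * s + u) * s + v) = 0" if "2 \<le> k" for k u v
    proof -
      have ge: "s * s + 16 < (k * s + u) * s + v" using slot_ge[OF that] .
      have "inp ((k * s + u) * s + v) = 0" using s_bounds(4) ge by (intro inp_beyond) linarith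
      then show ?thesis using ge s_square_ge unfolding m6_def m5_def saved_def by simp
    qed
  qed
  ultimately show ?thesis using b6 by blast
qed

lemma full_code_correct:
  assumes wf: "wf_stmt {0} c" and kl: "2 \<le> k" "k < 16" "2 \<le> l" "l < 16"
  shows "\<exists>t m. exec (full_code c k l) inp t m \<and>
    t \<le> (440 + poly (work c) N) * (b0 + poly (growth c) N * N) \<and>
    m 0 = run c (\<lambda>_. 0) (\<lambda>_ _ _. 0) k 0 0 \<and> m 1 = run c (\<lambda>_. 0) (\<lambda>_ _ _. 0) l 0 0"
proof -
  define B where "B = b0 + poly (growth c) N * N"
  define \<sigma> where "\<sigma> = run c (\<lambda>_. 0) (\<lambda>_ _ _. 0)"
  have bB: "b0 \<le> B" unfolding B_def by simp
  have B5: "5 \<le> B" using bB b0_ge by linarith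
  have env: "env_ok {0} (\<lambda>_. 0)" unfolding env_ok_def by simp
  obtain m1 where m1: "runs B 300 init_code inp m1" "rep {0} (\<lambda>_. 0) (\<lambda>_ _ _. 0) m1" "bounded b0 m1"
    using init_code_correct[OF bB] by blast
  obtain m2 where m2: "runs B (poly (work c) N) (compile c) m1 m2" "rep {0} (\<lambda>_. 0) \<sigma> m2" "bounded B m2"
    using compile_correct[OF wf m1(2) env m1(3), of B] unfolding B_def \<sigma>_def by auto
  obtain m3 where m3: "runs B 62 (fetch 3 (Arr k 0 0)) m2 m3" "bounded B m3" "m3 3 = \<sigma> k 0 0"
    "\<forall>i. i \<noteq> 2 \<longrightarrow> i \<noteq> 3 \<longrightarrow> m3 i = m2 i"
    using fetch_correct[OF m2(2) env m2(3) bB order_refl, of 3 "Arr k 0 0"] kl by auto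
  have R3: "rep {0} (\<lambda>_. 0) \<sigma> m3" using rep_scratch[OF m2(2)] m3(4) by auto
  obtain m4 where m4: "runs B 62 (fetch 4 (Arr l 0 0)) m3 m4" "bounded B m4" "m4 4 = \<sigma> l 0 0"
    "\<forall>i. i \<noteq> 2 \<longrightarrow> i \<noteq> 4 \<longrightarrow> m4 i = m3 i"
    using fetch_correct[OF R3 env m3(2) bB order_refl, of 4 "Arr l 0 0"] kl by auto
  define m5 where "m5 = m4(0 := \<sigma> k 0 0)"
  define m6 where "m6 = m5(1 := \<sigma> l 0 0)"
  have b5: "bounded B m5" unfolding m5_def
    using m4(2) m3(2,3) by (intro bounded_upd) (auto simp: bounded_def dest: spec[of _ 3])
  have 5: "runs B 8 (Assign (Cell 0) Add (Dir 3) (Imm 0)) m4 m5"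
    unfolding m5_def using m3(3) m4(4) by (intro runs_assign m4 B5) auto
  have 6: "runs B 8 (Assign (Cell 1) Add (Dir 4) (Imm 0)) m5 m6"
    unfolding m6_def using m4(3) by (intro runs_assign b5 B5) (auto simp: m5_def)
  \<comment> \<open>300 for the start, twice 62 and twice 8 for the output make up the constant
    440.\<close>
  have "runs B (300 + (poly (work c) N + (62 + (62 + (8 + 8))))) (full_code c k l) inp m6"
    unfolding full_code_def output_code_def
    by (intro runs_seq[OF m1(1)] runs_seq[OF m2(1)] runs_seq[OF m3(1)] runs_seq[OF m4(1)] runs_seq[OF 5 6])
  then have "runs B (440 + poly (work c) N) (full_code c k l) inp m6"
    by (simp add: add.commute)
  then obtain t where "exec (full_code c k l) inp t m6"
    "t \<le> (440 + poly (work c) N) * (b0 + poly (growth c) N * N)"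
    unfolding runs_def B_def by blast
  moreover have "m6 0 = \<sigma> k 0 0" "m6 1 = \<sigma> l 0 0" unfolding m6_def m5_def by auto
  ultimately show ?thesis unfolding \<sigma>_def by blast
qed

end

text \<open>The second factor bounds the length of all numbers, starting from
  \<open>[:12, 2:]\<close>, which is \<open>b0\<close> as a polynomial in \<open>N\<close>; the
  first counts units of that length.\<close>

definition time_bound :: "stmt \<Rightarrow> nat poly" where
  "time_bound c = (440 + work c) * ([:12, 2:] + growth c * [:0, 1:])"

lemma (in wmisp_input) full_code_time_bound:
  assumes "wf_stmt {0} c" "2 \<le> k" "k < 16" "2 \<le> l" "l < 16"
  shows "\<exists>t m. exec (full_code c k l) inp t m \<and> t \<le> poly (time_bound c) N \<and>
    m 0 = run c (\<lambda>_. 0) (\<lambda>_ _ _. 0) k 0 0 \<and> m 1 = run c (\<lambda>_. 0) (\<lambda>_ _ _. 0) l 0 0"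
proof -
  have "poly (time_bound c) N = (440 + poly (work c) N) * (b0 + poly (growth c) N * N)"
    unfolding time_bound_def b0_def by (simp add: numeral_poly algebra_simps)
  then show ?thesis using full_code_correct[OF assms] by simp
qed

section \<open>Cells of the encoded instance\<close>

lemma nth_concat_equal_length:
  assumes "\<And>x. x \<in> set xss \<Longrightarrow> length x = k" "i < length xss" "j < k"
  shows "concat xss ! (i * k + j) = xss ! i ! j"
  using assms
proof (induction xss arbitrary: i)
  case (Cons x xss)
  show ?case
  proof (cases i)
    case 0
    then show ?thesis using Cons.prems by (simp add: nth_append)
  next
    case (Suc i')
    have "concat xss ! (i' * k + j) = xss ! i' ! j" using Cons Suc by simp
    moreover have "length x = k" using Cons.prems by simp
    ultimately show ?thesis using Suc by (simp add: nth_append add.assoc)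
  qed
qed simp

lemma length_concat_equal_length:
  assumes "\<And>x. x \<in> set xss \<Longrightarrow> length x = k"
  shows "length (concat xss) = length xss * k"
  using assms by (induction xss) auto

text \<open>Each entry of the list counts at least one bit, so the input size is at least
  \<open>n\<close>, and loops of \<open>n\<close> rounds are polynomial in it. It is also at least
  the length of every single entry.\<close>

lemma wmisp_input_encode:
  assumes G: "tournament G" "pverts G = {..<n}"
  shows "wmisp_input n (\<lambda>u v. if (u, v) \<in> parcs G then 1 else 0)
    (\<lambda>v. nat (fst (quotient_of (w v)))) (\<lambda>v. nat (snd (quotient_of (w v))))
    (input_size (wmisp_encode (G, w))) (load (wmisp_encode (G, w)))"
proof -
  define rows where "rows = map (\<lambda>u. map (\<lambda>v. if (u, v) \<in> parcs G then 1 else 0 :: nat) [0..<n]) [0..<n]"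
  define fracs where "fracs = map (\<lambda>v. [nat (fst (quotient_of (w v))), nat (snd (quotient_of (w v)))]) [0..<n]"
  define xs where "xs = wmisp_encode (G, w)"
  have xs: "xs = n # concat rows @ concat fracs"
    using G(2) unfolding xs_def wmisp_encode_def rows_def fracs_def
    by (simp add: Let_def case_prod_beta)
  have lr: "length x = n" if "x \<in> set rows" for x using that unfolding rows_def by auto
  have lf: "length x = 2" if "x \<in> set fracs" for x using that unfolding fracs_def by auto
  have len: "length (concat rows) = n * n" "length (concat fracs) = n * 2"
    using length_concat_equal_length[of rows n, OF lr] length_concat_equal_length[of fracs 2, OF lf]
    by (simp_all add: rows_def fracs_def)
  have row: "load xs (u * n + v + 1) = (if (u, v) \<in> parcs G then 1 else 0)" if "u < n" "v < n" for u v
  proof -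
    have "Suc u * n \<le> n * n" using that by (intro mult_right_mono) auto
    then have lt: "u * n + v < n * n" using that by simp
    have "concat rows ! (u * n + v) = rows ! u ! v"
      using nth_concat_equal_length[of rows n u v, OF lr] that by (simp add: rows_def)
    then show ?thesis using lt that len unfolding load_def xs
      by (simp add: nth_append) (simp add: rows_def)
  qed
  have frac: "load xs (n * n + v + v + 1 + j) = fracs ! v ! j" if "v < n" "j < 2" for v j
  proof -
    have "concat fracs ! (v * 2 + j) = fracs ! v ! j"
      using nth_concat_equal_length[of fracs 2 v j, OF lf] that by (simp add: fracs_def)
    moreover have "v * 2 + j = v + v + j" "n * n + v + v + 1 + j < length xs"
      using that len unfolding xs by auto
    ultimately show ?thesis using len unfolding load_def xs by (simp add: nth_append add.assoc)
  qed
  have bits1: "1 \<le> bits k" for k unfolding bits_def by simp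
  have sz: "input_size xs = bits n + (\<Sum>x\<leftarrow>concat rows @ concat fracs. bits x)"
    unfolding input_size_def xs by simp
  have "length ys \<le> (\<Sum>x\<leftarrow>ys. bits x)" for ys
  proof (induction ys)
    case (Cons y ys)
    then show ?case using bits1[of y] by simp
  qed simp
  from this[of "concat rows @ concat fracs"] have "n * n + n * 2 \<le> (\<Sum>x\<leftarrow>concat rows @ concat fracs. bits x)"
    using len by simp
  then have nN: "n \<le> input_size xs" "0 < input_size xs" using sz bits1[of n] by auto
  have less: "load xs i < 2 ^ input_size xs" for i
  proof (cases "i < length xs")
    case True
    then have "bits (xs ! i) \<le> input_size xs"
      unfolding input_size_def using member_le_sum_list[of "bits (xs ! i)" "map bits xs"] by simp
    then have "floorlog 2 (xs ! i) \<le> input_size xs" unfolding bits_def by simp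
    then show ?thesis using True floorlog_leD[of 2 "xs ! i"] unfolding load_def by simp
  qed (simp add: load_def)
  have diag: "(0, 0) \<notin> parcs G"
  proof -
    interpret tournament G by (rule G)
    show ?thesis using pair_no_loops[of "(0, 0)"] by auto
  qed
  \<comment> \<open>Cell 1 is the diagonal entry of vertex 0 or, when there are no vertices, lies
    beyond the list.\<close>
  have one: "load xs 1 = 0"
  proof (cases "n = 0")
    case True
    then show ?thesis unfolding load_def xs rows_def fracs_def by simp
  next
    case False
    then show ?thesis using row[of 0 0] diag by simp
  qed
  show ?thesis
    unfolding xs_def[symmetric]
  proof unfold_locales
    show "load xs (n * n + v + v + 1) = nat (fst (quotient_of (w v)))" if "v < n" for v
      using frac[OF that, of 0] that by (simp add: fracs_def)
    show "load xs (n * n + v + v + 2) = nat (snd (quotient_of (w v)))" if "v < n" for v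
      using frac[OF that, of 1] that by (simp add: fracs_def)
    show "load xs 0 = n" unfolding load_def xs by simp
    show "load xs i = 0" if "n * n + 2 * n + 1 \<le> i" for i
      using that len unfolding load_def xs by simp
  qed (use row one nN less in auto)
qed

section \<open>The algorithm\<close>

fun Whens :: "test list \<Rightarrow> stmt \<Rightarrow> stmt" where
  "Whens [] c = c"
| "Whens (t # ts) c = Cond t (Whens ts c) Nop"

abbreviation Copy :: "nat \<Rightarrow> nat \<Rightarrow> nat \<Rightarrow> expr \<Rightarrow> stmt" where
  "Copy k i j x \<equiv> Put k i j Add x (Const 0)"

text \<open>Arrays: 2 common denominator, 3 weights, 4 remaining vertices, 5 current module, 6 smallest
  module found, 7 and 8 one plus the sizes of their complements, 9 the table of the dynamic program,
  10 candidate value, 11 redundancy flag, 12 optimum inside the module, 13 flag for the first vertex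
  of the module, 14 result.\<close>

definition prepare :: stmt where
  "prepare = Copy 2 0 0 (Const 1) ;; For 5 (Put 2 0 0 Mul (Arr 2 0 0) (Den 5)) ;;
     For 5 (Put 3 5 0 Div (Arr 2 0 0) (Den 5) ;; Put 3 5 0 Mul (Arr 3 5 0) (Num 5) ;; Copy 4 5 0 (Const 1))"

definition grow_step :: stmt where
  "grow_step = Whens [Eq (Arr 4 5 0) (Const 1), Eq (Arr 5 6 0) (Const 1), Eq (Arr 5 7 0) (Const 1),
     Eq (Adj 5 6) (Const 1), Eq (Adj 5 7) (Const 0)] (Copy 5 5 0 (Const 1))"

definition grow_round :: stmt where
  "grow_round = For 5 (For 6 (For 7 grow_step))"

definition module_hull :: stmt where
  "module_hull = For 5 (Copy 5 5 0 (Const 0)) ;; Copy 5 2 0 (Const 1) ;; Copy 5 3 0 (Const 1) ;; For 4 grow_round"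

definition record_hull :: stmt where
  "record_hull = Copy 7 0 0 (Const 1) ;;
     For 5 (Cond (Eq (Arr 5 5 0) (Const 1)) Nop (Put 7 0 0 Add (Arr 7 0 0) (Const 1))) ;;
     Whens [Lt (Arr 8 0 0) (Arr 7 0 0)] (Copy 8 0 0 (Arr 7 0 0) ;; For 5 (Copy 6 5 0 (Arr 5 5 0)))"

text \<open>The arc test excludes equal vertices and selects each unordered pair once, in the
  direction of its arc.\<close>

definition try_pair :: stmt where
  "try_pair = Whens [Eq (Arr 4 2 0) (Const 1), Eq (Arr 4 3 0) (Const 1), Eq (Adj 2 3) (Const 1)]
     (module_hull ;; record_hull)"

definition find_module :: stmt where
  "find_module = Copy 8 0 0 (Const 0) ;; For 5 (Copy 6 5 0 (Const 0)) ;; For 2 (For 3 try_pair)"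

definition check :: "nat \<Rightarrow> nat \<Rightarrow> stmt" where
  "check i j = Copy 11 0 0 (Const 1) ;;
     For 6 (Whens [Eq (Arr 6 6 0) (Const 1), Eq (Adj i 6) (Const 1), Eq (Adj 5 6) (Const 1),
       Eq (Adj j 6) (Const 0)] (Copy 11 0 0 (Const 0)))"

definition raise :: "nat \<Rightarrow> stmt" where
  "raise i = Whens [Eq (Arr 11 0 0) (Const 1), Lt (Arr 9 i 5) (Arr 10 0 0)] (Copy 9 i 5 (Arr 10 0 0))"

text \<open>Appends the vertex of variable 5 to the set recorded for the vertices of variables 2 and
  3. The new entry keeps a member of the pair whose partner is redundant; if either may go, both
  entries are raised. The two may coincide, and this is how single vertices grow into pairs.\<close>

definition relax :: stmt where
  "relax = Whens [Eq (Arr 6 2 0) (Const 1), Eq (Arr 6 3 0) (Const 1), Eq (Arr 6 5 0) (Const 1),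
     Eq (Adj 2 5) (Const 1), Eq (Adj 3 5) (Const 1)]
     (Put 10 0 0 Add (Arr 9 2 3) (Arr 3 5 0) ;; check 2 3 ;; raise 2 ;; check 3 2 ;; raise 3)"

definition relax_round :: stmt where
  "relax_round = For 2 (For 3 (For 5 relax))"

definition solve_module :: stmt where
  "solve_module = For 2 (For 3 (Copy 9 2 3 (Const 0))) ;; For 2 (Copy 9 2 2 (Arr 3 2 0)) ;;
     For 4 relax_round ;; Copy 12 0 0 (Const 0) ;;
     For 2 (For 3 (Whens [Eq (Arr 6 2 0) (Const 1), Eq (Arr 6 3 0) (Const 1), Lt (Arr 12 0 0) (Arr 9 2 3)]
       (Copy 12 0 0 (Arr 9 2 3))))"

definition contract :: stmt where
  "contract = Copy 13 0 0 (Const 0) ;;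
     For 5 (Whens [Eq (Arr 6 5 0) (Const 1)]
       (Cond (Eq (Arr 13 0 0) (Const 0)) (Copy 13 0 0 (Const 1) ;; Copy 3 5 0 (Arr 12 0 0))
          (Copy 4 5 0 (Const 0))))"

definition collect :: stmt where
  "collect = Copy 14 0 0 (Const 0) ;;
     For 5 (Whens [Eq (Arr 4 5 0) (Const 1)] (Put 14 0 0 Add (Arr 14 0 0) (Arr 3 5 0)))"

definition algorithm :: stmt where
  "algorithm = prepare ;; For 1 (find_module ;; solve_module ;; contract) ;; collect"

lemma wf_algorithm: "wf_stmt {0} algorithm"
  by (simp add: algorithm_def prepare_def find_module_def try_pair_def module_hull_def grow_round_def
      grow_step_def record_hull_def solve_module_def relax_round_def relax_def check_def raise_def
      contract_def collect_def)

section \<open>Reasoning about bounded loops\<close>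

fun writes :: "stmt \<Rightarrow> nat set" where
  "writes Nop = {}"
| "writes (Put k i j f x y) = {k}"
| "writes (c ;; d) = writes c \<union> writes d"
| "writes (Cond b c d) = writes c \<union> writes d"
| "writes (For j c) = writes c"

context loop_semantics
begin

lemma run_Whens: "run (Whens ts c) e \<sigma> = (if \<forall>t\<in>set ts. test_holds e \<sigma> t then run c e \<sigma> else \<sigma>)"
  by (induction ts) auto

lemma for_induct:
  assumes "P 0 \<sigma>" "\<And>i \<tau>. i < n \<Longrightarrow> P i \<tau> \<Longrightarrow> P (Suc i) (run c (e(j := i)) \<tau>)"
  shows "P n (run (For j c) e \<sigma>)"
proof -
  have "k \<le> n \<Longrightarrow> P k (rec_nat \<sigma> (\<lambda>i \<tau>. run c (e(j := i)) \<tau>) k)" for k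
    by (induction k) (use assms in auto)
  then show ?thesis by simp
qed

lemma for_inv:
  assumes "P \<sigma>" "\<And>i \<tau>. i < n \<Longrightarrow> P \<tau> \<Longrightarrow> P (run c (e(j := i)) \<tau>)"
  shows "P (run (For j c) e \<sigma>)"
  using for_induct[of "\<lambda>_. P"] assms by blast

text \<open>For facts brought about by one particular round \<open>i\<close>: \<open>P\<close> holds
  throughout, round \<open>i\<close> establishes \<open>Q\<close>, and no later round destroys it. A
  nest of loops that searches for a tuple takes one application per loop.\<close>

lemma for_reach:
  assumes "i < n" "P \<sigma>" "\<And>i \<tau>. i < n \<Longrightarrow> P \<tau> \<Longrightarrow> P (run c (e(j := i)) \<tau>)"
    and "\<And>i \<tau>. i < n \<Longrightarrow> P \<tau> \<Longrightarrow> Q \<tau> \<Longrightarrow> Q (run c (e(j := i)) \<tau>)"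
    and "\<And>\<tau>. P \<tau> \<Longrightarrow> Q (run c (e(j := i)) \<tau>)"
  shows "Q (run (For j c) e \<sigma>)"
proof -
  have "P (run (For j c) e \<sigma>) \<and> (i < n \<longrightarrow> Q (run (For j c) e \<sigma>))"
  proof (rule for_induct[where P = "\<lambda>k \<tau>. P \<tau> \<and> (i < k \<longrightarrow> Q \<tau>)"])
    show "P \<sigma> \<and> (i < 0 \<longrightarrow> Q \<sigma>)" using assms(2) by simp
    fix k \<tau> assume "k < n" "P \<tau> \<and> (i < k \<longrightarrow> Q \<tau>)"
    then show "P (run c (e(j := k)) \<tau>) \<and> (i < Suc k \<longrightarrow> Q (run c (e(j := k)) \<tau>))"
      using assms(3-5) less_antisym by blast
  qed
  then show ?thesis using assms(1) by blast
qed

lemma run_frame: "k \<notin> writes c \<Longrightarrow> run c e \<sigma> k = \<sigma> k"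
proof (induction c arbitrary: e \<sigma>)
  case (For j c)
  show ?case by (rule for_inv[where P = "\<lambda>\<tau>. \<tau> k = \<sigma> k"]) (use For in auto)
qed (auto simp: put_def)

definition flagged :: "store \<Rightarrow> nat \<Rightarrow> nat set" where
  "flagged \<sigma> k = {v. v < n \<and> \<sigma> k v 0 = 1}"

lemma flagged_cong: "\<sigma> k = \<tau> k \<Longrightarrow> flagged \<sigma> k = flagged \<tau> k"
  unfolding flagged_def by simp

lemma finite_flagged: "finite (flagged \<sigma> k)" "flagged \<sigma> k \<subseteq> {..<n}"
  unfolding flagged_def by auto

lemma put_simps: "put \<sigma> k u v a k' u' v' = (if k' = k \<and> u' = u \<and> v' = v then a else \<sigma> k' u' v')"
  "k' \<noteq> k \<Longrightarrow> put \<sigma> k u v a k' = \<sigma> k'"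
  unfolding put_def by auto

lemma flagged_put:
  "k' \<noteq> k \<Longrightarrow> flagged (put \<sigma> k u v a) k' = flagged \<sigma> k'"
  "u < n \<Longrightarrow> flagged (put \<sigma> k u 0 1) k = insert u (flagged \<sigma> k)"
  "u < n \<Longrightarrow> flagged (put \<sigma> k u 0 (Suc 0)) k = insert u (flagged \<sigma> k)"
  "flagged (put \<sigma> k u 0 0) k = flagged \<sigma> k - {u}"
  unfolding flagged_def put_simps by auto

end

locale wmisp_algorithm = loop_semantics +
  fixes E :: "nat \<Rightarrow> nat \<Rightarrow> bool"
  defines "E \<equiv> \<lambda>u v. adj u v = 1"
  assumes adj_01: "adj u v = 0 \<or> adj u v = 1"
    and T: "tour_on E {..<n}" and U: "U5_free_on E {..<n}"
begin

lemma adj_iff: "adj u v = 1 \<longleftrightarrow> E u v" "adj u v = Suc 0 \<longleftrightarrow> E u v" "adj u v = 0 \<longleftrightarrow> \<not> E u v"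
  using adj_01[of u v] unfolding E_def by auto

lemma E_iff: "u < n \<Longrightarrow> v < n \<Longrightarrow> E u v \<longleftrightarrow> u \<noteq> v \<and> \<not> E v u"
  using T unfolding tour_on_def by blast

subsection \<open>Modules\<close>

text \<open>The set under construction lies between \<open>C\<close> and every module containing
  \<open>C\<close>; as soon as it is a module, it is the smallest one.\<close>

definition grow_inv :: "nat set \<Rightarrow> nat set \<Rightarrow> store \<Rightarrow> bool" where
  "grow_inv A C \<tau> \<longleftrightarrow> flagged \<tau> 4 = A \<and> C \<subseteq> flagged \<tau> 5 \<and> flagged \<tau> 5 \<subseteq> A \<and>
     (\<forall>B. module_in E A B \<longrightarrow> C \<subseteq> B \<longrightarrow> flagged \<tau> 5 \<subseteq> B)"

lemma run_grow_step:
  assumes "e 0 = 0" "e 5 < n" "e 6 < n" "e 7 < n"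
  shows "run grow_step e \<sigma> = (if e 5 \<in> flagged \<sigma> 4 \<and> e 6 \<in> flagged \<sigma> 5 \<and> e 7 \<in> flagged \<sigma> 5 \<and>
    E (e 5) (e 6) \<and> \<not> E (e 5) (e 7) then put \<sigma> 5 (e 5) 0 1 else \<sigma>)"
  using assms unfolding grow_step_def run_Whens by (auto simp: flagged_def adj_iff)

lemma grow_step_inv:
  assumes "e 0 = 0" "e 5 < n" "e 6 < n" "e 7 < n" "grow_inv A C \<tau>"
  shows "grow_inv A C (run grow_step e \<tau>)" "flagged \<tau> 5 \<subseteq> flagged (run grow_step e \<tau>) 5"
proof -
  define C' where "C' = flagged (run grow_step e \<tau>) 5"
  have I: "flagged \<tau> 4 = A" "C \<subseteq> flagged \<tau> 5" "flagged \<tau> 5 \<subseteq> A"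
    "\<And>B. module_in E A B \<Longrightarrow> C \<subseteq> B \<Longrightarrow> flagged \<tau> 5 \<subseteq> B"
    using assms(5) unfolding grow_inv_def by blast+
  have 4: "flagged (run grow_step e \<tau>) 4 = A"
    using I(1) unfolding run_grow_step[of e, OF assms(1-4)] by (simp add: flagged_put)
  have C': "C' = flagged \<tau> 5 \<or> C' = insert (e 5) (flagged \<tau> 5) \<and> e 5 \<in> A \<and> e 6 \<in> flagged \<tau> 5 \<and>
      e 7 \<in> flagged \<tau> 5 \<and> E (e 5) (e 6) \<and> \<not> E (e 5) (e 7)"
    using I(1) assms(2) flagged_put(2)[of "e 5"] unfolding C'_def run_grow_step[of e, OF assms(1-4)] by simp
  have "C' \<subseteq> B" if "module_in E A B" "C \<subseteq> B" for B
    using C' I(4)[OF that] that(1) unfolding module_in_def by blast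
  moreover have "flagged \<tau> 5 \<subseteq> C'" "C' \<subseteq> A" using C' I(3) by blast+
  ultimately show "grow_inv A C (run grow_step e \<tau>)" "flagged \<tau> 5 \<subseteq> flagged (run grow_step e \<tau>) 5"
    using 4 I(2) unfolding grow_inv_def C'_def by blast+
qed

text \<open>The set may grow while the round is running, so the second claim is about vertices mixed
  on the set at its start. Since the set only grows, the step that meets the triple still finds
  \<open>y\<close> and \<open>z\<close> in it.\<close>

lemma grow_round_correct:
  assumes e: "e 0 = 0" and I: "grow_inv A (flagged \<sigma> 5) \<sigma>"
  shows "grow_inv A (flagged \<sigma> 5) (run grow_round e \<sigma>)"
    and "x \<in> A \<Longrightarrow> y \<in> flagged \<sigma> 5 \<Longrightarrow> z \<in> flagged \<sigma> 5 \<Longrightarrow> E x y \<Longrightarrow> \<not> E x z \<Longrightarrow>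
      x \<in> flagged (run grow_round e \<sigma>) 5"
proof -
  let ?I = "grow_inv A (flagged \<sigma> 5)"
  have inv7: "?I (run (For 7 grow_step) f \<tau>)" if "?I \<tau>" "f 0 = 0" "f 5 < n" "f 6 < n" for f \<tau>
    by (rule for_inv[where P = ?I]) (use that grow_step_inv in auto)
  have inv6: "?I (run (For 6 (For 7 grow_step)) f \<tau>)" if "?I \<tau>" "f 0 = 0" "f 5 < n" for f \<tau>
    by (rule for_inv[where P = ?I]) (use that inv7 in auto)
  show "?I (run grow_round e \<sigma>)"
    unfolding grow_round_def by (rule for_inv[where P = ?I]) (use I e inv6 in auto)
  assume xyz: "x \<in> A" "y \<in> flagged \<sigma> 5" "z \<in> flagged \<sigma> 5" "E x y" "\<not> E x z"
  let ?Q = "\<lambda>\<tau>. x \<in> flagged \<tau> 5"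
  have A: "flagged \<sigma> 4 = A" using I unfolding grow_inv_def by blast
  have lt: "x < n" "y < n" "z < n" using xyz A unfolding flagged_def by auto
  have keep: "?I (run grow_step f \<tau>) \<and> ?Q (run grow_step f \<tau>)"
    if "?I \<tau> \<and> ?Q \<tau>" "f 0 = 0" "f 5 < n" "f 6 < n" "f 7 < n" for f \<tau>
    using grow_step_inv[of f A _ \<tau>] that by blast
  have keep7: "?I (run (For 7 grow_step) f \<tau>) \<and> ?Q (run (For 7 grow_step) f \<tau>)"
    if "?I \<tau> \<and> ?Q \<tau>" "f 0 = 0" "f 5 < n" "f 6 < n" for f \<tau>
    by (rule for_inv[where P = "\<lambda>\<tau>. ?I \<tau> \<and> ?Q \<tau>"]) (use that keep in auto)
  have keep6: "?I (run (For 6 (For 7 grow_step)) f \<tau>) \<and> ?Q (run (For 6 (For 7 grow_step)) f \<tau>)"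
    if "?I \<tau> \<and> ?Q \<tau>" "f 0 = 0" "f 5 < n" for f \<tau>
    by (rule for_inv[where P = "\<lambda>\<tau>. ?I \<tau> \<and> ?Q \<tau>"]) (use that keep7 in auto)
  have hit: "?Q (run grow_step f \<tau>)" if "?I \<tau>" "f 0 = 0" "f 5 = x" "f 6 = y" "f 7 = z" for f \<tau>
    using that xyz lt run_grow_step[of f \<tau>] unfolding grow_inv_def by (auto simp: flagged_put)
  have hit7: "?Q (run (For 7 grow_step) f \<tau>)" if "?I \<tau>" "f 0 = 0" "f 5 = x" "f 6 = y" for f \<tau>
    by (rule for_reach[where P = ?I and Q = ?Q and i = z]) (use that lt hit grow_step_inv keep in auto)
  have hit6: "?Q (run (For 6 (For 7 grow_step)) f \<tau>)" if "?I \<tau>" "f 0 = 0" "f 5 = x" for f \<tau>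
    by (rule for_reach[where P = ?I and Q = ?Q and i = y]) (use that lt hit7 inv7 keep7 in auto)
  show "x \<in> flagged (run grow_round e \<sigma>) 5"
    unfolding grow_round_def
    by (rule for_reach[where P = ?I and Q = ?Q and i = x]) (use e I lt hit6 inv6 keep6 in auto)
qed

text \<open>A round that does not start from a module adds a vertex. After \<open>n\<close> rounds
  the set is therefore a module or has \<open>n\<close> members, and in the latter case it is the
  whole vertex set.\<close>

lemma hull_correct:
  assumes e: "e 0 = 0" and uv: "e 2 \<in> flagged \<sigma> 4" "e 3 \<in> flagged \<sigma> 4"
  shows "module_in E (flagged \<sigma> 4) (flagged (run module_hull e \<sigma>) 5)"
    and "e 2 \<in> flagged (run module_hull e \<sigma>) 5" "e 3 \<in> flagged (run module_hull e \<sigma>) 5"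
    and "module_in E (flagged \<sigma> 4) B \<Longrightarrow> e 2 \<in> B \<Longrightarrow> e 3 \<in> B \<Longrightarrow> flagged (run module_hull e \<sigma>) 5 \<subseteq> B"
proof -
  define A where "A = flagged \<sigma> 4"
  define c0 where "c0 = (For 5 (Copy 5 5 0 (Const 0)) ;; Copy 5 2 0 (Const 1) ;; Copy 5 3 0 (Const 1))"
  define \<sigma>0 where "\<sigma>0 = run c0 e \<sigma>"
  have A: "A \<subseteq> {..<n}" unfolding A_def by (rule finite_flagged)
  have z: "\<forall>v<n. run (For 5 (Copy 5 5 0 (Const 0))) e \<sigma> 5 v 0 = 0"
    by (rule for_induct[where P = "\<lambda>k \<tau>. \<forall>v<k. \<tau> 5 v 0 = 0"]) (use e in \<open>auto simp: put_simps less_Suc_eq\<close>)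
  have f0: "flagged \<sigma>0 5 = {e 2, e 3}"
    unfolding \<sigma>0_def c0_def using z uv e by (auto simp: flagged_def put_simps simp del: run.simps(5))
  have f4: "flagged \<sigma>0 4 = A"
    unfolding A_def \<sigma>0_def by (intro flagged_cong run_frame) (simp add: c0_def)
  have hull: "run module_hull e \<sigma> = run (For 4 grow_round) e \<sigma>0"
    unfolding module_hull_def \<sigma>0_def c0_def by simp
  let ?I = "grow_inv A {e 2, e 3}"
  have I0: "?I \<sigma>0" unfolding grow_inv_def using f0 f4 uv A_def by auto
  have "?I (run module_hull e \<sigma>) \<and> (module_in E A (flagged (run module_hull e \<sigma>) 5) \<or> n \<le> card (flagged (run module_hull e \<sigma>) 5))"
    unfolding hull
  proof (rule for_induct[where P = "\<lambda>k \<tau>. ?I \<tau> \<and> (module_in E A (flagged \<tau> 5) \<or> k \<le> card (flagged \<tau> 5))"])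
    show "?I \<sigma>0 \<and> (module_in E A (flagged \<sigma>0 5) \<or> 0 \<le> card (flagged \<sigma>0 5))" using I0 by simp
    fix k \<tau> assume \<tau>: "?I \<tau> \<and> (module_in E A (flagged \<tau> 5) \<or> k \<le> card (flagged \<tau> 5))"
    define C where "C = flagged \<tau> 5"
    define \<tau>' where "\<tau>' = run grow_round (e(4 := k)) \<tau>"
    define C' where "C' = flagged \<tau>' 5"
    have e4: "(e(4 := k)) 0 = 0" using e by simp
    have IC: "grow_inv A (flagged \<tau> 5) \<tau>" using \<tau> unfolding grow_inv_def by auto
    note R = grow_round_correct[of "e(4 := k)", OF e4 IC, folded \<tau>'_def C_def C'_def]
    have I': "?I \<tau>'" using \<tau> R(1) unfolding grow_inv_def C_def by (meson order_trans)
    have CC': "C \<subseteq> C'" "C' \<subseteq> A" using R(1) unfolding grow_inv_def C'_def by blast+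
    have CA: "C \<subseteq> A" using CC' by blast
    have "module_in E A C' \<or> Suc k \<le> card C'"
    proof (cases "module_in E A C")
      case True
      \<comment> \<open>Once \<open>C\<close> is a module, it is itself one of the upper bounds in
        the invariant, so growth stops.\<close>
      then have "C' \<subseteq> C" using R(1) unfolding grow_inv_def C'_def by blast
      then show ?thesis using True CC' by auto
    next
      case False
      then obtain x y z where "x \<in> A" "y \<in> C" "z \<in> C" "E x y" "\<not> E x z" "x \<notin> C"
        using CA unfolding module_in_def by blast
      then have "x \<in> C' - C" using R(2) by blast
      then have "card C < card C'"
        using CC' finite_flagged(1)[of \<tau>' 5] unfolding C'_def by (intro psubset_card_mono) auto
      then show ?thesis using False \<tau> unfolding C_def by auto
    qed
    then show "?I (run grow_round (e(4 := k)) \<tau>) \<and> (module_in E A (flagged (run grow_round (e(4 := k)) \<tau>) 5)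
        \<or> Suc k \<le> card (flagged (run grow_round (e(4 := k)) \<tau>) 5))"
      using I' unfolding \<tau>'_def C'_def by blast
  qed
  moreover have "module_in E A C" if "n \<le> card C" "C \<subseteq> A" for C
  proof -
    have "A = {..<n}" "C = A"
      using that A card_mono[of A C] card_mono[of "{..<n}" A] card_subset_eq[of "{..<n}" A] card_subset_eq[of A C]
        finite_subset[OF A] by auto
    then show ?thesis unfolding module_in_def by blast
  qed
  ultimately have "module_in E A (flagged (run module_hull e \<sigma>) 5)" and I: "?I (run module_hull e \<sigma>)"
    unfolding grow_inv_def by blast+
  then show "module_in E (flagged \<sigma> 4) (flagged (run module_hull e \<sigma>) 5)"
    and "e 2 \<in> flagged (run module_hull e \<sigma>) 5" "e 3 \<in> flagged (run module_hull e \<sigma>) 5"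
    and "module_in E (flagged \<sigma> 4) B \<Longrightarrow> e 2 \<in> B \<Longrightarrow> e 3 \<in> B \<Longrightarrow> flagged (run module_hull e \<sigma>) 5 \<subseteq> B"
    unfolding A_def grow_inv_def by auto
qed

text \<open>The smaller the module, the larger this value, and 0 remains free to say that no module
  has been found. The search for a smallest module thus becomes a search for a maximum starting from
  0.\<close>

definition cosize :: "nat set \<Rightarrow> nat" where "cosize C = Suc (card ({..<n} - C))"

lemma record_hull_correct:
  assumes e: "e 0 = 0"
  shows "run record_hull e \<sigma> 8 0 0 = max (\<sigma> 8 0 0) (cosize (flagged \<sigma> 5))"
    and "flagged (run record_hull e \<sigma>) 6 =
      (if \<sigma> 8 0 0 < cosize (flagged \<sigma> 5) then flagged \<sigma> 5 else flagged \<sigma> 6)"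
proof -
  define c where "c = For 5 (Cond (Eq (Arr 5 5 0) (Const 1)) Nop (Put 7 0 0 Add (Arr 7 0 0) (Const 1)))"
  define \<sigma>1 where "\<sigma>1 = run c e (run (Copy 7 0 0 (Const 1)) e \<sigma>)"
  have fr: "\<sigma>1 k = \<sigma> k" if "k \<noteq> 7" for k
    unfolding \<sigma>1_def c_def using that by (subst run_frame) (auto simp: put_simps)
  have "\<sigma>1 5 = \<sigma> 5 \<and> \<sigma>1 7 0 0 = Suc (card ({..<n} - flagged \<sigma> 5))"
    unfolding \<sigma>1_def c_def
  proof (rule for_induct[where P = "\<lambda>k \<tau>. \<tau> 5 = \<sigma> 5 \<and> \<tau> 7 0 0 = Suc (card ({..<k} - flagged \<sigma> 5))"])
    fix k and \<tau> :: store assume "k < n" "\<tau> 5 = \<sigma> 5 \<and> \<tau> 7 0 0 = Suc (card ({..<k} - flagged \<sigma> 5))"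
    moreover have "{..<Suc k} - flagged \<sigma> 5 =
        (if k \<in> flagged \<sigma> 5 then {..<k} - flagged \<sigma> 5 else insert k ({..<k} - flagged \<sigma> 5))"
      by (auto simp: less_Suc_eq)
    ultimately show "run (Cond (Eq (Arr 5 5 0) (Const 1)) Nop (Put 7 0 0 Add (Arr 7 0 0) (Const 1))) (e(5 := k)) \<tau> 5
        = \<sigma> 5 \<and> run (Cond (Eq (Arr 5 5 0) (Const 1)) Nop (Put 7 0 0 Add (Arr 7 0 0) (Const 1))) (e(5 := k)) \<tau> 7 0 0
        = Suc (card ({..<Suc k} - flagged \<sigma> 5))"
      using e by (auto simp: put_simps flagged_def)
  qed (use e in \<open>auto simp: put_simps\<close>)
  then have s7: "\<sigma>1 7 0 0 = cosize (flagged \<sigma> 5)" unfolding cosize_def by simp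
  define d where "d = For 5 (Copy 6 5 0 (Arr 5 5 0))"
  have run: "run record_hull e \<sigma> = (if \<sigma> 8 0 0 < cosize (flagged \<sigma> 5)
      then run d e (run (Copy 8 0 0 (Arr 7 0 0)) e \<sigma>1) else \<sigma>1)"
    unfolding record_hull_def d_def \<sigma>1_def[symmetric] c_def[symmetric] run.simps(3) run_Whens
    unfolding \<sigma>1_def[symmetric] using s7 fr e by simp
  have d8: "run d e \<tau> 8 = \<tau> 8" for \<tau> unfolding d_def by (rule run_frame) simp
  have "run d e \<tau> 5 = \<tau> 5 \<and> (\<forall>v<n. run d e \<tau> 6 v 0 = \<tau> 5 v 0)" for \<tau>
    unfolding d_def
    by (rule for_induct[where P = "\<lambda>k \<tau>'. \<tau>' 5 = \<tau> 5 \<and> (\<forall>v<k. \<tau>' 6 v 0 = \<tau> 5 v 0)"])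
      (use e in \<open>auto simp: put_simps less_Suc_eq\<close>)
  then have d6: "flagged (run d e \<tau>) 6 = flagged \<tau> 5" for \<tau> unfolding flagged_def by auto
  show "run record_hull e \<sigma> 8 0 0 = max (\<sigma> 8 0 0) (cosize (flagged \<sigma> 5))"
    using run d8 s7 fr e by (auto simp: put_simps)
  show "flagged (run record_hull e \<sigma>) 6 =
      (if \<sigma> 8 0 0 < cosize (flagged \<sigma> 5) then flagged \<sigma> 5 else flagged \<sigma> 6)"
    using run d6 e by (auto simp: flagged_put intro!: flagged_cong[OF fr] simp: flagged_cong[OF fr])
qed

text \<open>The two distinct members ensure that contracting the recorded module removes a
  vertex.\<close>

definition module_inv :: "nat set \<Rightarrow> store \<Rightarrow> bool" where
  "module_inv A \<tau> \<longleftrightarrow> flagged \<tau> 4 = A \<and>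
     (\<tau> 8 0 0 = 0 \<and> flagged \<tau> 6 = {} \<or>
      \<tau> 8 0 0 = cosize (flagged \<tau> 6) \<and> module_in E A (flagged \<tau> 6) \<and>
      (\<exists>u\<in>flagged \<tau> 6. \<exists>v\<in>flagged \<tau> 6. u \<noteq> v))"

lemma try_pair_correct:
  assumes e: "e 0 = 0" "e 2 < n" "e 3 < n" and I: "module_inv A \<sigma>"
  shows "module_inv A (run try_pair e \<sigma>)" "\<sigma> 8 0 0 \<le> run try_pair e \<sigma> 8 0 0"
    and "e 2 \<in> A \<Longrightarrow> e 3 \<in> A \<Longrightarrow> E (e 2) (e 3) \<Longrightarrow> module_in E A B \<Longrightarrow> e 2 \<in> B \<Longrightarrow> e 3 \<in> B \<Longrightarrow>
      cosize B \<le> run try_pair e \<sigma> 8 0 0"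
proof -
  have A: "flagged \<sigma> 4 = A" using I unfolding module_inv_def by blast
  define \<tau> where "\<tau> = run module_hull e \<sigma>"
  have fr: "\<tau> k = \<sigma> k" if "k \<noteq> 5" for k
    unfolding \<tau>_def using that by (intro run_frame) (simp add: module_hull_def grow_round_def grow_step_def)
  have fr4: "run record_hull e \<tau> 4 = \<tau> 4" by (rule run_frame) (simp add: record_hull_def)
  have run: "run try_pair e \<sigma> =
      (if e 2 \<in> A \<and> e 3 \<in> A \<and> E (e 2) (e 3) then run record_hull e \<tau> else \<sigma>)"
    using e unfolding try_pair_def run_Whens \<tau>_def A[symmetric] by (auto simp: adj_iff flagged_def)
  note R = record_hull_correct[of e \<tau>, OF e(1)]
  have "module_inv A (run try_pair e \<sigma>) \<and> \<sigma> 8 0 0 \<le> run try_pair e \<sigma> 8 0 0 \<and>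
    (e 2 \<in> A \<and> e 3 \<in> A \<and> E (e 2) (e 3) \<and> module_in E A B \<and> e 2 \<in> B \<and> e 3 \<in> B \<longrightarrow>
      cosize B \<le> run try_pair e \<sigma> 8 0 0)"
  proof (cases "e 2 \<in> A \<and> e 3 \<in> A \<and> E (e 2) (e 3)")
    case True
    have h: "e 2 \<in> flagged \<sigma> 4" "e 3 \<in> flagged \<sigma> 4" using True unfolding A by blast+
    have H: "module_in E A (flagged \<tau> 5)" "e 2 \<in> flagged \<tau> 5" "e 3 \<in> flagged \<tau> 5"
      "\<And>B. module_in E A B \<Longrightarrow> e 2 \<in> B \<Longrightarrow> e 3 \<in> B \<Longrightarrow> flagged \<tau> 5 \<subseteq> B"
      using hull_correct[of e \<sigma>] e(1) h A unfolding \<tau>_def by metis+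
    have ne: "e 2 \<noteq> e 3" using True E_iff[OF e(2,3)] by blast
    have "cosize B \<le> cosize (flagged \<tau> 5)" if "module_in E A B \<and> e 2 \<in> B \<and> e 3 \<in> B"
    proof -
      have "flagged \<tau> 5 \<subseteq> B" using H(4)[of B] that by blast
      then show ?thesis unfolding cosize_def by (auto intro!: card_mono)
    qed
    moreover have "flagged (run record_hull e \<tau>) 4 = A"
      using A fr4 fr[of 4] unfolding flagged_def by simp
    moreover have "flagged \<tau> 6 = flagged \<sigma> 6" using fr[of 6] unfolding flagged_def by simp
    moreover have "module_inv A (run record_hull e \<tau>)"
    proof (cases "\<tau> 8 0 0 < cosize (flagged \<tau> 5)")
      case True
      then show ?thesis unfolding module_inv_def R
        using \<open>flagged (run record_hull e \<tau>) 4 = A\<close> H(1-3) ne by auto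
    next
      case False
      then have "\<tau> 8 0 0 \<noteq> 0" unfolding cosize_def by simp
      then show ?thesis using False I \<open>flagged (run record_hull e \<tau>) 4 = A\<close>
          \<open>flagged \<tau> 6 = flagged \<sigma> 6\<close> fr[of 8]
        unfolding module_inv_def R by auto
    qed
    ultimately show ?thesis using True R(1) fr[of 8] unfolding run by auto
  next
    case False
    then show ?thesis using I unfolding run by auto
  qed
  then show "module_inv A (run try_pair e \<sigma>)" "\<sigma> 8 0 0 \<le> run try_pair e \<sigma> 8 0 0"
    and "e 2 \<in> A \<Longrightarrow> e 3 \<in> A \<Longrightarrow> E (e 2) (e 3) \<Longrightarrow> module_in E A B \<Longrightarrow> e 2 \<in> B \<Longrightarrow> e 3 \<in> B \<Longrightarrow>
      cosize B \<le> run try_pair e \<sigma> 8 0 0"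
    by blast+
qed

text \<open>A module with two vertices contains the hull of the arc between them, and that arc is
  tried. Hence no module with at least two vertices is smaller than the recorded one.\<close>

lemma find_module_correct:
  assumes e: "e 0 = 0"
  shows "module_inv (flagged \<sigma> 4) (run find_module e \<sigma>)"
    and "module_in E (flagged \<sigma> 4) B \<Longrightarrow> u \<in> B \<Longrightarrow> v \<in> B \<Longrightarrow> u \<noteq> v \<Longrightarrow>
      cosize B \<le> run find_module e \<sigma> 8 0 0"
proof -
  define A where "A = flagged \<sigma> 4"
  define c where "c = For 5 (Copy 6 5 0 (Const 0))"
  define \<sigma>0 where "\<sigma>0 = run c e (run (Copy 8 0 0 (Const 0)) e \<sigma>)"
  have run: "run find_module e \<sigma> = run (For 2 (For 3 try_pair)) e \<sigma>0"
    unfolding find_module_def \<sigma>0_def c_def by simp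
  have "\<forall>v<n. \<sigma>0 6 v 0 = 0"
    unfolding \<sigma>0_def c_def
    by (rule for_induct[where P = "\<lambda>k \<tau>. \<forall>v<k. \<tau> 6 v 0 = 0"]) (use e in \<open>auto simp: put_simps less_Suc_eq\<close>)
  then have f6: "flagged \<sigma>0 6 = {}" unfolding flagged_def by auto
  have fr: "run c e \<tau> 8 = \<tau> 8" "run c e \<tau> 4 = \<tau> 4" for \<tau> unfolding c_def by (rule run_frame, simp)+
  have I0: "module_inv A \<sigma>0"
    using f6 fr e unfolding module_inv_def \<sigma>0_def A_def by (auto simp: put_simps flagged_def)
  have inv: "module_inv A (run (For 3 try_pair) f \<tau>)" if "module_inv A \<tau>" "f 0 = 0" "f 2 < n" for f \<tau>
    by (rule for_inv[where P = "module_inv A"]) (use that try_pair_correct(1) in auto)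
  show "module_inv (flagged \<sigma> 4) (run find_module e \<sigma>)"
    unfolding run A_def[symmetric] by (rule for_inv[where P = "module_inv A"]) (use inv I0 e in auto)
  have reach: "cosize B \<le> run find_module e \<sigma> 8 0 0"
    if uv: "u \<in> A" "v \<in> A" "E u v" "module_in E A B" "u \<in> B" "v \<in> B" for u v
  proof -
    let ?Q = "\<lambda>\<tau>. cosize B \<le> \<tau> 8 0 0"
    have lt: "u < n" "v < n" using uv unfolding A_def flagged_def by auto
    have keep: "module_inv A (run try_pair f \<tau>) \<and> ?Q (run try_pair f \<tau>)"
      if "module_inv A \<tau> \<and> ?Q \<tau>" "f 0 = 0" "f 2 < n" "f 3 < n" for f \<tau>
      using that try_pair_correct(1,2)[of f A \<tau>] by (meson le_trans)
    have keep3: "module_inv A (run (For 3 try_pair) f \<tau>) \<and> ?Q (run (For 3 try_pair) f \<tau>)"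
      if "module_inv A \<tau> \<and> ?Q \<tau>" "f 0 = 0" "f 2 < n" for f \<tau>
      by (rule for_inv[where P = "\<lambda>\<tau>. module_inv A \<tau> \<and> ?Q \<tau>"]) (use that keep in auto)
    have hit3: "?Q (run (For 3 try_pair) f \<tau>)" if "module_inv A \<tau>" "f 0 = 0" "f 2 = u" for f \<tau>
      by (rule for_reach[where P = "module_inv A" and Q = ?Q and i = v])
        (use that lt uv keep try_pair_correct(1) try_pair_correct(3)[of "f(3 := v)" A _ B] in auto)
    show ?thesis unfolding run
      by (rule for_reach[where P = "module_inv A" and Q = ?Q and i = u]) (use I0 e lt inv keep3 hit3 in auto)
  qed
  assume B: "module_in E (flagged \<sigma> 4) B" "u \<in> B" "v \<in> B" "u \<noteq> v"
  then have A: "u \<in> A" "v \<in> A" unfolding A_def module_in_def by auto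
  then have "u < n" "v < n" unfolding A_def flagged_def by auto
  then have "E u v \<or> E v u" using E_iff[of u v] B(4) by blast
  then show "cosize B \<le> run find_module e \<sigma> 8 0 0"
    using reach[of u v] reach[of v u] A B unfolding A_def by blast
qed

end

context wmisp_algorithm
begin

subsection \<open>The dynamic program\<close>

lemma run_check:
  assumes e: "e 0 = 0" and ij: "i \<noteq> 6" "j \<noteq> 6"
  shows "run (check i j) e \<sigma> =
    put \<sigma> 11 0 0 (if redundant E (flagged \<sigma> 6) (e i) (e j) (e 5) then 1 else 0)"
proof -
  define body where "body = Whens [Eq (Arr 6 6 0) (Const 1), Eq (Adj i 6) (Const 1), Eq (Adj 5 6) (Const 1),
    Eq (Adj j 6) (Const 0)] (Copy 11 0 0 (Const 0))"
  define ok where "ok k \<longleftrightarrow> (\<forall>x\<in>flagged \<sigma> 6. x < k \<longrightarrow> E (e i) x \<longrightarrow> E (e 5) x \<longrightarrow> E (e j) x)" for k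
  have "run (For 6 body) e (put \<sigma> 11 0 0 1) = put \<sigma> 11 0 0 (if ok n then 1 else 0)"
  proof (rule for_induct[where P = "\<lambda>k \<tau>. \<tau> = put \<sigma> 11 0 0 (if ok k then 1 else 0)"])
    show "put \<sigma> 11 0 0 1 = put \<sigma> 11 0 0 (if ok 0 then 1 else 0)" unfolding ok_def by simp
    fix k \<tau> assume k: "k < n" "\<tau> = put \<sigma> 11 0 0 (if ok k then 1 else 0)"
    have Suc: "ok (Suc k) \<longleftrightarrow> ok k \<and> \<not> (k \<in> flagged \<sigma> 6 \<and> E (e i) k \<and> E (e 5) k \<and> \<not> E (e j) k)"
      unfolding ok_def less_Suc_eq by blast
    have "run body (e(6 := k)) \<tau> = (if k \<in> flagged \<sigma> 6 \<and> E (e i) k \<and> E (e 5) k \<and> \<not> E (e j) k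
        then put \<tau> 11 0 0 0 else \<tau>)"
      using e ij k unfolding body_def run_Whens by (auto simp: adj_iff flagged_def put_simps)
    then show "run body (e(6 := k)) \<tau> = put \<sigma> 11 0 0 (if ok (Suc k) then 1 else 0)"
      unfolding Suc k(2) by (auto simp: put_def)
  qed
  moreover have "ok n \<longleftrightarrow> redundant E (flagged \<sigma> 6) (e i) (e j) (e 5)"
    using finite_flagged(2)[of \<sigma> 6] unfolding ok_def redundant_def by auto
  ultimately show ?thesis
    using e unfolding check_def body_def by (simp del: run.simps(5))
qed

text \<open>\<open>F1\<close> is the table between the two updates; for \<open>s = t\<close> the
  second update meets the entry that the first may have changed.\<close>

lemma run_relax:
  assumes e: "e 0 = 0" "e 2 < n" "e 3 < n" "e 5 < n"
    and M: "flagged \<sigma> 6 = M" and stu: "e 2 = s" "e 3 = t" "e 5 = u"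
  defines "cand \<equiv> \<sigma> 9 s t + \<sigma> 3 u 0"
  defines "F1 \<equiv> (if redundant E M s t u then (\<sigma> 9)(s := (\<sigma> 9 s)(u := max (\<sigma> 9 s u) cand)) else \<sigma> 9)"
  shows "run relax e \<sigma> 9 = (if s \<in> M \<and> t \<in> M \<and> u \<in> M \<and> E s u \<and> E t u
    then if redundant E M t s u then F1(t := (F1 t)(u := max (F1 t u) cand)) else F1
    else \<sigma> 9)"
proof (cases "s \<in> M \<and> t \<in> M \<and> u \<in> M \<and> E s u \<and> E t u")
  case True
  have raise: "run (raise i) e \<tau> 9 =
      (if \<tau> 11 0 0 = 1 then (\<tau> 9)(e i := (\<tau> 9 (e i))(e 5 := max (\<tau> 9 (e i) (e 5)) (\<tau> 10 0 0))) else \<tau> 9)" for i \<tau>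
    using e(1) unfolding raise_def run_Whens by (auto simp: put_def max_def)
  have raise6: "flagged (run (raise i) e \<tau>) 6 = flagged \<tau> 6" "run (raise i) e \<tau> 10 = \<tau> 10" for i \<tau>
    unfolding flagged_def raise_def by (simp_all add: put_simps)
  define \<sigma>1 where "\<sigma>1 = put \<sigma> 10 0 0 cand"
  define \<sigma>2 where "\<sigma>2 = put \<sigma>1 11 0 0 (if redundant E M s t u then 1 else 0)"
  define \<sigma>3 where "\<sigma>3 = run (raise 2) e \<sigma>2"
  define \<sigma>4 where "\<sigma>4 = put \<sigma>3 11 0 0 (if redundant E M t s u then 1 else 0)"
  have M1: "flagged \<sigma>1 6 = M" "flagged \<sigma>2 6 = M" "flagged \<sigma>3 6 = M"
    unfolding \<sigma>3_def raise6 \<sigma>2_def \<sigma>1_def using M by (simp_all add: flagged_put)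
  have c1: "run (check 2 3) e \<sigma>1 = \<sigma>2" using run_check[of e 2 3 \<sigma>1] e M1 stu unfolding \<sigma>2_def by simp
  have c2: "run (check 3 2) e \<sigma>3 = \<sigma>4" using run_check[of e 3 2 \<sigma>3] e M1 stu unfolding \<sigma>4_def by simp
  have "s \<in> flagged \<sigma> 6" "t \<in> flagged \<sigma> 6" "u \<in> flagged \<sigma> 6" using True M by auto
  then have run: "run relax e \<sigma> = run (raise 3) e \<sigma>4"
    using True e stu c1 c2 unfolding relax_def run_Whens \<sigma>3_def \<sigma>1_def cand_def
    by (simp add: adj_iff flagged_def)
  have F1: "\<sigma>3 9 = F1" "\<sigma>3 10 0 0 = cand"
    unfolding \<sigma>3_def raise raise6 \<sigma>2_def \<sigma>1_def F1_def using stu by (auto simp: put_simps)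
  show ?thesis
    unfolding run raise \<sigma>4_def using True stu F1 by (simp add: put_simps)
next
  case False
  have "run relax e \<sigma> = \<sigma>"
    using False e stu unfolding relax_def run_Whens M[symmetric] by (auto simp: adj_iff flagged_def)
  then show ?thesis using False by auto
qed

text \<open>Soundness: each entry is attained by a transitive set that dominates every common
  out-neighbour of \<open>s\<close> and \<open>t\<close>, whether or not it contains them.
  Domination is what allows a further vertex to be appended. \<open>F\<close> is a lower bound, in
  practice the table at the start of a round.\<close>

definition table_inv :: "nat set \<Rightarrow> (nat \<Rightarrow> nat) \<Rightarrow> (nat \<Rightarrow> nat \<Rightarrow> nat) \<Rightarrow> store \<Rightarrow> bool" where
  "table_inv M w F \<tau> \<longleftrightarrow> flagged \<tau> 6 = M \<and> (\<forall>v. \<tau> 3 v 0 = w v) \<and> (\<forall>s t. F s t \<le> \<tau> 9 s t) \<and>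
     (\<forall>s\<in>M. \<forall>t\<in>M. \<exists>X. acyclic_in E M X \<and> sum w X = \<tau> 9 s t \<and>
        (\<forall>x\<in>M. E s x \<longrightarrow> E t x \<longrightarrow> (\<forall>y\<in>X. E y x)))"

text \<open>The set recorded for \<open>s\<close> and \<open>t\<close> dominates \<open>u\<close>,
  so \<open>u\<close> can be placed behind it. By redundancy, whatever the retained vertex and
  \<open>u\<close> both dominate is dominated by the dropped vertex too, so the enlarged set is
  valid for the new pair.\<close>

lemma relax_inv:
  assumes e: "e 0 = 0" "e 2 < n" "e 3 < n" "e 5 < n" and I: "table_inv M w F \<sigma>"
  shows "table_inv M w F (run relax e \<sigma>)" "\<sigma> 9 a b \<le> run relax e \<sigma> 9 a b"
    and "e 2 \<in> M \<Longrightarrow> e 3 \<in> M \<Longrightarrow> e 5 \<in> M \<Longrightarrow> E (e 2) (e 5) \<Longrightarrow> E (e 3) (e 5) \<Longrightarrow>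
      redundant E M (e 2) (e 3) (e 5) \<Longrightarrow> \<sigma> 9 (e 2) (e 3) + w (e 5) \<le> run relax e \<sigma> 9 (e 2) (e 5)"
    and "e 2 \<in> M \<Longrightarrow> e 3 \<in> M \<Longrightarrow> e 5 \<in> M \<Longrightarrow> E (e 2) (e 5) \<Longrightarrow> E (e 3) (e 5) \<Longrightarrow>
      redundant E M (e 3) (e 2) (e 5) \<Longrightarrow> \<sigma> 9 (e 2) (e 3) + w (e 5) \<le> run relax e \<sigma> 9 (e 3) (e 5)"
proof -
  define s t u where stu: "s = e 2" "t = e 3" "u = e 5"
  have M: "flagged \<sigma> 6 = M" and w: "\<sigma> 3 v 0 = w v" and F: "F p q \<le> \<sigma> 9 p q" for v p q
    using I unfolding table_inv_def by blast+
  have Mn: "M \<subseteq> {..<n}" using finite_flagged(2)[of \<sigma> 6] M by simp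
  define cand where "cand = \<sigma> 9 s t + w u"
  note R = run_relax[of e \<sigma> M s t u, OF e M stu[symmetric], unfolded w, folded cand_def]
  define \<tau> where "\<tau> = run relax e \<sigma>"
  have mono: "\<sigma> 9 a b \<le> \<tau> 9 a b" for a b unfolding \<tau>_def R by auto
  have or: "\<tau> 9 a b = \<sigma> 9 a b \<or> \<tau> 9 a b = cand \<and> b = u \<and> s \<in> M \<and> t \<in> M \<and> u \<in> M \<and> E s u \<and> E t u \<and>
      (a = s \<and> redundant E M s t u \<or> a = t \<and> redundant E M t s u)" for a b
    unfolding \<tau>_def R by (auto simp: max_def)
  have fr: "\<tau> 6 = \<sigma> 6" "\<tau> 3 = \<sigma> 3"
    unfolding \<tau>_def by (intro run_frame, simp add: relax_def check_def raise_def)+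
  have sound: "\<exists>X. acyclic_in E M X \<and> sum w X = \<sigma> 9 a b \<and> (\<forall>x\<in>M. E a x \<longrightarrow> E b x \<longrightarrow> (\<forall>y\<in>X. E y x))"
    if "a \<in> M" "b \<in> M" for a b
    using I that unfolding table_inv_def by blast
  have "\<exists>X. acyclic_in E M X \<and> sum w X = \<tau> 9 a b \<and> (\<forall>x\<in>M. E a x \<longrightarrow> E b x \<longrightarrow> (\<forall>y\<in>X. E y x))"
    if ab: "a \<in> M" "b \<in> M" for a b
  proof (cases "\<tau> 9 a b = \<sigma> 9 a b")
    case True
    then show ?thesis using sound[OF ab] by simp
  next
    case False
    then have o: "\<tau> 9 a b = cand" "b = u" "s \<in> M" "t \<in> M" "u \<in> M" "E s u" "E t u"
      "a = s \<and> redundant E M s t u \<or> a = t \<and> redundant E M t s u"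
      using or[of a b] by blast+
    obtain X where X: "acyclic_in E M X" "sum w X = \<sigma> 9 s t" "\<And>x y. x \<in> M \<Longrightarrow> E s x \<Longrightarrow> E t x \<Longrightarrow> y \<in> X \<Longrightarrow> E y x"
      using sound[OF o(3,4)] by blast
    have XM: "X \<subseteq> M" using X(1) unfolding acyclic_in_def by blast
    have Eiff: "E x y \<longleftrightarrow> x \<noteq> y \<and> \<not> E y x" if "x \<in> M" "y \<in> M" for x y
      using E_iff[of x y] that Mn by blast
    have Xu: "E y u" if "y \<in> X" for y using X(3)[of u y] o that by blast
    have uX: "u \<notin> X" using Xu[of u] Eiff[of u u] o by blast
    have nX: "\<not> E u y" if "y \<in> X" for y using Xu[OF that] Eiff[of u y] that XM o by blast
    have "finite X" using finite_subset[of X "{..<n}"] XM Mn by auto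
    then have "sum w (insert u X) = cand" using uX X(2) unfolding cand_def by simp
    moreover have "acyclic_in E M (insert u X)"
      using X(1) o(5) Xu nX Eiff[of u u] unfolding acyclic_in_def by blast
    moreover have "E y x" if "x \<in> M" "E a x" "E b x" "y \<in> insert u X" for x y
    proof -
      have "E s x \<and> E t x \<and> E u x" using that o unfolding redundant_def by blast
      then show ?thesis using that X(3)[of x y] by blast
    qed
    ultimately show ?thesis using o(1) by (intro exI[of _ "insert u X"]) auto
  qed
  moreover have "flagged \<tau> 6 = M" using M fr unfolding flagged_def by simp
  moreover have "F p q \<le> \<tau> 9 p q" for p q using F mono le_trans by blast
  ultimately show "table_inv M w F (run relax e \<sigma>)"
    unfolding table_inv_def \<tau>_def[symmetric] using w fr by auto
  show "\<sigma> 9 a b \<le> run relax e \<sigma> 9 a b" using mono unfolding \<tau>_def .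
  show "\<sigma> 9 (e 2) (e 3) + w (e 5) \<le> run relax e \<sigma> 9 (e 2) (e 5)"
    if "e 2 \<in> M" "e 3 \<in> M" "e 5 \<in> M" "E (e 2) (e 5)" "E (e 3) (e 5)" "redundant E M (e 2) (e 3) (e 5)"
    using that unfolding stu[symmetric] cand_def[symmetric] R by auto
  show "\<sigma> 9 (e 2) (e 3) + w (e 5) \<le> run relax e \<sigma> 9 (e 3) (e 5)"
    if "e 2 \<in> M" "e 3 \<in> M" "e 5 \<in> M" "E (e 2) (e 5)" "E (e 3) (e 5)" "redundant E M (e 3) (e 2) (e 5)"
    using that unfolding stu[symmetric] cand_def[symmetric] R by auto
qed

text \<open>Entries are overwritten during the round but never decrease, so the gain can be measured
  against the table at its start.\<close>

lemma relax_round_correct: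
  assumes e: "e 0 = 0" and I: "table_inv M w (\<sigma> 9) \<sigma>"
  shows "table_inv M w (\<sigma> 9) (run relax_round e \<sigma>)"
    and "s \<in> M \<Longrightarrow> t \<in> M \<Longrightarrow> u \<in> M \<Longrightarrow> E s u \<Longrightarrow> E t u \<Longrightarrow>
      (redundant E M s t u \<longrightarrow> \<sigma> 9 s t + w u \<le> run relax_round e \<sigma> 9 s u) \<and>
      (redundant E M t s u \<longrightarrow> \<sigma> 9 s t + w u \<le> run relax_round e \<sigma> 9 t u)"
proof -
  let ?I = "table_inv M w (\<sigma> 9)"
  have inv5: "?I (run (For 5 relax) f \<tau>)" if "?I \<tau>" "f 0 = 0" "f 2 < n" "f 3 < n" for f \<tau>
    by (rule for_inv[where P = ?I]) (use that relax_inv(1) in auto)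
  have inv3: "?I (run (For 3 (For 5 relax)) f \<tau>)" if "?I \<tau>" "f 0 = 0" "f 2 < n" for f \<tau>
    by (rule for_inv[where P = ?I]) (use that inv5 in auto)
  show "?I (run relax_round e \<sigma>)"
    unfolding relax_round_def by (rule for_inv[where P = ?I]) (use I e inv3 in auto)
  assume stu: "s \<in> M" "t \<in> M" "u \<in> M" "E s u" "E t u"
  let ?Q = "\<lambda>\<tau>. (redundant E M s t u \<longrightarrow> \<sigma> 9 s t + w u \<le> \<tau> 9 s u) \<and>
      (redundant E M t s u \<longrightarrow> \<sigma> 9 s t + w u \<le> \<tau> 9 t u)"
  have "flagged \<sigma> 6 = M" using I unfolding table_inv_def by blast
  then have lt: "s < n" "t < n" "u < n" using stu unfolding flagged_def by auto
  have keep: "?I (run relax f \<tau>) \<and> ?Q (run relax f \<tau>)"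
    if "?I \<tau> \<and> ?Q \<tau>" "f 0 = 0" "f 2 < n" "f 3 < n" "f 5 < n" for f \<tau>
    using that relax_inv(1,2)[of f M w "\<sigma> 9" \<tau>] by (meson le_trans)
  have keep5: "?I (run (For 5 relax) f \<tau>) \<and> ?Q (run (For 5 relax) f \<tau>)"
    if "?I \<tau> \<and> ?Q \<tau>" "f 0 = 0" "f 2 < n" "f 3 < n" for f \<tau>
    by (rule for_inv[where P = "\<lambda>\<tau>. ?I \<tau> \<and> ?Q \<tau>"]) (use that keep in auto)
  have keep3: "?I (run (For 3 (For 5 relax)) f \<tau>) \<and> ?Q (run (For 3 (For 5 relax)) f \<tau>)"
    if "?I \<tau> \<and> ?Q \<tau>" "f 0 = 0" "f 2 < n" for f \<tau>
    by (rule for_inv[where P = "\<lambda>\<tau>. ?I \<tau> \<and> ?Q \<tau>"]) (use that keep5 in auto)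
  have hit: "?Q (run relax f \<tau>)" if h: "?I \<tau>" "f 0 = 0" "f 2 = s" "f 3 = t" "f 5 = u" for f \<tau>
  proof -
    have "f 2 < n" "f 3 < n" "f 5 < n" using h lt by auto
    note R = relax_inv(3,4)[of f, OF h(2) this h(1), unfolded h(3-5), OF stu]
    have "\<sigma> 9 s t \<le> \<tau> 9 s t" using h(1) unfolding table_inv_def by blast
    then show ?thesis using R by (meson add_right_mono le_trans)
  qed
  have hit5: "?Q (run (For 5 relax) f \<tau>)" if "?I \<tau>" "f 0 = 0" "f 2 = s" "f 3 = t" for f \<tau>
    by (rule for_reach[where P = ?I and Q = ?Q and i = u])
      (use that lt keep relax_inv(1) hit[of _ "f(5 := u)"] in auto)
  have hit3: "?Q (run (For 3 (For 5 relax)) f \<tau>)" if "?I \<tau>" "f 0 = 0" "f 2 = s" for f \<tau>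
    by (rule for_reach[where P = ?I and Q = ?Q and i = t])
      (use that lt keep5 inv5 hit5[of _ "f(3 := t)"] in auto)
  show "?Q (run relax_round e \<sigma>)"
    unfolding relax_round_def
    by (rule for_reach[where P = ?I and Q = ?Q and i = s])
      (use I e lt keep3 inv3 hit3[of _ "e(2 := s)"] in auto)
qed

text \<open>Completeness after \<open>k\<close> rounds: some \<open>s\<close> and \<open>t\<close>
  in \<open>X\<close> have the same common out-neighbourhood in \<open>M\<close> as all of
  \<open>X\<close>, and their entry is large enough. Single vertices, with \<open>s = t\<close>, are
  covered before any round, whence \<open>Suc k\<close>.\<close>

definition covered :: "nat set \<Rightarrow> (nat \<Rightarrow> nat) \<Rightarrow> nat \<Rightarrow> (nat \<Rightarrow> nat \<Rightarrow> nat) \<Rightarrow> bool" where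
  "covered M w k F \<longleftrightarrow> (\<forall>X. acyclic_in E M X \<longrightarrow> X \<noteq> {} \<longrightarrow> card X \<le> Suc k \<longrightarrow>
     (\<exists>s\<in>X. \<exists>t\<in>X. (s = t \<or> E s t) \<and> (\<forall>x\<in>M. E s x \<longrightarrow> E t x \<longrightarrow> (\<forall>y\<in>X. E y x)) \<and> sum w X \<le> F s t))"

lemma covered_Suc:
  assumes Mn: "M \<subseteq> {..<n}" and C: "covered M w k F"
    and dich: "\<And>s t u. s \<in> M \<Longrightarrow> t \<in> M \<Longrightarrow> u \<in> M \<Longrightarrow> E s t \<Longrightarrow> E t u \<Longrightarrow> E s u \<Longrightarrow>
      redundant E M s t u \<or> redundant E M t s u"
    and le: "\<And>s t. F s t \<le> F' s t"
    and step: "\<And>s t u. s \<in> M \<Longrightarrow> t \<in> M \<Longrightarrow> u \<in> M \<Longrightarrow> E s u \<Longrightarrow> E t u \<Longrightarrow>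
      (redundant E M s t u \<longrightarrow> F s t + w u \<le> F' s u) \<and> (redundant E M t s u \<longrightarrow> F s t + w u \<le> F' t u)"
  shows "covered M w (Suc k) F'"
  unfolding covered_def
proof (intro allI impI)
  fix X assume X: "acyclic_in E M X" "X \<noteq> {}" "card X \<le> Suc (Suc k)"
  have TM: "tour_on E M" using tour_on_subset[OF T Mn] .
  have XM: "X \<subseteq> M" using X(1) unfolding acyclic_in_def by blast
  have fX: "finite X" using finite_subset[of X "{..<n}"] XM Mn by auto
  obtain u where u: "u \<in> X" "\<And>x. x \<in> X \<Longrightarrow> x \<noteq> u \<Longrightarrow> E x u"
    using acyclic_sink[OF TM X(1,2)] by blast
  show "\<exists>s\<in>X. \<exists>t\<in>X. (s = t \<or> E s t) \<and> (\<forall>x\<in>M. E s x \<longrightarrow> E t x \<longrightarrow> (\<forall>y\<in>X. E y x)) \<and> sum w X \<le> F' s t"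
  proof (cases "X = {u}")
    case True
    then show ?thesis using C X(1) le unfolding covered_def
      by (smt (verit) One_nat_def Suc_le_mono X(2) card_1_singleton_iff le_trans zero_le)
  next
    case False
    define Y where "Y = X - {u}"
    have "acyclic_in E M Y" "Y \<noteq> {}" "card Y \<le> Suc k"
      using X False u(1) fX acyclic_in_mono[OF X(1), of Y M] unfolding Y_def by auto
    then obtain s t where st: "s \<in> Y" "t \<in> Y" "s = t \<or> E s t"
      "\<forall>x\<in>M. E s x \<longrightarrow> E t x \<longrightarrow> (\<forall>y\<in>Y. E y x)" "sum w Y \<le> F s t"
      using C unfolding covered_def by blast
    have su: "E s u" "E t u" using st u(2) unfolding Y_def by blast+
    have mem: "s \<in> M" "t \<in> M" "u \<in> M" using st u XM unfolding Y_def by blast+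
    have sum: "sum w X = sum w Y + w u"
      unfolding Y_def using sum.remove[OF fX u(1), of w] by simp
    \<comment> \<open>For \<open>s = t\<close> both alternatives hold trivially; otherwise
      \<open>s\<close>, \<open>t\<close>, \<open>u\<close> is a transitive triple.\<close>
    have "redundant E M s t u \<or> redundant E M t s u"
      using dich[of s t u] st(3) mem su unfolding redundant_def by blast
    then show ?thesis
    proof
      assume r: "redundant E M s t u"
      then have "sum w X \<le> F' s u" using step[OF mem su] sum st(5) by linarith
      moreover have "\<forall>x\<in>M. E s x \<longrightarrow> E u x \<longrightarrow> (\<forall>y\<in>X. E y x)"
        using r st(4) unfolding redundant_def Y_def by blast
      ultimately show ?thesis using st(1) u(1) su unfolding Y_def by blast
    next
      assume r: "redundant E M t s u"
      then have "sum w X \<le> F' t u" using step[OF mem su] sum st(5) by linarith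
      moreover have "\<forall>x\<in>M. E t x \<longrightarrow> E u x \<longrightarrow> (\<forall>y\<in>X. E y x)"
        using r st(4) unfolding redundant_def Y_def by blast
      ultimately show ?thesis using st(2) u(1) su unfolding Y_def by blast
    qed
  qed
qed

text \<open>Over \<open>M\<close>, a diagonal entry stands for the single vertex and any other entry
  for the empty set, which is valid for every pair.\<close>

lemma table_init:
  assumes e: "e 0 = 0" and M: "flagged \<sigma> 6 = M" and w: "\<And>v. \<sigma> 3 v 0 = w v"
  defines "\<tau> \<equiv> run (For 2 (Copy 9 2 2 (Arr 3 2 0))) e (run (For 2 (For 3 (Copy 9 2 3 (Const 0)))) e \<sigma>)"
  shows "table_inv M w (\<tau> 9) \<tau>" "covered M w 0 (\<tau> 9)"
proof -
  define \<sigma>1 where "\<sigma>1 = run (For 2 (For 3 (Copy 9 2 3 (Const 0)))) e \<sigma>"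
  have row: "\<forall>b<n. run (For 3 (Copy 9 2 3 (Const 0))) f \<rho> 9 (f 2) b = 0" for f \<rho>
    by (rule for_induct[where P = "\<lambda>k \<tau>. \<forall>b<k. \<tau> 9 (f 2) b = 0"]) (auto simp: put_simps less_Suc_eq)
  have other: "a \<noteq> f 2 \<Longrightarrow> run (For 3 (Copy 9 2 3 (Const 0))) f \<rho> 9 a b = \<rho> 9 a b" for f \<rho> a b
    by (rule for_inv[where P = "\<lambda>\<tau>. \<tau> 9 a b = \<rho> 9 a b"]) (auto simp: put_simps)
  have zero: "\<forall>a<n. \<forall>b<n. \<sigma>1 9 a b = 0"
    unfolding \<sigma>1_def
  proof (rule for_induct[where P = "\<lambda>k \<tau>. \<forall>a<k. \<forall>b<n. \<tau> 9 a b = 0"])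
    fix k and \<rho> :: store assume k: "k < n" "\<forall>a<k. \<forall>b<n. \<rho> 9 a b = 0"
    show "\<forall>a<Suc k. \<forall>b<n. run (For 3 (Copy 9 2 3 (Const 0))) (e(2 := k)) \<rho> 9 a b = 0"
    proof (intro allI impI)
      fix a b assume "a < Suc k" "b < n"
      then show "run (For 3 (Copy 9 2 3 (Const 0))) (e(2 := k)) \<rho> 9 a b = 0"
        using row[where f = "e(2 := k)" and \<rho> = \<rho>] other[where f = "e(2 := k)" and \<rho> = \<rho> and a = a and b = b] k
        by (cases "a = k") (auto simp del: run.simps(5))
    qed
  qed simp
  have s3: "\<sigma>1 3 = \<sigma> 3" "\<sigma>1 6 = \<sigma> 6" unfolding \<sigma>1_def by (rule run_frame, simp)+
  have t3: "\<tau> 3 = \<sigma> 3" "\<tau> 6 = \<sigma> 6"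
    unfolding \<tau>_def \<sigma>1_def[symmetric] s3[symmetric] by (rule run_frame, simp)+
  have "\<tau> 3 = \<sigma>1 3 \<and> (\<forall>a b. a < n \<longrightarrow> b < n \<longrightarrow> \<tau> 9 a b = (if a = b \<and> a < n then w a else 0))"
    unfolding \<tau>_def \<sigma>1_def[symmetric]
    by (rule for_induct[where P = "\<lambda>k \<rho>. \<rho> 3 = \<sigma>1 3 \<and>
      (\<forall>a b. a < n \<longrightarrow> b < n \<longrightarrow> \<rho> 9 a b = (if a = b \<and> a < k then w a else 0))"])
      (use zero e w s3 in \<open>auto simp: put_simps less_Suc_eq\<close>)
  then have F: "\<tau> 9 a b = (if a = b then w a else 0)" if "a < n" "b < n" for a b using that by simp
  have Mn: "v < n" if "v \<in> M" for v using that M unfolding flagged_def by auto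
  have irr: "\<not> E v v" if "v \<in> M" for v using E_iff[of v v] Mn[OF that] by blast
  have M': "flagged \<tau> 6 = M" using M t3 unfolding flagged_def by simp
  have "\<exists>X. acyclic_in E M X \<and> sum w X = \<tau> 9 a b \<and> (\<forall>x\<in>M. E a x \<longrightarrow> E b x \<longrightarrow> (\<forall>y\<in>X. E y x))"
    if ab: "a \<in> M" "b \<in> M" for a b
  proof (cases "a = b")
    case True
    then show ?thesis using ab F[of a b] Mn irr
      by (intro exI[of _ "{a}"]) (auto simp: acyclic_in_def)
  next
    case False
    then show ?thesis using ab F[of a b] Mn by (intro exI[of _ "{}"]) (auto simp: acyclic_in_def)
  qed
  then show "table_inv M w (\<tau> 9) \<tau>" unfolding table_inv_def using M' t3 w by auto
  show "covered M w 0 (\<tau> 9)"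
    unfolding covered_def
  proof (intro allI impI)
    fix X assume X: "acyclic_in E M X" "X \<noteq> {}" "card X \<le> Suc 0"
    have XM: "X \<subseteq> M" using X unfolding acyclic_in_def by blast
    then have "finite X" using Mn by (intro finite_subset[of X "{..<n}"]) auto
    then have "card X = 1" using X(2,3) card_0_eq[of X] by linarith
    then obtain v where v: "X = {v}" using card_1_singletonE by blast
    then show "\<exists>s\<in>X. \<exists>t\<in>X. (s = t \<or> E s t) \<and> (\<forall>x\<in>M. E s x \<longrightarrow> E t x \<longrightarrow> (\<forall>y\<in>X. E y x)) \<and> sum w X \<le> \<tau> 9 s t"
      using F[of v v] Mn[of v] XM by auto
  qed
qed

text \<open>Every entry over \<open>M\<close> is attained by a transitive set, and after
  \<open>n\<close> rounds every nonempty transitive set is bounded by one of these entries. The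
  starting value 0 of the maximum is attained by the empty set.\<close>

lemma solve_module_correct:
  assumes e: "e 0 = 0" and M: "flagged \<sigma> 6 = M" and w: "\<And>v. \<sigma> 3 v 0 = w v"
    and dich: "\<And>s t u. s \<in> M \<Longrightarrow> t \<in> M \<Longrightarrow> u \<in> M \<Longrightarrow> E s t \<Longrightarrow> E t u \<Longrightarrow> E s u \<Longrightarrow>
      redundant E M s t u \<or> redundant E M t s u"
  shows "is_opt E M w (run solve_module e \<sigma> 12 0 0)"
proof -
  have Mn: "M \<subseteq> {..<n}" using finite_flagged(2)[of \<sigma> 6] M by simp
  define \<tau>0 where "\<tau>0 = run (For 2 (Copy 9 2 2 (Arr 3 2 0))) e (run (For 2 (For 3 (Copy 9 2 3 (Const 0)))) e \<sigma>)"
  define \<tau>1 where "\<tau>1 = run (For 4 relax_round) e \<tau>0"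
  define \<tau>2 where "\<tau>2 = put \<tau>1 12 0 0 0"
  define body where "body = Whens [Eq (Arr 6 2 0) (Const 1), Eq (Arr 6 3 0) (Const 1), Lt (Arr 12 0 0) (Arr 9 2 3)]
       (Copy 12 0 0 (Arr 9 2 3))"
  have run: "run solve_module e \<sigma> = run (For 2 (For 3 body)) e \<tau>2"
    unfolding solve_module_def \<tau>0_def \<tau>1_def \<tau>2_def body_def using e by (simp del: run.simps(5))
  have init: "table_inv M w (\<tau>0 9) \<tau>0" "covered M w 0 (\<tau>0 9)"
    using table_init[of e \<sigma> M w, OF e M w] unfolding \<tau>0_def by blast+
  have t1: "table_inv M w (\<tau>1 9) \<tau>1 \<and> covered M w n (\<tau>1 9)"
    unfolding \<tau>1_def
  proof (rule for_induct[where P = "\<lambda>k \<tau>. table_inv M w (\<tau> 9) \<tau> \<and> covered M w k (\<tau> 9)"])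
    fix k \<tau> assume \<tau>: "table_inv M w (\<tau> 9) \<tau> \<and> covered M w k (\<tau> 9)"
    define \<tau>' where "\<tau>' = run relax_round (e(4 := k)) \<tau>"
    have e4: "(e(4 := k)) 0 = 0" using e by simp
    have R: "table_inv M w (\<tau> 9) \<tau>'" "\<And>s t u. s \<in> M \<Longrightarrow> t \<in> M \<Longrightarrow> u \<in> M \<Longrightarrow> E s u \<Longrightarrow> E t u \<Longrightarrow>
      (redundant E M s t u \<longrightarrow> \<tau> 9 s t + w u \<le> \<tau>' 9 s u) \<and> (redundant E M t s u \<longrightarrow> \<tau> 9 s t + w u \<le> \<tau>' 9 t u)"
      using relax_round_correct[of "e(4 := k)" M w \<tau>] e4 \<tau> unfolding \<tau>'_def by blast+
    have "\<And>s t. \<tau> 9 s t \<le> \<tau>' 9 s t" using R(1) unfolding table_inv_def by blast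
    then have "covered M w (Suc k) (\<tau>' 9)" using covered_Suc[OF Mn _ dich _ R(2)] \<tau> by blast
    moreover have "table_inv M w (\<tau>' 9) \<tau>'" using R(1) unfolding table_inv_def by blast
    ultimately show "table_inv M w (run relax_round (e(4 := k)) \<tau> 9) (run relax_round (e(4 := k)) \<tau>) \<and>
      covered M w (Suc k) (run relax_round (e(4 := k)) \<tau> 9)" unfolding \<tau>'_def by blast
  qed (use init in blast)
  define attained where "attained r \<longleftrightarrow> (\<exists>X. acyclic_in E M X \<and> sum w X = r)" for r
  have valF: "attained (\<tau>1 9 s t)" if "s \<in> M" "t \<in> M" for s t
    using t1 that unfolding table_inv_def attained_def by blast
  have M1: "flagged \<tau>1 6 = M" using t1 unfolding table_inv_def by blast
  let ?I = "\<lambda>\<tau>. \<tau> 6 = \<tau>1 6 \<and> \<tau> 9 = \<tau>1 9 \<and> attained (\<tau> 12 0 0)"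
  have step: "run body f \<tau> = (if f 2 \<in> M \<and> f 3 \<in> M \<and> \<tau> 12 0 0 < \<tau>1 9 (f 2) (f 3)
      then put \<tau> 12 0 0 (\<tau>1 9 (f 2) (f 3)) else \<tau>)"
    if "?I \<tau>" "f 0 = 0" "f 2 < n" "f 3 < n" for f \<tau>
    using that unfolding body_def run_Whens M1[symmetric] by (auto simp: flagged_def)
  have inv: "?I (run body f \<tau>)" if "?I \<tau>" "f 0 = 0" "f 2 < n" "f 3 < n" for f \<tau>
    unfolding step[OF that] using that(1) valF by (auto simp: put_simps)
  have inv3: "?I (run (For 3 body) f \<tau>)" if "?I \<tau>" "f 0 = 0" "f 2 < n" for f \<tau>
    by (rule for_inv[where P = ?I]) (use that inv in auto)
  have "attained 0" unfolding attained_def by (intro exI[of _ "{}"]) (auto simp: acyclic_in_def)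
  then have I2: "?I \<tau>2" unfolding \<tau>2_def by (auto simp: put_simps)
  have final: "?I (run solve_module e \<sigma>)"
    unfolding run by (rule for_inv[where P = ?I]) (use I2 e inv3 in auto)
  have max: "\<tau>1 9 s t \<le> run solve_module e \<sigma> 12 0 0" if st: "s \<in> M" "t \<in> M" for s t
  proof -
    let ?Q = "\<lambda>\<tau>. \<tau>1 9 s t \<le> \<tau> 12 0 0"
    have lt: "s < n" "t < n" using st Mn by auto
    have keep: "?I (run body f \<tau>) \<and> ?Q (run body f \<tau>)"
      if k: "?I \<tau> \<and> ?Q \<tau>" "f 0 = 0" "f 2 < n" "f 3 < n" for f \<tau>
    proof -
      have I: "?I \<tau>" using k by blast
      have "?Q (run body f \<tau>)" unfolding step[OF I k(2-4)] using k(1) by (auto simp: put_simps)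
      then show ?thesis using inv[OF I k(2-4)] by blast
    qed
    have keep3: "?I (run (For 3 body) f \<tau>) \<and> ?Q (run (For 3 body) f \<tau>)"
      if "?I \<tau> \<and> ?Q \<tau>" "f 0 = 0" "f 2 < n" for f \<tau>
      by (rule for_inv[where P = "\<lambda>\<tau>. ?I \<tau> \<and> ?Q \<tau>"]) (use that keep in auto)
    have hit: "?Q (run body f \<tau>)" if "?I \<tau>" "f 0 = 0" "f 2 = s" "f 3 = t" for f \<tau>
      using step[of \<tau> f] that st lt by (auto simp: put_simps)
    have hit3: "?Q (run (For 3 body) f \<tau>)" if "?I \<tau>" "f 0 = 0" "f 2 = s" for f \<tau>
      by (rule for_reach[where P = ?I and Q = ?Q and i = t])
        (use that lt inv keep hit[of _ "f(3 := t)"] in auto)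
    show ?thesis unfolding run
      by (rule for_reach[where P = ?I and Q = ?Q and i = s])
        (use I2 e lt inv3 keep3 hit3[of _ "e(2 := s)"] in auto)
  qed
  show ?thesis
    unfolding is_opt_def
  proof (intro conjI allI impI)
    show "\<exists>X. acyclic_in E M X \<and> sum w X = run solve_module e \<sigma> 12 0 0"
      using final unfolding attained_def by blast
    fix X assume X: "acyclic_in E M X"
    show "sum w X \<le> run solve_module e \<sigma> 12 0 0"
    proof (cases "X = {}")
      case False
      have XM: "X \<subseteq> M" using X unfolding acyclic_in_def by blast
      then have "X \<subseteq> {..<n}" using Mn by blast
      then have "card X \<le> Suc n" using card_mono[of "{..<n}" X] by simp
      then obtain s t where "s \<in> X" "t \<in> X" "sum w X \<le> \<tau>1 9 s t"
        using t1 X False unfolding covered_def by blast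
      then show ?thesis using max[of s t] XM by (meson le_trans subsetD)
    qed simp
  qed
qed

end

lemma is_opt_cong:
  assumes "\<And>v. v \<in> A \<Longrightarrow> w v = w' v" "is_opt E A w k"
  shows "is_opt E A w' k"
proof -
  have "sum w X = sum w' X" if "acyclic_in E A X" for X
    using that assms(1) unfolding acyclic_in_def by (intro sum.cong) auto
  then show ?thesis using assms(2) unfolding is_opt_def by auto
qed

context wmisp_algorithm
begin

subsection \<open>Contraction\<close>

text \<open>Vertices are visited in increasing order, so the first member of \<open>M\<close> met is
  the least one. The flag in array 13 records that it has been passed, and all later members are
  removed.\<close>

lemma contract_correct:
  assumes e: "e 0 = 0" and M: "flagged \<sigma> 6 = M" and v: "v \<in> M" "\<And>x. x \<in> M \<Longrightarrow> v \<le> x"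
  shows "flagged (run contract e \<sigma>) 4 = flagged \<sigma> 4 - (M - {v})"
    and "run contract e \<sigma> 3 x 0 = (if x = v then \<sigma> 12 0 0 else \<sigma> 3 x 0)"
proof -
  define body where "body = Whens [Eq (Arr 6 5 0) (Const 1)]
    (Cond (Eq (Arr 13 0 0) (Const 0)) (Copy 13 0 0 (Const 1) ;; Copy 3 5 0 (Arr 12 0 0)) (Copy 4 5 0 (Const 0)))"
  let ?P = "\<lambda>k \<tau>. \<tau> 6 = \<sigma> 6 \<and> \<tau> 12 = \<sigma> 12 \<and> flagged \<tau> 4 = flagged \<sigma> 4 - (M \<inter> {..<k} - {v}) \<and>
    \<tau> 13 0 0 = (if v < k then 1 else 0) \<and> (\<forall>x. \<tau> 3 x 0 = (if x = v \<and> v < k then \<sigma> 12 0 0 else \<sigma> 3 x 0))"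
  have vn: "v < n" using v(1) M unfolding flagged_def by blast
  have "?P n (run (For 5 body) e (put \<sigma> 13 0 0 0))"
  proof (rule for_induct[where P = ?P])
    show "?P 0 (put \<sigma> 13 0 0 0)" by (simp add: put_simps flagged_put)
    fix k \<tau> assume k: "k < n" and P: "?P k \<tau>"
    have kM: "\<tau> 6 k 0 = 1 \<longleftrightarrow> k \<in> M" using P M k unfolding flagged_def by auto
    have run: "run body (e(5 := k)) \<tau> = (if k \<in> M then if \<tau> 13 0 0 = 0 then put (put \<tau> 13 0 0 1) 3 k 0 (\<tau> 12 0 0)
        else put \<tau> 4 k 0 0 else \<tau>)"
      using e kM unfolding body_def run_Whens by (simp add: put_simps)
    consider "k \<notin> M" | "k = v" | "k \<in> M" "v < k" using v(2)[of k] by linarith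
    then show "?P (Suc k) (run body (e(5 := k)) \<tau>)"
    proof cases
      case 1
      then have "M \<inter> {..<Suc k} = M \<inter> {..<k}" "v < Suc k \<longleftrightarrow> v < k" using v(1) by (auto simp: less_Suc_eq)
      then show ?thesis using 1 P unfolding run by simp
    next
      case 2
      have e1: "M \<inter> {..<Suc k} - {v} = M \<inter> {..<k} - {v}" using 2 by (auto simp: less_Suc_eq)
      have "\<tau> 13 0 0 = 0" using P 2 by simp
      then have "run body (e(5 := k)) \<tau> = put (put \<tau> 13 0 0 1) 3 v 0 (\<tau> 12 0 0)" using 2 v(1) unfolding run by simp
      then show ?thesis using P 2 unfolding e1 by (auto simp: put_simps flagged_put)
    next
      case 3
      have "M \<inter> {..<Suc k} - {v} = insert k (M \<inter> {..<k} - {v})" using 3 by (auto simp: less_Suc_eq)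
      moreover have "run body (e(5 := k)) \<tau> = put \<tau> 4 k 0 0" using 3 P unfolding run by simp
      ultimately show ?thesis using P 3 by (auto simp: put_simps flagged_put)
    qed
  qed
  moreover have "run contract e \<sigma> = run (For 5 body) e (put \<sigma> 13 0 0 0)"
    using e unfolding contract_def body_def by (simp del: run.simps(5))
  moreover have "M \<inter> {..<n} = M" using M finite_flagged(2)[of \<sigma> 6] by auto
  ultimately show "flagged (run contract e \<sigma>) 4 = flagged \<sigma> 4 - (M - {v})"
    and "run contract e \<sigma> 3 x 0 = (if x = v then \<sigma> 12 0 0 else \<sigma> 3 x 0)"
    using vn by simp_all
qed

lemma contract_empty:
  assumes e: "e 0 = 0" and M: "flagged \<sigma> 6 = {}"
  shows "run contract e \<sigma> = put \<sigma> 13 0 0 0"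
proof -
  define body where "body = Whens [Eq (Arr 6 5 0) (Const 1)]
    (Cond (Eq (Arr 13 0 0) (Const 0)) (Copy 13 0 0 (Const 1) ;; Copy 3 5 0 (Arr 12 0 0)) (Copy 4 5 0 (Const 0)))"
  have "run (For 5 body) e (put \<sigma> 13 0 0 0) = put \<sigma> 13 0 0 0"
    by (rule for_inv[where P = "\<lambda>\<tau>. \<tau> = put \<sigma> 13 0 0 0"])
      (use e M in \<open>auto simp: body_def flagged_def put_simps\<close>)
  then show ?thesis using e unfolding contract_def body_def by (simp del: run.simps(5))
qed

text \<open>The search minimises size, whereas the dichotomy asks for minimality by inclusion. An
  intersection of modules is a module; if \<open>B \<inter> M\<close> has two vertices, it is no
  smaller than \<open>M\<close> and hence equal to it.\<close>

lemma minimal_module_dichotomy: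
  assumes A: "A \<subseteq> {..<n}" and M: "module_in E A M"
    and min: "\<And>B u v. module_in E A B \<Longrightarrow> u \<in> B \<Longrightarrow> v \<in> B \<Longrightarrow> u \<noteq> v \<Longrightarrow> cosize B \<le> cosize M"
    and stu: "s \<in> M" "t \<in> M" "u \<in> M" "E s t" "E t u" "E s u"
  shows "redundant E M s t u \<or> redundant E M t s u"
proof (rule redundant_dichotomy[OF tour_on_subset[OF T A] U5_free_on_subset[OF U A] _ _ stu])
  show "M \<subseteq> A" using M unfolding module_in_def by blast
  fix B b1 b2 assume B: "module_in E A B" "b1 \<in> B" "b2 \<in> B" "b1 \<in> M" "b2 \<in> M" "b1 \<noteq> b2"
  have "module_in E A (B \<inter> M)" using B(1) M unfolding module_in_def by blast
  then have "cosize (B \<inter> M) \<le> cosize M" using min B by blast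
  then have "card ({..<n} - (B \<inter> M)) \<le> card ({..<n} - M)" unfolding cosize_def by simp
  then have "{..<n} - M = {..<n} - (B \<inter> M)" by (intro card_seteq) auto
  then show "M \<subseteq> B" using \<open>M \<subseteq> A\<close> A by blast
qed

text \<open>The whole vertex set is a module, so a search without result means that at most one
  vertex is left, and the instance stays as it is; this is the reason for \<open>max 1\<close>.
  Otherwise at least one vertex disappears.\<close>

lemma round_correct:
  fixes \<sigma> :: store
  assumes e: "e 0 = 0"
  defines "\<tau> \<equiv> run (find_module ;; solve_module ;; contract) e \<sigma>"
  shows "is_opt E (flagged \<tau> 4) (\<lambda>v. \<tau> 3 v 0) k \<Longrightarrow> is_opt E (flagged \<sigma> 4) (\<lambda>v. \<sigma> 3 v 0) k"
    and "card (flagged \<tau> 4) \<le> max 1 (card (flagged \<sigma> 4) - 1)"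
proof -
  define A where "A = flagged \<sigma> 4"
  define w where "w = (\<lambda>v. \<sigma> 3 v 0)"
  define \<sigma>1 where "\<sigma>1 = run find_module e \<sigma>"
  define \<sigma>2 where "\<sigma>2 = run solve_module e \<sigma>1"
  define M where "M = flagged \<sigma>1 6"
  have \<tau>: "\<tau> = run contract e \<sigma>2" unfolding \<tau>_def \<sigma>2_def \<sigma>1_def by simp
  have fr1: "\<sigma>1 3 = \<sigma> 3"
    unfolding \<sigma>1_def by (intro run_frame)
      (simp add: find_module_def try_pair_def module_hull_def grow_round_def grow_step_def record_hull_def)
  have fr2: "\<sigma>2 3 = \<sigma>1 3" "\<sigma>2 4 = \<sigma>1 4" "\<sigma>2 6 = \<sigma>1 6"
    unfolding \<sigma>2_def by (intro run_frame,
      simp add: solve_module_def relax_round_def relax_def check_def raise_def)+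
  have inv: "module_inv A \<sigma>1" using find_module_correct(1)[of e \<sigma>, OF e] unfolding \<sigma>1_def A_def .
  have A1: "flagged \<sigma>1 4 = A" using inv unfolding module_inv_def by blast
  have A2: "flagged \<sigma>2 4 = A" using A1 fr2 unfolding flagged_def by simp
  have M2: "flagged \<sigma>2 6 = M" using fr2 unfolding M_def flagged_def by simp
  have min: "cosize B \<le> \<sigma>1 8 0 0" if "module_in E A B" "u \<in> B" "v \<in> B" "u \<noteq> v" for B u v
    using find_module_correct(2)[of e \<sigma> B u v] that e unfolding A_def \<sigma>1_def by blast
  have An: "A \<subseteq> {..<n}" unfolding A_def by (rule finite_flagged)
  have fA: "finite A" unfolding A_def by (rule finite_flagged)
  have goal: "(is_opt E (flagged \<tau> 4) (\<lambda>v. \<tau> 3 v 0) k \<longrightarrow> is_opt E A w k) \<and> card (flagged \<tau> 4) \<le> max 1 (card A - 1)"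
  proof (cases "M = {}")
    case True
    then have z: "\<sigma>1 8 0 0 = 0" using inv unfolding module_inv_def M_def by blast
    have "card A \<le> 1"
    proof (rule ccontr)
      assume "\<not> card A \<le> 1"
      then have "\<not> (\<forall>u\<in>A. \<forall>v\<in>A. u = v)" using card_le_Suc0_iff_eq[OF fA] by simp
      then obtain u v where "u \<in> A" "v \<in> A" "u \<noteq> v" by blast
      moreover have "module_in E A A" unfolding module_in_def by blast
      ultimately show False using min[of A u v] z unfolding cosize_def by simp
    qed
    moreover have "\<tau> = put \<sigma>2 13 0 0 0"
      unfolding \<tau> using contract_empty[of e \<sigma>2] e M2 True by simp
    then have "flagged \<tau> 4 = A" "(\<lambda>v. \<tau> 3 v 0) = w"
      using A2 fr1 fr2 unfolding w_def by (simp_all add: flagged_put put_simps)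
    ultimately show ?thesis by simp
  next
    case False
    then have 8: "\<sigma>1 8 0 0 = cosize M" and mod: "module_in E A M" and two: "\<exists>u\<in>M. \<exists>v\<in>M. u \<noteq> v"
      using inv unfolding module_inv_def M_def by blast+
    have dich: "redundant E M s t u \<or> redundant E M t s u"
      if "s \<in> M" "t \<in> M" "u \<in> M" "E s t" "E t u" "E s u" for s t u
      by (rule minimal_module_dichotomy[OF An mod _ that]) (use min 8 in auto)
    define r where "r = \<sigma>2 12 0 0"
    have opt: "is_opt E M w r"
      using solve_module_correct[of e \<sigma>1 M w] e dich fr1 unfolding M_def r_def \<sigma>2_def w_def by simp
    have fM: "finite M" unfolding M_def by (rule finite_flagged)
    define v where "v = Min M"
    have v: "v \<in> M" "\<And>x. x \<in> M \<Longrightarrow> v \<le> x" unfolding v_def using fM False by auto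
    have c: "flagged \<tau> 4 = A - (M - {v})" "\<tau> 3 x 0 = (if x = v then r else w x)" for x
      using contract_correct[of e \<sigma>2 M v] e M2 v A2 fr1 fr2 unfolding \<tau> r_def w_def by auto
    have w': "(\<lambda>x. \<tau> 3 x 0) = w(v := r)" using c(2) by auto
    have MA: "M \<subseteq> A" using mod unfolding module_in_def by blast
    have "flagged \<tau> 4 \<subset> A" using two v(1) MA unfolding c(1) by blast
    then have "card (flagged \<tau> 4) < card A" using fA psubset_card_mono by blast
    moreover have "is_opt E A w k" if "is_opt E (flagged \<tau> 4) (\<lambda>v. \<tau> 3 v 0) k"
      using is_opt_contract[OF tour_on_subset[OF T An] mod v(1) opt] that unfolding w' c(1) .
    ultimately show ?thesis by auto
  qed
  then show "is_opt E (flagged \<tau> 4) (\<lambda>v. \<tau> 3 v 0) k \<Longrightarrow> is_opt E (flagged \<sigma> 4) (\<lambda>v. \<sigma> 3 v 0) k"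
    and "card (flagged \<tau> 4) \<le> max 1 (card (flagged \<sigma> 4) - 1)"
    unfolding A_def w_def by blast+
qed

lemma collect_correct:
  assumes e: "e 0 = 0"
  shows "run collect e \<sigma> 14 0 0 = (\<Sum>v\<in>flagged \<sigma> 4. \<sigma> 3 v 0)"
proof -
  define body where "body = Whens [Eq (Arr 4 5 0) (Const 1)] (Put 14 0 0 Add (Arr 14 0 0) (Arr 3 5 0))"
  have "run (For 5 body) e (put \<sigma> 14 0 0 0) 14 0 0 = (\<Sum>v\<in>flagged \<sigma> 4 \<inter> {..<n}. \<sigma> 3 v 0) \<and>
    run (For 5 body) e (put \<sigma> 14 0 0 0) 3 = \<sigma> 3 \<and> run (For 5 body) e (put \<sigma> 14 0 0 0) 4 = \<sigma> 4"
  proof (rule for_induct[where P = "\<lambda>k \<tau>. \<tau> 14 0 0 = (\<Sum>v\<in>flagged \<sigma> 4 \<inter> {..<k}. \<sigma> 3 v 0) \<and> \<tau> 3 = \<sigma> 3 \<and> \<tau> 4 = \<sigma> 4"])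
    fix k and \<tau> :: store
    assume k: "k < n" and P: "\<tau> 14 0 0 = (\<Sum>v\<in>flagged \<sigma> 4 \<inter> {..<k}. \<sigma> 3 v 0) \<and> \<tau> 3 = \<sigma> 3 \<and> \<tau> 4 = \<sigma> 4"
    have "flagged \<sigma> 4 \<inter> {..<Suc k} = (if \<sigma> 4 k 0 = 1 then insert k (flagged \<sigma> 4 \<inter> {..<k}) else flagged \<sigma> 4 \<inter> {..<k})"
      using k unfolding flagged_def by (auto simp: less_Suc_eq)
    then show "run body (e(5 := k)) \<tau> 14 0 0 = (\<Sum>v\<in>flagged \<sigma> 4 \<inter> {..<Suc k}. \<sigma> 3 v 0) \<and>
      run body (e(5 := k)) \<tau> 3 = \<sigma> 3 \<and> run body (e(5 := k)) \<tau> 4 = \<sigma> 4"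
      using e P unfolding body_def by (simp add: put_simps)
  qed (simp add: put_simps)
  moreover have "flagged \<sigma> 4 \<inter> {..<n} = flagged \<sigma> 4" using finite_flagged(2)[of \<sigma> 4] by blast
  ultimately show ?thesis using e unfolding collect_def body_def by (simp del: run.simps(5))
qed

text \<open>The product in place of the least common multiple: it arises by multiplying with input
  numbers only, the one form of multiplication that the growth bound admits.\<close>

definition denom :: nat where "denom = (\<Prod>v<n. den v)"

lemma prepare_correct:
  assumes e: "e 0 = 0"
  shows "run prepare e \<sigma> 2 0 0 = denom" "flagged (run prepare e \<sigma>) 4 = {..<n}"
    "v < n \<Longrightarrow> run prepare e \<sigma> 3 v 0 = denom div den v * num v"
proof -
  define b1 where "b1 = Put 2 0 0 Mul (Arr 2 0 0) (Den 5)"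
  \<comment> \<open>Division precedes multiplication, so that again the right factor is an input
    number.\<close>
  define b2 where "b2 = (Put 3 5 0 Div (Arr 2 0 0) (Den 5) ;; Put 3 5 0 Mul (Arr 3 5 0) (Num 5) ;; Copy 4 5 0 (Const 1))"
  define \<sigma>1 where "\<sigma>1 = run (For 5 b1) e (put \<sigma> 2 0 0 1)"
  have 1: "\<sigma>1 2 0 0 = denom"
    unfolding \<sigma>1_def denom_def
    by (rule for_induct[where P = "\<lambda>k \<tau>. \<tau> 2 0 0 = (\<Prod>v<k. den v)"])
      (use e in \<open>auto simp: put_simps b1_def\<close>)
  have run: "run prepare e \<sigma> = run (For 5 b2) e \<sigma>1"
    using e unfolding prepare_def b1_def b2_def \<sigma>1_def by (simp del: run.simps(5))
  have "run prepare e \<sigma> 2 0 0 = denom \<and> (\<forall>v<n. run prepare e \<sigma> 3 v 0 = denom div den v * num v \<and> run prepare e \<sigma> 4 v 0 = 1)"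
    unfolding run
    by (rule for_induct[where P = "\<lambda>k \<tau>. \<tau> 2 0 0 = denom \<and> (\<forall>v<k. \<tau> 3 v 0 = denom div den v * num v \<and> \<tau> 4 v 0 = 1)"])
      (use e 1 in \<open>auto simp: put_simps b2_def less_Suc_eq\<close>)
  then show "run prepare e \<sigma> 2 0 0 = denom" "flagged (run prepare e \<sigma>) 4 = {..<n}"
    "v < n \<Longrightarrow> run prepare e \<sigma> 3 v 0 = denom div den v * num v"
    unfolding flagged_def by auto
qed

lemma algorithm_correct:
  assumes e: "e 0 = 0"
  shows "run algorithm e \<sigma> 2 0 0 = denom"
    and "is_opt E {..<n} (\<lambda>v. denom div den v * num v) (run algorithm e \<sigma> 14 0 0)"
proof -
  define body where "body = (find_module ;; solve_module ;; contract)"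
  define \<sigma>1 where "\<sigma>1 = run prepare e \<sigma>"
  define \<sigma>2 where "\<sigma>2 = run (For 1 body) e \<sigma>1"
  have run: "run algorithm e \<sigma> = run collect e \<sigma>2"
    unfolding algorithm_def \<sigma>2_def \<sigma>1_def body_def by simp
  note prep = prepare_correct[where e = e and \<sigma> = \<sigma>, OF e, folded \<sigma>1_def]
  have "\<sigma>2 2 = \<sigma>1 2"
    unfolding \<sigma>2_def body_def by (intro run_frame)
      (simp add: find_module_def try_pair_def module_hull_def grow_round_def grow_step_def record_hull_def
        solve_module_def relax_round_def relax_def check_def raise_def contract_def)
  moreover have "run collect e \<sigma>2 2 = \<sigma>2 2" by (intro run_frame) (simp add: collect_def)
  ultimately show "run algorithm e \<sigma> 2 0 0 = denom" using prep(1) unfolding run by simp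
  define w where "w = (\<lambda>v. \<sigma>1 3 v 0)"
  \<comment> \<open>The invariant points backwards: an optimum of the remaining instance is one of
    the original. After \<open>n\<close> rounds at most one vertex remains, and its weight is the
    answer.\<close>
  have "(\<forall>r. is_opt E (flagged \<sigma>2 4) (\<lambda>v. \<sigma>2 3 v 0) r \<longrightarrow> is_opt E {..<n} w r) \<and> card (flagged \<sigma>2 4) \<le> max 1 (n - n)"
    unfolding \<sigma>2_def
  proof (rule for_induct[where P = "\<lambda>k \<tau>. (\<forall>r. is_opt E (flagged \<tau> 4) (\<lambda>v. \<tau> 3 v 0) r \<longrightarrow> is_opt E {..<n} w r) \<and>
      card (flagged \<tau> 4) \<le> max 1 (n - k)"])
    show "(\<forall>r. is_opt E (flagged \<sigma>1 4) (\<lambda>v. \<sigma>1 3 v 0) r \<longrightarrow> is_opt E {..<n} w r) \<and> card (flagged \<sigma>1 4) \<le> max 1 (n - 0)"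
      using prep(2) unfolding w_def by simp
    fix k \<tau>
    assume k: "k < n" and P: "(\<forall>r. is_opt E (flagged \<tau> 4) (\<lambda>v. \<tau> 3 v 0) r \<longrightarrow> is_opt E {..<n} w r) \<and>
      card (flagged \<tau> 4) \<le> max 1 (n - k)"
    have e1: "(e(1 := k)) 0 = 0" using e by simp
    note R = round_correct[of "e(1 := k)" \<tau>, OF e1, folded body_def]
    show "(\<forall>r. is_opt E (flagged (run body (e(1 := k)) \<tau>) 4) (\<lambda>v. run body (e(1 := k)) \<tau> 3 v 0) r \<longrightarrow>
        is_opt E {..<n} w r) \<and> card (flagged (run body (e(1 := k)) \<tau>) 4) \<le> max 1 (n - Suc k)"
      using R(1) R(2) P by force
  qed
  then have opt: "is_opt E (flagged \<sigma>2 4) (\<lambda>v. \<sigma>2 3 v 0) r \<Longrightarrow> is_opt E {..<n} w r" and "card (flagged \<sigma>2 4) \<le> 1" for r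
    by auto
  then have "is_opt E {..<n} w (\<Sum>v\<in>flagged \<sigma>2 4. \<sigma>2 3 v 0)"
    using is_opt_card_le_1[OF finite_flagged(1)] by blast
  then show "is_opt E {..<n} (\<lambda>v. denom div den v * num v) (run algorithm e \<sigma> 14 0 0)"
    unfolding run collect_correct[of e, OF e]
    by (rule is_opt_cong[rotated]) (use prep(3) in \<open>auto simp: w_def\<close>)
qed

end

section \<open>The theorem\<close>

text \<open>Sending \<open>p1\<close> to \<open>p5\<close> to 1 to 5 is an isomorphism onto
  \<open>U_tour 5\<close>: the ten arcs of the pattern already orient every pair of the five
  vertices, so the induced subtournament has no further arc.\<close>

lemma U5_free_on_of_tournament_free:
  assumes G: "tournament G" and free: "tournament_free G (U_tour 5)"
  shows "U5_free_on (\<lambda>u v. (u, v) \<in> parcs G) (pverts G)"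
  unfolding U5_free_on_def
proof (intro ballI notI)
  fix p1 p2 p3 p4 p5
  assume p: "p1 \<in> pverts G" "p2 \<in> pverts G" "p3 \<in> pverts G" "p4 \<in> pverts G" "p5 \<in> pverts G"
    and U: "U5_pattern (\<lambda>u v. (u, v) \<in> parcs G) p1 p2 p3 p4 p5"
  interpret tournament G by (rule G)
  have irr: "(u, u) \<notin> parcs G" for u using pair_no_loops[of "(u, u)"] by auto
  have asym: "(v, u) \<notin> parcs G" if "(u, v) \<in> parcs G" "u \<in> pverts G" "v \<in> pverts G" for u v
    using that one_arc[of u v] irr by (cases "u = v") auto
  define arcs5 where "arcs5 = {(p2,p1),(p1,p3),(p2,p3),(p2,p4),(p3,p4),(p3,p5),(p4,p5),(p4,p1),(p5,p1),(p5,p2)}"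
  have in5: "arcs5 \<subseteq> parcs G" using U unfolding arcs5_def U5_pattern_def by simp
  have dist: "p1 \<noteq> p2" "p1 \<noteq> p3" "p1 \<noteq> p4" "p1 \<noteq> p5" "p2 \<noteq> p3" "p2 \<noteq> p4" "p2 \<noteq> p5" "p3 \<noteq> p4" "p3 \<noteq> p5" "p4 \<noteq> p5"
    using in5 irr unfolding arcs5_def by auto
  define X where "X = {p1, p2, p3, p4, p5}"
  have sub: "{e \<in> parcs G. fst e \<in> X \<and> snd e \<in> X} = arcs5"
  proof
    show "arcs5 \<subseteq> {e \<in> parcs G. fst e \<in> X \<and> snd e \<in> X}"
      using in5 unfolding X_def by (auto simp: arcs5_def)
    have all: "(u, v) \<in> arcs5 \<or> (v, u) \<in> arcs5 \<or> u = v" if "u \<in> X" "v \<in> X" for u v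
      using that unfolding X_def arcs5_def by auto
    show "{e \<in> parcs G. fst e \<in> X \<and> snd e \<in> X} \<subseteq> arcs5"
    proof
      fix e assume e: "e \<in> {e \<in> parcs G. fst e \<in> X \<and> snd e \<in> X}"
      moreover have "X \<subseteq> pverts G" using p unfolding X_def by simp
      ultimately show "e \<in> arcs5"
        using all[of "fst e" "snd e"] in5 irr asym[of "fst e" "snd e"] by (cases e) auto
    qed
  qed
  define f where "f x = (if x = p1 then 1 else if x = p2 then 2 else if x = p3 then 3 else if x = p4 then 4 else 5 :: nat)" for x
  have f: "f p1 = 1" "f p2 = 2" "f p3 = 3" "f p4 = 4" "f p5 = 5" using dist unfolding f_def by auto
  have inj: "inj_on f X" unfolding X_def inj_on_def by (simp add: f)
  define h where "h = \<lparr>iso_verts = f, iso_arcs = map_prod f f, iso_head = snd, iso_tail = fst\<rparr>"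
  define H where "H = with_proj G \<restriction> X"
  have H: "verts H = X" "arcs H = arcs5" "tail H = fst" "head H = snd"
    unfolding H_def induce_subgraph_def with_proj_def using sub by auto
  have arcsX: "fst e \<in> X" "snd e \<in> X" if "e \<in> arcs5" for e using that sub by blast+
  have "pre_digraph.digraph_isomorphism H h"
    unfolding pre_digraph.digraph_isomorphism_def
  proof (intro conjI ballI)
    show "wf_digraph H" by unfold_locales (use H arcsX in auto)
    show "inj_on (iso_verts h) (verts H)" using inj H unfolding h_def by simp
    have "arcs5 \<subseteq> X \<times> X" using arcsX by (auto simp: mem_Times_iff)
    then show "inj_on (iso_arcs h) (arcs H)"
      using map_prod_inj_on[OF inj inj] H unfolding h_def by (auto intro: inj_on_subset)
  qed (use H in \<open>auto simp: h_def\<close>)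
  moreover have "with_proj (U_tour 5) = app_iso h H"
  proof -
    have "f ` X = {1..5}" unfolding X_def by (auto simp: f)
    moreover have "map_prod f f ` arcs5 = parcs (U_tour 5)"
      unfolding arcs5_def parcs_U_tour_5 by (simp add: f)
    moreover have "pverts (U_tour 5) = {1..5}" unfolding U_tour_def by (simp add: Let_def)
    ultimately show ?thesis unfolding app_iso_def with_proj_def using H by (simp add: h_def)
  qed
  ultimately have "digraph_iso (with_proj G \<restriction> X) (with_proj (U_tour 5))"
    unfolding digraph_iso_def H_def by blast
  moreover have "X \<subseteq> pverts G" using p unfolding X_def by simp
  ultimately show False using free[unfolded tournament_free_def, rule_format, of X] by simp
qed

lemma independent_set_iff_acyclic_in:
  "independent_set G X \<longleftrightarrow> acyclic_in (\<lambda>u v. (u, v) \<in> parcs G) (pverts G) X"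
proof -
  have "(u, v) \<in> arcs_ends (with_proj G \<restriction> X) \<longleftrightarrow> u \<in> X \<and> v \<in> X \<and> (u, v) \<in> parcs G" for u v
    by (auto simp: induce_subgraph_def arcs_ends_conv with_proj_def image_iff)
  then show ?thesis
    unfolding independent_set_def acyclic_in_def trans_def by blast
qed

lemma max_independent_weight_eq:
  assumes fin: "finite (pverts G)" and D: "0 < (D::nat)"
    and w: "\<And>v. v \<in> pverts G \<Longrightarrow> w v = of_nat (W v) / of_nat D"
    and opt: "is_opt (\<lambda>u v. (u, v) \<in> parcs G) (pverts G) W k"
  shows "max_independent_weight G w = of_nat k / of_nat D"
  unfolding max_independent_weight_def independent_set_iff_acyclic_in
proof (rule Max_eqI)
  have sum: "(\<Sum>v\<in>X. w v) = of_nat (sum W X) / of_nat D"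
    if "acyclic_in (\<lambda>u v. (u, v) \<in> parcs G) (pverts G) X" for X
  proof -
    have "(\<Sum>v\<in>X. w v) = (\<Sum>v\<in>X. of_nat (W v) / of_nat D)"
      using that w unfolding acyclic_in_def by (intro sum.cong) auto
    then show ?thesis by (simp add: sum_divide_distrib)
  qed
  have "{\<Sum>v\<in>X. w v | X. acyclic_in (\<lambda>u v. (u, v) \<in> parcs G) (pverts G) X} \<subseteq> sum w ` Pow (pverts G)"
    unfolding acyclic_in_def by blast
  then show "finite {\<Sum>v\<in>X. w v | X. acyclic_in (\<lambda>u v. (u, v) \<in> parcs G) (pverts G) X}"
    using fin by (simp add: finite_subset)
  show "of_nat k / of_nat D \<in> {\<Sum>v\<in>X. w v | X. acyclic_in (\<lambda>u v. (u, v) \<in> parcs G) (pverts G) X}"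
    using opt sum unfolding is_opt_def by force
  fix y assume "y \<in> {\<Sum>v\<in>X. w v | X. acyclic_in (\<lambda>u v. (u, v) \<in> parcs G) (pverts G) X}"
  then obtain X where X: "acyclic_in (\<lambda>u v. (u, v) \<in> parcs G) (pverts G) X" "y = of_nat (sum W X) / of_nat D"
    using sum by blast
  then have "sum W X \<le> k" using opt unfolding is_opt_def by blast
  then have "(of_nat (sum W X) :: rat) \<le> of_nat k" by (rule of_nat_mono)
  then show "y \<le> of_nat k / of_nat D" unfolding X(2) using D by (intro divide_right_mono) auto
qed

theorem theorem1p4:
  shows "poly_time_solvable {(G, w) \<in> WMISP. tournament_free G (U_tour 5)} wmisp_encode wmisp_answer"
  unfolding poly_time_solvable_def
\<comment> \<open>Array 14 holds the optimum for the scaled weights and array 2 the common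
  denominator. The fraction may be output unreduced.\<close>
proof (rule exI[of _ "full_code algorithm 14 2"], rule exI[of _ "time_bound algorithm"], rule ballI)
  fix x assume "x \<in> {(G, w) \<in> WMISP. tournament_free G (U_tour 5)}"
  then obtain G w n where x: "x = (G, w)" and G: "tournament G" "pverts G = {..<n}"
    and pos: "\<And>v. v < n \<Longrightarrow> 0 \<le> w v" and free: "tournament_free G (U_tour 5)"
    unfolding WMISP_def by auto
  define adj where "adj = (\<lambda>u v. if (u, v) \<in> parcs G then 1 else 0 :: nat)"
  define num where "num = (\<lambda>v. nat (fst (quotient_of (w v))))"
  define den where "den = (\<lambda>v. nat (snd (quotient_of (w v))))"
  interpret tournament G by (rule G)
  interpret I: wmisp_input n adj num den "input_size (wmisp_encode x)" "load (wmisp_encode x)"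
    unfolding x adj_def num_def den_def by (rule wmisp_input_encode[OF G])
  have den: "0 < den v" for v using quotient_of_denom_pos'[of "w v"] unfolding den_def by simp
  have wv: "w v = of_nat (num v) / of_nat (den v)" if "v < n" for v
  proof -
    have q: "quotient_of (w v) = (fst (quotient_of (w v)), snd (quotient_of (w v)))" by simp
    have "0 < snd (quotient_of (w v))" by (rule quotient_of_denom_pos')
    moreover have eq: "w v = of_int (fst (quotient_of (w v))) / of_int (snd (quotient_of (w v)))"
      by (rule quotient_of_div[OF q])
    \<comment> \<open>A positive denominator gives the numerator the sign of the weight, so
      \<open>nat\<close> loses nothing.\<close>
    ultimately have "0 \<le> fst (quotient_of (w v))"
      using pos[OF that] by (metis of_int_0_le_iff of_int_pos zero_le_divide_iff not_less)
    then show ?thesis using eq \<open>0 < snd _\<close> unfolding num_def den_def by simp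
  qed
  have E: "(\<lambda>u v. adj u v = 1) = (\<lambda>u v. (u, v) \<in> parcs G)" unfolding adj_def by auto
  have tour: "tour_on (\<lambda>u v. (u, v) \<in> parcs G) {..<n}"
    unfolding tour_on_def
  proof (intro conjI ballI)
    fix u v assume "u \<in> {..<n}" "v \<in> {..<n}"
    then show "(u, v) \<in> parcs G \<longleftrightarrow> u \<noteq> v \<and> (v, u) \<notin> parcs G"
      using one_arc[of u v] pair_no_loops[of "(u, u)"] G(2) by auto
  qed simp
  interpret A: wmisp_algorithm n adj num den "\<lambda>u v. adj u v = 1"
    by unfold_locales
      (use tour U5_free_on_of_tournament_free[OF G(1) free] den in \<open>auto simp: E G(2) adj_def\<close>)
  define \<sigma> where "\<sigma> = I.run algorithm (\<lambda>_. 0) (\<lambda>_ _ _. 0)"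
  obtain t m where m: "exec (full_code algorithm 14 2) (load (wmisp_encode x)) t m"
    "t \<le> poly (time_bound algorithm) (input_size (wmisp_encode x))" "m 0 = \<sigma> 14 0 0" "m 1 = \<sigma> 2 0 0"
    using I.full_code_time_bound[OF wf_algorithm, of 14 2] unfolding \<sigma>_def by auto
  have D: "\<sigma> 2 0 0 = A.denom" and opt: "is_opt (\<lambda>u v. (u, v) \<in> parcs G) (pverts G)
      (\<lambda>v. A.denom div den v * num v) (\<sigma> 14 0 0)"
    using A.algorithm_correct[of "\<lambda>_. 0" "\<lambda>_ _ _. 0"] unfolding \<sigma>_def E G(2) by auto
  have Dpos: "0 < A.denom" unfolding A.denom_def using den by (simp add: prod_pos)
  have "max_independent_weight G w = of_nat (\<sigma> 14 0 0) / of_nat A.denom"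
  proof (rule max_independent_weight_eq[OF _ Dpos _ opt])
    show "finite (pverts G)" using G(2) by simp
    fix v assume "v \<in> pverts G"
    then have v: "v < n" using G(2) by simp
    \<comment> \<open>Divisibility makes the integer division performed by the program
      exact.\<close>
    have "den v dvd A.denom" unfolding A.denom_def using v by (intro dvd_prodI) auto
    then obtain c where c: "A.denom = den v * c" by blast
    then have "0 < c" "A.denom div den v = c" using Dpos den[of v] by auto
    then show "w v = of_nat (A.denom div den v * num v) / of_nat A.denom"
      using wv[OF v] den[of v] unfolding c by simp
  qed
  then have "wmisp_answer x m" unfolding wmisp_answer_def x using m D Dpos by simp
  then show "\<exists>t m. exec (full_code algorithm 14 2) (load (wmisp_encode x)) t m \<and>
      t \<le> poly (time_bound algorithm) (input_size (wmisp_encode x)) \<and> wmisp_answer x m"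
    using m by blast
qed

end
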